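(* POHPP and POHCP can be solved in $(k+1)!\cdot 2^k\cdot n^{O(1)}$ time on an $n$-vertex graph $G$ when given, together with the input, a set $F\subseteq E(G)$ with $|F|\le k$ such that $G-F$ is a block graph.
   Context: All graphs are finite and simple. A graph is 2-connected if it is connected and has no cut vertex; a block is an inclusion-maximal 2-connected induced subgraph; a block graph is a graph all of whose blocks are cliques. A partial order $\pi$ on $V(G)$ is a reflexive, antisymmetric, transitive relation. An ordered Hamiltonian path $(v_1,\dots,v_n)$ of $G$ (each vertex exactly once, consecutive vertices adjacent) is $\pi$-extending if $(v_i,v_j)\in\pi$ implies $i\le j$. POHPP: given $G$ and $\pi$, decide whether $G$ has a $\pi$-extending ordered Hamiltonian path. POHCP: given $G$ and $\pi$, decide whether $G$ has a $\pi$-extending ordered Hamiltonian path $(v_1,\dots,v_n)$ with $v_1v_n\in E(G)$. *)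

theory Defs
  imports "HOL-Computational_Algebra.Polynomial"
begin

section \<open>Graphs\<close>

text \<open>A graph is given by a vertex set \<open>V\<close> and a set \<open>E\<close> of two-element subsets of \<open>V\<close>.\<close>

definition simple_graph :: "'a set \<Rightarrow> 'a set set \<Rightarrow> bool" where
  "simple_graph V E \<longleftrightarrow> finite V \<and> (\<forall>e\<in>E. e \<subseteq> V \<and> card e = 2)"

definition induced_edges :: "'a set set \<Rightarrow> 'a set \<Rightarrow> 'a set set" where
  "induced_edges E U = {e \<in> E. e \<subseteq> U}"

definition reachable :: "'a set set \<Rightarrow> 'a \<Rightarrow> 'a \<Rightarrow> bool" where
  "reachable E u v \<longleftrightarrow> (u, v) \<in> {(x, y). {x, y} \<in> E}\<^sup>*"

definition connected_graph :: "'a set \<Rightarrow> 'a set set \<Rightarrow> bool" where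
  "connected_graph V E \<longleftrightarrow> V \<noteq> {} \<and> (\<forall>u\<in>V. \<forall>v\<in>V. reachable E u v)"

text \<open>A cut vertex separates two other vertices of its component. In particular, the graphs with one
  vertex and with two adjacent vertices have no cut vertex, so both are 2-connected.\<close>

definition cut_vertex :: "'a set \<Rightarrow> 'a set set \<Rightarrow> 'a \<Rightarrow> bool" where
  "cut_vertex V E x \<longleftrightarrow> x \<in> V \<and>
     (\<exists>u \<in> V - {x}. \<exists>v \<in> V - {x}. reachable E u v \<and> \<not> reachable (induced_edges E (V - {x})) u v)"

definition two_connected :: "'a set \<Rightarrow> 'a set set \<Rightarrow> bool" where
  "two_connected V E \<longleftrightarrow> connected_graph V E \<and> (\<nexists>x. cut_vertex V E x)"

definition is_block :: "'a set \<Rightarrow> 'a set set \<Rightarrow> 'a set \<Rightarrow> bool" where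
  "is_block V E B \<longleftrightarrow> B \<subseteq> V \<and> two_connected B (induced_edges E B) \<and>
     (\<forall>B'. B \<subset> B' \<and> B' \<subseteq> V \<longrightarrow> \<not> two_connected B' (induced_edges E B'))"

definition clique :: "'a set set \<Rightarrow> 'a set \<Rightarrow> bool" where
  "clique E B \<longleftrightarrow> (\<forall>u\<in>B. \<forall>v\<in>B. u \<noteq> v \<longrightarrow> {u, v} \<in> E)"

definition block_graph :: "'a set \<Rightarrow> 'a set set \<Rightarrow> bool" where
  "block_graph V E \<longleftrightarrow> (\<forall>B. is_block V E B \<longrightarrow> clique E B)"

definition ordered_ham_path :: "'a set \<Rightarrow> 'a set set \<Rightarrow> 'a list \<Rightarrow> bool" where
  "ordered_ham_path V E vs \<longleftrightarrow>
     distinct vs \<and> set vs = V \<and> (\<forall>i. Suc i < length vs \<longrightarrow> {vs ! i, vs ! Suc i} \<in> E)"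

definition extending :: "'a rel \<Rightarrow> 'a list \<Rightarrow> bool" where
  "extending \<pi> vs \<longleftrightarrow> (\<forall>i < length vs. \<forall>j < length vs. (vs ! i, vs ! j) \<in> \<pi> \<longrightarrow> i \<le> j)"

definition pohpp :: "'a set \<Rightarrow> 'a set set \<Rightarrow> 'a rel \<Rightarrow> bool" where
  "pohpp V E \<pi> \<longleftrightarrow> (\<exists>vs. ordered_ham_path V E vs \<and> extending \<pi> vs)"

definition pohcp :: "'a set \<Rightarrow> 'a set set \<Rightarrow> 'a rel \<Rightarrow> bool" where
  "pohcp V E \<pi> \<longleftrightarrow>
     (\<exists>vs. ordered_ham_path V E vs \<and> extending \<pi> vs \<and> vs \<noteq> [] \<and> {hd vs, last vs} \<in> E)"


section \<open>Random access machine with unit cost\<close>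

text \<open>A state consists of registers and of arrays (one for each array name), all holding natural
  numbers. Programs mention finitely many registers and arrays, and indirect addressing is available
  inside the arrays. The only arithmetic is adding or subtracting one. Hence after \<open>t\<close> steps no number
  exceeds the initial numbers and the program constants by more than \<open>t\<close>, so that charging one time
  unit per step cannot be exploited by building very long numbers: logarithmic cost differs from unit
  cost only by a factor logarithmic in the running time.\<close>

type_synonym state = "(nat \<Rightarrow> nat) \<times> (nat \<Rightarrow> nat \<Rightarrow> nat)"

datatype prog =
    Skip
  | Const nat nat
  | Copy nat nat
  | Inc nat
  | Dec nat
  | Load nat nat nat
  | Store nat nat nat
  | Seq prog prog
  | IfLess nat nat prog prog
  | WhileLess nat nat prog

text \<open>\<open>exec c s t s'\<close>: program \<open>c\<close> started in state \<open>s\<close> halts after exactly \<open>t\<close> steps in state \<open>s'\<close>.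
  \<open>Dec\<close> leaves zero unchanged.\<close>

inductive exec :: "prog \<Rightarrow> state \<Rightarrow> nat \<Rightarrow> state \<Rightarrow> bool" where
  Skip: "exec Skip s 1 s"
| Const: "exec (Const x m) (r, a) 1 (r(x := m), a)"
| Copy: "exec (Copy x y) (r, a) 1 (r(x := r y), a)"
| Inc: "exec (Inc x) (r, a) 1 (r(x := r x + 1), a)"
| Dec: "exec (Dec x) (r, a) 1 (r(x := r x - 1), a)"
| Load: "exec (Load x A y) (r, a) 1 (r(x := a A (r y)), a)"
| Store: "exec (Store A x y) (r, a) 1 (r, a(A := (a A)(r x := r y)))"
| Seq: "exec c s t s' \<Longrightarrow> exec d s' t' s'' \<Longrightarrow> exec (Seq c d) s (t + t') s''"
| IfTrue: "fst s x < fst s y \<Longrightarrow> exec c s t s' \<Longrightarrow> exec (IfLess x y c d) s (t + 1) s'"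
| IfFalse: "\<not> fst s x < fst s y \<Longrightarrow> exec d s t s' \<Longrightarrow> exec (IfLess x y c d) s (t + 1) s'"
| WhileTrue: "fst s x < fst s y \<Longrightarrow> exec c s t s' \<Longrightarrow> exec (WhileLess x y c) s' t' s''
    \<Longrightarrow> exec (WhileLess x y c) s (t + t' + 1) s''"
| WhileFalse: "\<not> fst s x < fst s y \<Longrightarrow> exec (WhileLess x y c) s 1 s"

inductive_cases SkipE: "exec Skip s t s'"
  and ConstE: "exec (Const x m) s t s'"
  and CopyE: "exec (Copy x y) s t s'"
  and IncE: "exec (Inc x) s t s'"
  and DecE: "exec (Dec x) s t s'"
  and LoadE: "exec (Load x A y) s t s'"
  and StoreE: "exec (Store A x y) s t s'"
  and SeqE: "exec (Seq c d) s t s'"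
  and IfE: "exec (IfLess x y c d) s t s'"
  and WhileE: "exec (WhileLess x y c) s t s'"

lemma exec_deterministic:
  "exec c s t s' \<Longrightarrow> exec c s u s'' \<Longrightarrow> t = u \<and> s' = s''"
proof (induction arbitrary: u s'' rule: exec.induct)
  case (Seq c s t s1 d t' s2)
  from Seq.prems show ?case
  proof (rule SeqE)
    fix v v' r
    assume "u = v + v'" "exec c s v r" "exec d r v' s''"
    with Seq.IH(1)[of v r] Seq.IH(2)[of v' s''] show ?thesis by simp
  qed
next
  case (IfTrue s x y c t s1 d)
  from IfTrue.prems show ?case
  proof (rule IfE)
    fix v
    assume "u = Suc v" "exec c s v s''"
    with IfTrue.IH[of v s''] show ?thesis by simp
  qed (use IfTrue.hyps in simp)
next
  case (IfFalse s x y d t s1 c)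
  from IfFalse.prems show ?case
  proof (rule IfE)
    fix v
    assume "u = Suc v" "exec d s v s''"
    with IfFalse.IH[of v s''] show ?thesis by simp
  qed (use IfFalse.hyps in simp)
next
  case (WhileTrue s x y c t s1 t' s2)
  from WhileTrue.prems show ?case
  proof (rule WhileE)
    fix v r v'
    assume "u = Suc (v + v')" "exec c s v r" "exec (WhileLess x y c) r v' s''"
    with WhileTrue.IH(1)[of v r] WhileTrue.IH(2)[of v' s''] show ?thesis by simp
  qed (use WhileTrue.hyps in simp)
next
  case (WhileFalse s x y c)
  from WhileFalse.prems show ?case
    by (rule WhileE) (use WhileFalse.hyps in simp_all)
next
  case Skip then show ?case by (rule SkipE) simp
next
  case Const then show ?case by (rule ConstE) simp
next
  case Copy then show ?case by (rule CopyE) simp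
next
  case Inc then show ?case by (rule IncE) simp
next
  case Dec then show ?case by (rule DecE) simp
next
  case Load then show ?case by (rule LoadE) simp
next
  case Store then show ?case by (rule StoreE) simp
qed

text \<open>Input and output conventions: an instance on the vertices \<open>0, \<dots>, n - 1\<close> has \<open>n\<close> in register 0,
  and the \<open>n \<times> n\<close> bit matrices of \<open>E\<close>, of \<open>\<pi>\<close> and of \<open>F\<close>, row by row, in the arrays 0, 1 and 2;
  everything else is zero. The answer is left in register 0. The parameter \<open>k\<close> is not part of the
  input.\<close>

definition bit_matrix :: "nat \<Rightarrow> (nat \<Rightarrow> nat \<Rightarrow> bool) \<Rightarrow> nat \<Rightarrow> nat" where
  "bit_matrix n R i = (if i < n * n \<and> R (i div n) (i mod n) then 1 else 0)"

definition encode :: "nat \<Rightarrow> nat set set \<Rightarrow> nat rel \<Rightarrow> nat set set \<Rightarrow> state" where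
  "encode n E \<pi> F =
     ((\<lambda>_. 0)(0 := n),
      (\<lambda>_ _. 0)(0 := bit_matrix n (\<lambda>u v. {u, v} \<in> E),
                1 := bit_matrix n (\<lambda>u v. (u, v) \<in> \<pi>),
                2 := bit_matrix n (\<lambda>u v. {u, v} \<in> F)))"

definition answers_within :: "prog \<Rightarrow> state \<Rightarrow> bool \<Rightarrow> nat \<Rightarrow> bool" where
  "answers_within c s b T \<longleftrightarrow>
     (\<exists>t s'. exec c s t s' \<and> t \<le> T \<and> fst s' 0 = (if b then 1 else 0))"

end

(* Delete F. Guess the sequence of the edges of F that the path uses, with their directions, and its two
   ends; every stretch between consecutive guessed edges is then a path with known ends b and a in the block
   graph H = G - F. The vertices that every walk from b to a in H meets lie on that stretch in a forced
   order, and consecutive ones are adjacent, because two connected vertices of a block graph that no third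
   vertex separates are adjacent. All other vertices go into gaps between consecutive forced vertices; those
   that fit into the same gap form a clique with its two ends, so only the choice of the gap matters, and
   putting every vertex into its first gap allowed by the partial order is optimal.
   Up to the two ends there are at most (k + 1)! 2^k guesses. The polynomial test of one guess is a combination of
   first-order formulas and least fixed points, so a compiler for those yields the RAM program. *)
theory Submission
  imports Defs "HOL-Library.Product_Lexorder"
begin

section \<open>Separating vertices in block graphs\<close>

text \<open>The two directions of the test rest on different facts. A wrong guess may produce any
  relation, so the test itself checks that the computed relation is a strict linear order whose
  neighbours are adjacent; only completeness uses that a right guess yields the order of the forced
  vertices along the path. The clique property of a gap reduces to a local fact: two vertices of H
  with two common neighbours cannot be separated by one vertex, hence are adjacent. The first
  allowed gaps form a least fixed point because vertices constrain each other: a vertex pushed to a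
  later gap pushes its successors in \<pi>. The machine does not know k and can only count by one.
  The guesses are therefore enumerated in a table that serves as a queue and runs empty by itself;
  the bound on its length comes afterwards from counting. Each edge occurs at most once, so there
  are at most k! 2^k sequences of each of the k + 1 possible lengths. The ends of the path are not
  part of a sequence: their n^2 choices go into the polynomial factor.\<close>

definition avoid :: "('a \<Rightarrow> 'a \<Rightarrow> bool) \<Rightarrow> 'a \<Rightarrow> 'a \<Rightarrow> 'a \<Rightarrow> bool" where
  "avoid H x u v \<longleftrightarrow> u \<noteq> x \<and> v \<noteq> x \<and> (\<lambda>a b. H a b \<and> a \<noteq> x \<and> b \<noteq> x)\<^sup>*\<^sup>* u v"

lemma avoid_refl: "u \<noteq> x \<Longrightarrow> avoid H x u u"
  by (simp add: avoid_def)

lemma avoid_step: "H u v \<Longrightarrow> u \<noteq> x \<Longrightarrow> v \<noteq> x \<Longrightarrow> avoid H x u v"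
  by (auto simp: avoid_def)

lemma avoid_trans: "avoid H x u v \<Longrightarrow> avoid H x v w \<Longrightarrow> avoid H x u w"
  unfolding avoid_def by (metis (no_types, lifting) rtranclp_trans)

lemma rtranclp_symp: "symp R \<Longrightarrow> R\<^sup>*\<^sup>* u v \<Longrightarrow> R\<^sup>*\<^sup>* v u"
  using symp_rtranclp[of R] by (metis sympD)

lemma avoid_sym: "symp H \<Longrightarrow> avoid H x u v \<Longrightarrow> avoid H x v u"
proof -
  assume s: "symp H" and a: "avoid H x u v"
  have "symp (\<lambda>a b. H a b \<and> a \<noteq> x \<and> b \<noteq> x)" using s by (auto simp: symp_def)
  from rtranclp_symp[OF this] show ?thesis using a unfolding avoid_def by blast
qed

definition simple_path :: "('a \<Rightarrow> 'a \<Rightarrow> bool) \<Rightarrow> 'a \<Rightarrow> 'a \<Rightarrow> 'a list \<Rightarrow> bool" where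
  "simple_path H u v ps \<longleftrightarrow> ps \<noteq> [] \<and> hd ps = u \<and> last ps = v \<and> distinct ps \<and> successively H ps"

text \<open>Induction along the walk keeps the path simple: a step to a vertex already on it cuts
  the path off there.\<close>

lemma ex_simple_path:
  assumes "H\<^sup>*\<^sup>* u v"
  shows "\<exists>ps. simple_path H u v ps"
  using assms
proof induction
  case base
  then show ?case by (intro exI[of _ "[u]"]) (simp add: simple_path_def)
next
  case (step y z)
  then obtain ps where ps: "simple_path H u y ps" by blast
  show ?case
  proof (cases "z \<in> set ps")
    case True
    then obtain as bs where ab: "ps = as @ z # bs" by (meson split_list)
    have "successively H (as @ [z])"
      using ps unfolding ab simple_path_def by (auto simp: successively_append_iff)
    then have "simple_path H u z (as @ [z])"
      using ps unfolding ab simple_path_def by (cases as) auto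
    then show ?thesis by blast
  next
    case False
    then have "simple_path H u z (ps @ [z])"
      using ps step.hyps(2) unfolding simple_path_def by (auto simp: successively_append_iff)
    then show ?thesis by blast
  qed
qed

lemma successively_all:
  assumes "successively H ps" "ps \<noteq> []" "Q (hd ps)" "\<And>a b. H a b \<Longrightarrow> Q b"
  shows "\<forall>y\<in>set ps. Q y"
  using assms
proof (induction ps)
  case (Cons a ps)
  show ?case
  proof (cases ps)
    case (Cons b qs)
    then have "H a b" "successively H ps" "ps \<noteq> []" "hd ps = b" using Cons.prems(1) by auto
    then show ?thesis using Cons.IH Cons.prems(3,4) by (metis list.sel(1) set_ConsD)
  qed (use Cons.prems in simp)
qed simp

text \<open>Every vertex of the list is reached from its head inside \<open>C\<close>; symmetry of
  \<open>H\<close> then joins any two of them.\<close>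

lemma successively_reach:
  assumes "symp H" "successively H ps" "set ps \<subseteq> C" "a \<in> set ps" "b \<in> set ps"
  shows "(\<lambda>a b. H a b \<and> a \<in> C \<and> b \<in> C)\<^sup>*\<^sup>* a b"
proof -
  let ?R = "\<lambda>a b. H a b \<and> a \<in> C \<and> b \<in> C"
  have "\<forall>y\<in>set ps. ?R\<^sup>*\<^sup>* (hd ps) y" using assms(2,3)
  proof (induction ps)
    case (Cons x ps)
    show ?case
    proof (cases ps)
      case (Cons y qs)
      then have "?R x y" "\<forall>z\<in>set ps. ?R\<^sup>*\<^sup>* y z" using Cons.IH Cons.prems by auto
      then show ?thesis by (auto intro: converse_rtranclp_into_rtranclp)
    qed simp
  qed simp
  moreover have "symp ?R" using assms(1) by (auto simp: symp_def)
  ultimately show ?thesis using assms(4,5) rtranclp_symp[of ?R] by (meson rtranclp_trans)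
qed

lemma reachable_iff: "reachable D u v \<longleftrightarrow> (\<lambda>x y. {x, y} \<in> D)\<^sup>*\<^sup>* u v"
  unfolding reachable_def by (simp add: rtranclp_rtrancl_eq)

text \<open>The vertices on simple paths from \<open>u\<close> to \<open>v\<close> induce a 2-connected graph when no single vertex
  separates \<open>u\<close> from \<open>v\<close>, and the block containing it is a clique.\<close>

lemma block_graph_adjacent:
  fixes V :: "'a set"
  defines "H \<equiv> \<lambda>D a b. {a, b} \<in> D"
  assumes V: "finite V" "\<And>e. e \<in> D \<Longrightarrow> e \<subseteq> V" and bg: "block_graph V D"
    and uv: "u \<in> V" "u \<noteq> v" "(H D)\<^sup>*\<^sup>* u v"
    and sep: "\<And>x. x \<noteq> u \<Longrightarrow> x \<noteq> v \<Longrightarrow> avoid (H D) x u v"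
  shows "{u, v} \<in> D"
proof -
  let ?H = "H D"
  have sym: "symp ?H" unfolding H_def by (auto simp: symp_def insert_commute)
  define B where "B = {w. \<exists>ps. simple_path ?H u v ps \<and> w \<in> set ps}"
  have BV: "B \<subseteq> V"
  proof
    fix w assume "w \<in> B"
    then obtain ps where "simple_path ?H u v ps" "w \<in> set ps" unfolding B_def by blast
    moreover have "b \<in> V" if "?H a b" for a b using that V(2) unfolding H_def by blast
    ultimately show "w \<in> V"
      using successively_all[of ?H ps "\<lambda>w. w \<in> V"] uv(1) unfolding simple_path_def by blast
  qed
  obtain p0 where p0: "simple_path ?H u v p0" using ex_simple_path[OF uv(3)] by blast
  have "u \<in> set p0" "v \<in> set p0"
    using p0 hd_in_set[of p0] last_in_set[of p0] unfolding simple_path_def by auto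
  then have uvB: "u \<in> B" "v \<in> B" using p0 unfolding B_def by blast+
  let ?E = "induced_edges D B"
  have reach: "reachable (induced_edges ?E C) a b" "reachable ?E a b"
    if "successively ?H ps" "set ps \<subseteq> C" "C \<subseteq> B" "a \<in> set ps" "b \<in> set ps" for ps C a b
  proof -
    have *: "(\<lambda>a b. ?H a b \<and> a \<in> C \<and> b \<in> C)\<^sup>*\<^sup>* a b"
      using successively_reach[OF sym that(1,2,4,5)] .
    show "reachable (induced_edges ?E C) a b" unfolding reachable_iff
      using * by (rule rtranclp_mono[THEN predicate2D, rotated])
        (use that(3) in \<open>auto simp: H_def induced_edges_def\<close>)
    show "reachable ?E a b" unfolding reachable_iff
      using * by (rule rtranclp_mono[THEN predicate2D, rotated])
        (use that(3) in \<open>auto simp: H_def induced_edges_def\<close>)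
  qed
  have reach_sym: "reachable E' a b \<Longrightarrow> reachable E' b a" for E' a b
    unfolding reachable_iff by (rule rtranclp_symp) (auto simp: symp_def insert_commute)
  have reach_trans: "reachable E' a b \<Longrightarrow> reachable E' b c \<Longrightarrow> reachable E' a c" for E' a b c
    unfolding reachable_iff by (rule rtranclp_trans)
  have pB: "set ps \<subseteq> B" if "simple_path ?H u v ps" for ps using that unfolding B_def by blast
  have "connected_graph B ?E"
  proof -
    have r: "reachable ?E u w" if w: "w \<in> B" for w
    proof -
      obtain ps where ps: "simple_path ?H u v ps" "w \<in> set ps" using w unfolding B_def by blast
      then show ?thesis using reach(2)[of ps B u w] pB[OF ps(1)] unfolding simple_path_def by auto
    qed
    then show ?thesis unfolding connected_graph_def using uvB reach_trans[OF reach_sym[OF r] r] by blast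
  qed
  moreover have "\<not> cut_vertex B ?E x" for x
  proof
    assume cut: "cut_vertex B ?E x"
    let ?C = "B - {x}"
    have x: "x \<in> B" using cut unfolding cut_vertex_def by blast
    \<comment> \<open>A simple path through \<open>w\<close> that also passes \<open>x\<close>
      splits at \<open>x\<close> into two halves; the half with \<open>w\<close> still leads to
      \<open>u\<close> or to \<open>v\<close>.\<close>
    have side: "(x \<noteq> u \<and> reachable (induced_edges ?E ?C) w u) \<or> (x \<noteq> v \<and> reachable (induced_edges ?E ?C) w v)"
      if w: "w \<in> ?C" for w
    proof -
      obtain ps where ps: "simple_path ?H u v ps" "w \<in> set ps" using w unfolding B_def by blast
      show ?thesis
      proof (cases "x \<in> set ps")
        case False
        then have "set ps \<subseteq> ?C" using pB[OF ps(1)] by blast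
        then have "reachable (induced_edges ?E ?C) w u"
          by (rule reach(1)[rotated]) (use ps in \<open>auto simp: simple_path_def\<close>)
        then show ?thesis using False ps(1) unfolding simple_path_def by auto
      next
        case True
        then obtain as bs where ab: "ps = as @ x # bs" by (meson split_list)
        have d: "x \<notin> set as" "x \<notin> set bs" using ps(1) unfolding ab simple_path_def by auto
        have succ: "successively ?H as" "successively ?H bs"
          using ps(1) unfolding ab simple_path_def by (auto simp: successively_append_iff successively_Cons)
        have C: "set as \<subseteq> ?C" "set bs \<subseteq> ?C" using pB[OF ps(1)] d unfolding ab by auto
        have "w \<in> set as \<or> w \<in> set bs" using ps(2) w unfolding ab by auto
        then show ?thesis
        proof
          assume was: "w \<in> set as"
          then have "u \<in> set as" using ps(1) unfolding ab simple_path_def by (cases as) auto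
          then show ?thesis using reach(1)[OF succ(1) C(1) _ was] d by auto
        next
          assume wbs: "w \<in> set bs"
          then have "v \<in> set bs" using ps(1) unfolding ab simple_path_def by (cases bs) auto
          then show ?thesis using reach(1)[OF succ(2) C(2) _ wbs] d by auto
        qed
      qed
    qed
    \<comment> \<open>The walk around \<open>x\<close> that \<open>sep\<close> provides may be taken
      simple, so it consists of vertices of \<open>B\<close> and survives in the graph induced on
      \<open>B - {x}\<close>.\<close>
    have link: "reachable (induced_edges ?E ?C) u v" if xuv: "x \<noteq> u" "x \<noteq> v"
    proof -
      let ?R = "\<lambda>a b. ?H a b \<and> a \<noteq> x \<and> b \<noteq> x"
      obtain ps where ps: "simple_path ?R u v ps"
        using sep[OF xuv] ex_simple_path[of ?R u v] unfolding avoid_def by blast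
      have nx: "\<forall>y\<in>set ps. y \<noteq> x"
        using successively_all[of ?R ps "\<lambda>y. y \<noteq> x"] ps xuv unfolding simple_path_def by auto
      have succ: "successively ?H ps"
        using ps successively_mono[of ?R ps ?H] unfolding simple_path_def by auto
      then have "simple_path ?H u v ps" using ps unfolding simple_path_def by blast
      then have "set ps \<subseteq> ?C" using nx pB by blast
      moreover have "u \<in> set ps" "v \<in> set ps"
        using ps hd_in_set[of ps] last_in_set[of ps] unfolding simple_path_def by auto
      ultimately show ?thesis using reach(1)[OF succ _ Diff_subset] by blast
    qed
    have "reachable (induced_edges ?E ?C) w w'" if ww: "w \<in> ?C" "w' \<in> ?C" for w w'
    proof -
      \<comment> \<open>A common meeting point: if \<open>x\<close> is one of the two ends, the
        other end; otherwise \<open>u\<close>, to which \<open>link\<close> leads from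
        \<open>v\<close>.\<close>
      have "\<exists>c. \<forall>w\<in>?C. reachable (induced_edges ?E ?C) w c"
      proof (cases "x = u \<or> x = v")
        case True
        then show ?thesis using side by blast
      next
        case False
        then have vu: "reachable (induced_edges ?E ?C) v u" by (intro reach_sym[OF link]) auto
        have "reachable (induced_edges ?E ?C) w u" if "w \<in> ?C" for w
          using side[OF that] reach_trans[OF _ vu] by blast
        then show ?thesis by blast
      qed
      then obtain c where c: "\<And>w. w \<in> ?C \<Longrightarrow> reachable (induced_edges ?E ?C) w c" by blast
      show ?thesis by (rule reach_trans[OF c[OF ww(1)] reach_sym[OF c[OF ww(2)]]])
    qed
    then show False using cut unfolding cut_vertex_def by blast
  qed
  ultimately have two: "two_connected B ?E" unfolding two_connected_def by blast
  \<comment> \<open>\<open>B\<close> need not be a block itself, but by finiteness it lies in a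
    maximal 2-connected set, which is one.\<close>
  let ?S = "{B'. B \<subseteq> B' \<and> B' \<subseteq> V \<and> two_connected B' (induced_edges D B')}"
  have S: "finite ?S" "B \<in> ?S" using V(1) two BV by auto
  from finite_has_maximal2[OF S] obtain M where
    M: "M \<in> ?S" "\<And>b. b \<in> ?S \<Longrightarrow> M \<subseteq> b \<Longrightarrow> M = b" by auto
  have "\<not> two_connected B' (induced_edges D B')" if "M \<subset> B'" "B' \<subseteq> V" for B'
    using M(1) M(2)[of B'] that by blast
  then have "is_block V D M" using M(1) unfolding is_block_def by blast
  then have "clique D M" using bg unfolding block_graph_def by blast
  then show ?thesis using M(1) uvB uv(2) unfolding clique_def by blast
qed

section \<open>The polynomial test for a fixed skeleton\<close>

text \<open>\<open>T\<close> is meant to be a strict linear order on the skeleton vertices. A gap is named by the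
  skeleton vertex that precedes it.\<close>

type_synonym vrel = "nat \<Rightarrow> nat \<Rightarrow> bool"

text \<open>The vertex set of the skeleton is not stored: it is recovered from the order as
  \<open>s\<close> together with all that follows \<open>s\<close>.\<close>

definition skel :: "nat \<Rightarrow> nat \<Rightarrow> vrel \<Rightarrow> nat \<Rightarrow> bool" where
  "skel n s T x \<longleftrightarrow> x < n \<and> (x = s \<or> T s x)"

definition skel_succ :: "nat \<Rightarrow> nat \<Rightarrow> vrel \<Rightarrow> nat \<Rightarrow> nat \<Rightarrow> bool" where
  "skel_succ n s T x y \<longleftrightarrow> skel n s T x \<and> skel n s T y \<and> T x y \<and>
     \<not> (\<exists>z<n. skel n s T z \<and> T x z \<and> T z y)"

text \<open>The condition \<open>H w w'\<close> closes the gaps that are crossed by a guessed edge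
  of F. The second part confronts \<open>v\<close> with the skeleton only: its predecessors must lie
  up to \<open>w\<close>, its successors behind \<open>w\<close>. Constraints among the inserted
  vertices are left to \<open>late\<close>.\<close>

definition fits :: "nat \<Rightarrow> nat \<Rightarrow> vrel \<Rightarrow> vrel \<Rightarrow> vrel \<Rightarrow> nat \<Rightarrow> nat \<Rightarrow> bool" where
  "fits n s T H P v w \<longleftrightarrow>
     (\<exists>w'<n. skel_succ n s T w w' \<and> H w w' \<and> H v w \<and> H v w') \<and>
     \<not> (\<exists>x<n. skel n s T x \<and> (P x v \<and> x \<noteq> w \<and> \<not> T x w \<or> P v x \<and> \<not> T w x))"

text \<open>\<open>late v w\<close> states that \<open>v\<close> is forced to lie behind the gap \<open>w\<close>. It is the least solution of the
  constraints, so that every vertex can be put into its first gap that is not excluded.\<close>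

definition late_step :: "nat \<Rightarrow> nat \<Rightarrow> vrel \<Rightarrow> vrel \<Rightarrow> vrel \<Rightarrow>
    vrel \<Rightarrow> nat \<Rightarrow> nat \<Rightarrow> bool" where
  "late_step n s T H P L v w \<longleftrightarrow> \<not> (\<exists>w'<n. skel n s T w' \<and> (w' = w \<or> T w' w) \<and> fits n s T H P v w' \<and>
     \<not> (\<exists>u<n. P u v \<and> \<not> skel n s T u \<and> L u w'))"

text \<open>\<open>L\<close> stands under two negations, hence positively; this admits the inductive
  definition below.\<close>

lemma late_step_mono:
  "(\<And>u w. L u w \<longrightarrow> L' u w) \<Longrightarrow> late_step n s T H P L v w \<longrightarrow> late_step n s T H P L' v w"
  unfolding late_step_def by blast

inductive late for n s T H P where
  "v < n \<Longrightarrow> w < n \<Longrightarrow> late_step n s T H P (late n s T H P) v w \<Longrightarrow> late n s T H P v w"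
monos late_step_mono

text \<open>Only negation, conjunction and existence below \<open>n\<close> occur, the connectives
  of the formula language into which the test is translated later. Consecutive skeleton vertices
  need adjacency in \<open>E\<close>, not in \<open>H\<close>, because the edges of F that the path
  uses are among these pairs.\<close>

definition accepts :: "nat \<Rightarrow> nat \<Rightarrow> nat \<Rightarrow> vrel \<Rightarrow> vrel \<Rightarrow> vrel \<Rightarrow>
    vrel \<Rightarrow> bool" where
  "accepts n s t T E H P \<longleftrightarrow>
     \<not> (\<exists>x<n. skel n s T x \<and> T x x) \<and>
     \<not> (\<exists>x<n. \<exists>y<n. \<exists>z<n. skel n s T x \<and> skel n s T y \<and> skel n s T z \<and> T x y \<and> T y z \<and> \<not> T x z) \<and>
     \<not> (\<exists>x<n. \<exists>y<n. skel n s T x \<and> skel n s T y \<and> x \<noteq> y \<and> \<not> T x y \<and> \<not> T y x) \<and>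
     \<not> (\<exists>x<n. \<exists>y<n. skel_succ n s T x y \<and> \<not> E x y) \<and>
     \<not> (\<exists>x<n. \<exists>y<n. skel n s T x \<and> skel n s T y \<and> P x y \<and> x \<noteq> y \<and> \<not> T x y) \<and>
     skel n s T t \<and>
     \<not> (\<exists>x<n. skel n s T x \<and> x \<noteq> t \<and> \<not> T x t) \<and>
     \<not> (\<exists>v<n. \<not> skel n s T v \<and> \<not> (\<exists>w<n. skel n s T w \<and> \<not> late n s T H P v w))"

text \<open>The path is a sorted list: every vertex off the skeleton goes into its first gap that is
  not late, and within a gap the vertices follow a linear extension of \<open>P\<close>. Any order
  within a gap is a path, since \<open>quad\<close> makes vertices with the same two gap ends
  adjacent. \<open>T\<close> is arbitrary here, so that a wrong guess cannot cause a wrong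
  answer.\<close>

lemma accepts_sound:
  assumes acc: "accepts n s t T E H P" and sn: "s < n"
    and HE: "\<And>u v. H u v \<Longrightarrow> E u v" and Hs: "symp H"
    and P: "\<And>u. u < n \<Longrightarrow> P u u" "\<And>u v. P u v \<Longrightarrow> P v u \<Longrightarrow> u = v" "\<And>u v w. P u v \<Longrightarrow> P v w \<Longrightarrow> P u w"
    and quad: "\<And>a b w w'. a \<noteq> b \<Longrightarrow> w \<noteq> w' \<Longrightarrow> H a w \<Longrightarrow> H a w' \<Longrightarrow> H b w \<Longrightarrow> H b w' \<Longrightarrow> H a b"
  shows "\<exists>vs. distinct vs \<and> set vs = {..<n} \<and> (\<forall>i. Suc i < length vs \<longrightarrow> E (vs ! i) (vs ! Suc i)) \<and>
    (\<forall>i<length vs. \<forall>j<length vs. P (vs ! i) (vs ! j) \<longrightarrow> i \<le> j) \<and> hd vs = s \<and> last vs = t"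
proof -
  let ?W = "skel n s T"
  let ?l = "late n s T H P"
  have Wn: "x < n" if "?W x" for x using that unfolding skel_def by simp
  note a = acc[unfolded accepts_def]
  note a1 = a[THEN conjunct1] and b1 = a[THEN conjunct2]
  note a2 = b1[THEN conjunct1] and b2 = b1[THEN conjunct2]
  note a3 = b2[THEN conjunct1] and b3 = b2[THEN conjunct2]
  note a4 = b3[THEN conjunct1] and b4 = b3[THEN conjunct2]
  note a5 = b4[THEN conjunct1] and b5 = b4[THEN conjunct2]
  note Wt = b5[THEN conjunct1] and b6 = b5[THEN conjunct2]
  note a7 = b6[THEN conjunct1] and a8 = b6[THEN conjunct2]
  have irr: "\<not> T x x" if "?W x" for x using a1 that Wn by blast
  have tr: "T x z" if "?W x" "?W y" "?W z" "T x y" "T y z" for x y z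
    using a2 that Wn by blast
  have tot: "x = y \<or> T x y \<or> T y x" if "?W x" "?W y" for x y
    using a3 that Wn by blast
  have succE: "E x y" if "skel_succ n s T x y" for x y
  proof -
    have "x < n" "y < n" using that Wn unfolding skel_succ_def by blast+
    then show ?thesis using a4 that by blast
  qed
  have WP: "x = y \<or> T x y" if "?W x" "?W y" "P x y" for x y
    using a5 that Wn by blast
  have tmax: "x = t \<or> T x t" if "?W x" for x
    using a7 that Wn by blast
  have Ws: "?W s" using sn unfolding skel_def by simp
  define pos where "pos = (\<lambda>w. card {z. ?W z \<and> T z w})"
  have finW: "finite {z. ?W z \<and> Q z}" for Q
    by (rule finite_subset[of _ "{..<n}"]) (use Wn in auto)
  have pos_less: "pos x < pos y" if "?W x" "?W y" "T x y" for x y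
    unfolding pos_def
  proof (rule psubset_card_mono[OF finW])
    show "{z. ?W z \<and> T z x} \<subset> {z. ?W z \<and> T z y}"
      using that tr irr by blast
  qed
  have pos_iff: "T x y \<longleftrightarrow> pos x < pos y" if "?W x" "?W y" for x y
    using pos_less that tot by (metis less_asym less_irrefl)
  have pos_inj: "x = y" if "?W x" "?W y" "pos x = pos y" for x y
    using pos_less that tot by (metis less_irrefl)
  \<comment> \<open>Take the first gap \<open>w\<close> that is not late. Since
    \<open>late_step\<close> fails there, some \<open>w'\<close> up to \<open>w\<close> fits and is
    late for no predecessor of \<open>v\<close>. By reflexivity \<open>v\<close> is its own
    predecessor, so \<open>w'\<close> is not late for \<open>v\<close>, and minimality forces
    \<open>w' = w\<close>.\<close>
  have "\<exists>w. ?W w \<and> fits n s T H P v w \<and> (\<forall>u<n. P u v \<longrightarrow> \<not> ?W u \<longrightarrow> \<not> ?l u w) \<and>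
      (\<forall>w'. ?W w' \<longrightarrow> \<not> ?l v w' \<longrightarrow> pos w \<le> pos w')" if v: "v < n" "\<not> ?W v" for v
  proof -
    have "\<exists>w. ?W w \<and> \<not> ?l v w" using a8 v by blast
    then obtain w where w: "?W w" "\<not> ?l v w" "\<And>w'. ?W w' \<Longrightarrow> \<not> ?l v w' \<Longrightarrow> pos w \<le> pos w'"
      using ex_has_least_nat[of "\<lambda>w. ?W w \<and> \<not> ?l v w" _ pos] by blast
    have "\<not> late_step n s T H P ?l v w"
      using w(2) late.intros[OF v(1) Wn[OF w(1)]] by blast
    then obtain w' where w': "?W w'" "w' = w \<or> T w' w" "fits n s T H P v w'"
        "\<And>u. u < n \<Longrightarrow> P u v \<Longrightarrow> \<not> ?W u \<Longrightarrow> \<not> ?l u w'"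
      unfolding late_step_def by blast
    have "\<not> ?l v w'" using w'(4) v P(1) by blast
    then have "pos w \<le> pos w'" using w(3) w'(1) by blast
    then have "w' = w" using w'(1,2) w(1) pos_less by fastforce
    then show ?thesis using w w' by blast
  qed
  then obtain g where g: "\<And>v. v < n \<Longrightarrow> \<not> ?W v \<Longrightarrow> ?W (g v) \<and> fits n s T H P v (g v) \<and>
      (\<forall>u<n. P u v \<longrightarrow> \<not> ?W u \<longrightarrow> \<not> ?l u (g v)) \<and>
      (\<forall>w'. ?W w' \<longrightarrow> \<not> ?l v w' \<longrightarrow> pos (g v) \<le> pos w')"
    by metis
  \<comment> \<open>The gap of \<open>v\<close> is not late for its predecessor \<open>u\<close>,
    and \<open>g u\<close> is the first gap with this property.\<close>
  have g_mono: "pos (g u) \<le> pos (g v)" if "u < n" "v < n" "\<not> ?W u" "\<not> ?W v" "P u v" for u v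
    using g[OF that(1,3)] g[OF that(2,4)] that by blast
  \<comment> \<open>By transitivity and antisymmetry, the number of predecessors grows strictly
    along \<open>P\<close>: a linear extension.\<close>
  define rank where "rank = (\<lambda>v. card {u. u < n \<and> P u v})"
  have rank_less: "rank u < rank v" if "P u v" "u \<noteq> v" "v < n" for u v
    unfolding rank_def
  proof (rule psubset_card_mono)
    show "{z. z < n \<and> P z u} \<subset> {z. z < n \<and> P z v}" using that P by blast
  qed simp
  \<comment> \<open>A gap shares the first component with the skeleton vertex that opens it;
    \<open>Suc\<close> reserves the second component 0 for that vertex.\<close>
  define key where "key = (\<lambda>v. if ?W v then (pos v, 0) else (pos (g v), Suc (rank v)))"
  define vs where "vs = sort_key key [0..<n]"
  have vs: "distinct vs" "set vs = {..<n}" "length vs = n" "sorted (map key vs)"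
    unfolding vs_def by auto
  have keys: "key (vs ! i) \<le> key (vs ! j)" if "i \<le> j" "j < n" for i j
    using vs(3,4) that sorted_nth_mono[of "map key vs" i j] by simp
  have adj: "E (vs ! i) (vs ! Suc i)" if i: "Suc i < n" for i
  proof -
    let ?x = "vs ! i" let ?y = "vs ! Suc i"
    have xy: "?x < n" "?y < n" "?x \<noteq> ?y"
      using i vs nth_mem[of i vs] nth_mem[of "Suc i" vs] nth_eq_iff_index_eq[OF vs(1), of i "Suc i"] by auto
    have le: "key ?x \<le> key ?y" using keys i by simp
    \<comment> \<open>No vertex has a key strictly between those of two neighbours in the sorted
      list. In each of the four cases below this keeps skeleton vertices from lying between
      them.\<close>
    have btw: False if z: "z < n" "key ?x < key z" "key z < key ?y" for z
    proof -
      obtain m where m: "m < n" "z = vs ! m" using z(1) vs by (metis in_set_conv_nth lessThan_iff)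
      show False
      proof (cases "m \<le> i")
        case True
        then show False using keys[OF True] i z m by auto
      next
        case False
        then show False using keys[of "Suc i" m] m z by auto
      qed
    qed
    show ?thesis
    proof (cases "?W ?x"; cases "?W ?y")
      assume W: "?W ?x" "?W ?y"
      then have "pos ?x \<le> pos ?y" using le unfolding key_def by auto
      then have T: "T ?x ?y" using tot[OF W] xy(3) pos_less W by fastforce
      moreover have "\<not> (T ?x z \<and> T z ?y)" if "?W z" for z
        using btw[OF Wn[OF that]] that W pos_less unfolding key_def by auto
      ultimately show ?thesis using succE W unfolding skel_succ_def by blast
    next
      assume W: "?W ?x" "\<not> ?W ?y"
      have gy: "?W (g ?y)" "fits n s T H P ?y (g ?y)" using g xy(2) W by blast+
      have "pos ?x \<le> pos (g ?y)" using le W unfolding key_def by auto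
      moreover have "\<not> pos ?x < pos (g ?y)"
        using btw[OF Wn[OF gy(1)]] W gy unfolding key_def by auto
      ultimately have "?x = g ?y" using pos_inj W gy by simp
      moreover have "H ?y (g ?y)" using gy(2) unfolding fits_def by blast
      ultimately show ?thesis using HE[OF sympD[OF Hs]] by metis
    next
      assume W: "\<not> ?W ?x" "?W ?y"
      have gx: "?W (g ?x)" "fits n s T H P ?x (g ?x)" using g xy(1) W by blast+
      have lt: "pos (g ?x) < pos ?y" using le W unfolding key_def by auto
      \<comment> \<open>The right end of the gap has to be the next vertex: before it,
        \<open>btw\<close> would be violated; behind it, \<open>vs ! Suc i\<close> would be a
        skeleton vertex inside the gap.\<close>
      obtain w' where w': "skel_succ n s T (g ?x) w'" "H ?x w'" using gx(2) unfolding fits_def by blast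
      have W': "?W w'" "T (g ?x) w'" using w'(1) unfolding skel_succ_def by auto
      have "\<not> pos w' < pos ?y"
      proof
        assume "pos w' < pos ?y"
        then show False using btw[OF Wn[OF W'(1)]] W W' gx pos_less unfolding key_def by auto
      qed
      moreover have "\<not> T ?y w'"
        using w'(1) lt pos_iff[OF gx(1) W(2)] W xy(2) unfolding skel_succ_def by blast
      then have "\<not> pos ?y < pos w'" using pos_iff W W' by blast
      ultimately have "w' = ?y" using pos_inj W W' by simp
      then show ?thesis using w' HE by blast
    next
      assume W: "\<not> ?W ?x" "\<not> ?W ?y"
      have gx: "?W (g ?x)" "fits n s T H P ?x (g ?x)" using g xy(1) W by blast+
      have gy: "?W (g ?y)" "fits n s T H P ?y (g ?y)" using g xy(2) W by blast+
      have "pos (g ?x) \<le> pos (g ?y)" using le W unfolding key_def by auto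
      moreover have "\<not> pos (g ?x) < pos (g ?y)"
        using btw[OF Wn[OF gy(1)]] W gy unfolding key_def by auto
      ultimately have gg: "g ?x = g ?y" using pos_inj gx gy by simp
      obtain w1 where w1: "skel_succ n s T (g ?x) w1" "H ?x (g ?x)" "H ?x w1" using gx(2) unfolding fits_def by blast
      obtain w2 where w2: "skel_succ n s T (g ?x) w2" "H ?y (g ?x)" "H ?y w2" using gy(2) gg unfolding fits_def by metis
      have W12: "?W w1" "?W w2" using w1(1) w2(1) unfolding skel_succ_def by blast+
      have "w1 = w2"
        using tot[OF W12] w1(1) w2(1) Wn[OF W12(1)] Wn[OF W12(2)] W12 unfolding skel_succ_def by blast
      moreover have "g ?x \<noteq> w1" using w1(1) irr unfolding skel_succ_def by metis
      ultimately have "H ?x ?y" using quad[OF xy(3)] w1 w2 by blast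
      then show ?thesis using HE by blast
    qed
  qed
  have ext: "i \<le> j" if ij: "i < n" "j < n" "P (vs ! i) (vs ! j)" for i j
  proof (rule ccontr)
    assume "\<not> i \<le> j"
    then have le: "key (vs ! j) \<le> key (vs ! i)" using keys ij by simp
    let ?u = "vs ! i" let ?v = "vs ! j"
    have uv: "?u < n" "?v < n" "?u \<noteq> ?v"
      using ij \<open>\<not> i \<le> j\<close> vs nth_mem[of i vs] nth_mem[of j vs] nth_eq_iff_index_eq[OF vs(1), of i j] by auto
    have "key ?u < key ?v"
    proof (cases "?W ?u"; cases "?W ?v")
      assume W: "?W ?u" "?W ?v"
      then show ?thesis using WP[OF W ij(3)] uv(3) pos_less unfolding key_def by auto
    next
      assume W: "?W ?u" "\<not> ?W ?v"
      have gv: "?W (g ?v)" "fits n s T H P ?v (g ?v)" using g uv(2) W by blast+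
      then have "?u = g ?v \<or> T ?u (g ?v)" using W ij(3) uv(1) unfolding fits_def by blast
      then have "pos ?u \<le> pos (g ?v)" using pos_less W gv by fastforce
      then show ?thesis using W unfolding key_def by auto
    next
      assume W: "\<not> ?W ?u" "?W ?v"
      have gu: "?W (g ?u)" "fits n s T H P ?u (g ?u)" using g uv(1) W by blast+
      then have "T (g ?u) ?v" using W ij(3) uv(2) unfolding fits_def by blast
      then show ?thesis using pos_less W gu unfolding key_def by auto
    next
      assume W: "\<not> ?W ?u" "\<not> ?W ?v"
      then show ?thesis using g_mono[OF uv(1,2) W ij(3)] rank_less[OF ij(3) uv(3,2)] unfolding key_def by auto
    qed
    then show False using le by simp
  qed
  have n0: "0 < n" using sn by simp
  then have ne: "vs \<noteq> []" using vs(3) by auto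
  have hd: "hd vs = s"
  proof -
    have "T s w" if "?W w" "w \<noteq> s" for w using that unfolding skel_def by blast
    then have min: "pos s < pos w" if "?W w" "w \<noteq> s" for w using that pos_less Ws by blast
    obtain m where m: "m < n" "s = vs ! m" using sn vs by (metis in_set_conv_nth lessThan_iff)
    have le: "key (vs ! 0) \<le> key s" using keys m by simp
    have x: "vs ! 0 < n" using nth_mem[of 0 vs] vs n0 by auto
    have "vs ! 0 = s"
    proof (cases "?W (vs ! 0)")
      case True
      have "pos (vs ! 0) \<le> pos s" using le Ws True unfolding key_def by auto
      then show ?thesis using min[OF True] by linarith
    next
      case False
      have "?W (g (vs ! 0))" using g x False by blast
      then have "pos s \<le> pos (g (vs ! 0))" using min by (metis order_refl less_imp_le)
      then show ?thesis using le Ws False unfolding key_def by auto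
    qed
    then show ?thesis using hd_conv_nth[OF ne] by simp
  qed
  have last: "last vs = t"
  proof -
    have max: "pos w < pos t" if "?W w" "w \<noteq> t" for w using tmax[OF that(1)] that(2) pos_less[OF that(1) Wt] by blast
    obtain m where m: "m < n" "t = vs ! m" using Wn[OF Wt] vs by (metis in_set_conv_nth lessThan_iff)
    let ?z = "vs ! (n - 1)"
    have le: "key t \<le> key ?z" using keys[of m "n - 1"] m by simp
    have x: "?z < n" using nth_mem[of "n - 1" vs] vs n0 by auto
    have "?z = t"
    proof (cases "?W ?z")
      case True
      have "pos t \<le> pos ?z" using le Wt True unfolding key_def by auto
      then show ?thesis using max[OF True] by linarith
    next
      case False
      \<comment> \<open>A gap has a right end \<open>w'\<close>, which lies at or before
        \<open>t\<close>; hence the gap, too, comes before \<open>t\<close>.\<close>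
      have gz: "?W (g ?z)" "fits n s T H P ?z (g ?z)" using g x False by blast+
      then obtain w' where "?W w'" "T (g ?z) w'" unfolding fits_def skel_succ_def by blast
      then have "pos (g ?z) < pos t" using pos_less[OF gz(1), of w'] max[of w'] by (metis less_trans)
      then show ?thesis using le Wt False unfolding key_def by auto
    qed
    then show ?thesis using vs(3) last_conv_nth[OF ne] by simp
  qed
  show ?thesis
  proof (intro exI[of _ vs] conjI allI impI)
    fix i assume "Suc i < length vs"
    then show "E (vs ! i) (vs ! Suc i)" using adj vs(3) by simp
  next
    fix i j assume "i < length vs" "j < length vs" "P (vs ! i) (vs ! j)"
    then show "i \<le> j" using ext vs(3) by simp
  qed (fact vs(1) vs(2) hd last)+
qed

section \<open>The skeleton of an ordered Hamiltonian path\<close>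

fun jumps :: "('a \<Rightarrow> 'a \<Rightarrow> bool) \<Rightarrow> 'a list \<Rightarrow> ('a \<times> 'a) list" where
  "jumps F (x # y # zs) = (if F x y then [(x, y)] else []) @ jumps F (y # zs)"
| "jumps F _ = []"

text \<open>The ends of the stretches between jumps: a stretch begins at the head of the previous
  jump and stops at the tail of the next one. Two jumps in a row leave a stretch of one vertex, the
  pair (b, b).\<close>

fun segs :: "'a \<Rightarrow> ('a \<times> 'a) list \<Rightarrow> 'a \<Rightarrow> ('a \<times> 'a) set" where
  "segs s [] t = {(s, t)}"
| "segs s ((a, b) # xs) t = insert (s, a) (segs b xs t)"

text \<open>The stretches as intervals of positions; their maximality makes the run around a given
  position unique.\<close>

definition is_run :: "('a \<Rightarrow> 'a \<Rightarrow> bool) \<Rightarrow> 'a list \<Rightarrow> nat \<Rightarrow> nat \<Rightarrow> bool" where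
  "is_run F vs l h \<longleftrightarrow> l \<le> h \<and> h < length vs \<and> (\<forall>k. l \<le> k \<and> k < h \<longrightarrow> \<not> F (vs ! k) (vs ! Suc k)) \<and>
     (l = 0 \<or> F (vs ! (l - 1)) (vs ! l)) \<and> (Suc h = length vs \<or> F (vs ! h) (vs ! Suc h))"

lemma set_jumps: "set (jumps F vs) = {(vs ! k, vs ! Suc k) |k. Suc k < length vs \<and> F (vs ! k) (vs ! Suc k)}"
proof (induction F vs rule: jumps.induct)
  case (1 F x y zs)
  let ?vs = "x # y # zs"
  have "{(?vs ! k, ?vs ! Suc k) |k. Suc k < length ?vs \<and> F (?vs ! k) (?vs ! Suc k)} =
     (if F x y then {(x, y)} else {}) \<union>
     {((y # zs) ! k, (y # zs) ! Suc k) |k. Suc k < length (y # zs) \<and> F ((y # zs) ! k) ((y # zs) ! Suc k)}"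
    (is "?L = ?R1 \<union> ?R2")
  proof
    show "?L \<subseteq> ?R1 \<union> ?R2"
    proof
      fix p assume "p \<in> ?L"
      then obtain k where k: "p = (?vs ! k, ?vs ! Suc k)" "Suc k < length ?vs" "F (?vs ! k) (?vs ! Suc k)" by blast
      show "p \<in> ?R1 \<union> ?R2"
      proof (cases k)
        case (Suc j)
        then have "p \<in> ?R2" using k by auto
        then show ?thesis ..
      qed (use k in auto)
    qed
    have "p \<in> ?L" if "p \<in> ?R1" for p
      using that by (intro CollectI exI[of _ 0]) (auto split: if_splits)
    moreover have "p \<in> ?L" if "p \<in> ?R2" for p
    proof -
      obtain k where k: "p = ((y # zs) ! k, (y # zs) ! Suc k)" "Suc k < length (y # zs)" "F ((y # zs) ! k) ((y # zs) ! Suc k)"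
        using \<open>p \<in> ?R2\<close> by blast
      then show ?thesis by (intro CollectI exI[of _ "Suc k"]) auto
    qed
    ultimately show "?R1 \<union> ?R2 \<subseteq> ?L" by blast
  qed
  then show ?case using 1 by simp
qed auto

lemma in_jumps: "(a, b) \<in> set (jumps F vs) \<Longrightarrow> a \<in> set vs \<and> b \<in> set vs"
  by (induction F vs rule: jumps.induct) auto

text \<open>The vertex \<open>x\<close> does not recur in the list, so no later jump uses the edge
  {x, y} in either direction.\<close>

lemma distinct_jumps:
  assumes "distinct vs"
  shows "distinct (map (\<lambda>(a, b). {a, b}) (jumps F vs))"
  using assms
proof (induction F vs rule: jumps.induct)
  case (1 F x y zs)
  have "{x, y} \<notin> (\<lambda>(a, b). {a, b}) ` set (jumps F (y # zs))"
    using 1(2) in_jumps[of _ _ F "y # zs"] by (fastforce simp: doubleton_eq_iff)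
  then show ?case using 1 by auto
qed auto

text \<open>The scan by \<open>jumps\<close> has arrived at position \<open>j\<close>, while the run
  it is in began at \<open>l\<close>. Separating the two positions carries an unfinished run through
  the induction on the remaining length.\<close>

lemma segs_runs_aux:
  assumes "l \<le> j" "j < length vs" "\<forall>k. l \<le> k \<and> k < j \<longrightarrow> \<not> F (vs ! k) (vs ! Suc k)"
    "l = 0 \<or> F (vs ! (l - 1)) (vs ! l)"
  shows "segs (vs ! l) (jumps F (drop j vs)) (last vs) \<subseteq> {(vs ! l, vs ! h) |l h. is_run F vs l h} \<and>
    (\<forall>k. l \<le> k \<and> k < length vs \<longrightarrow> (\<exists>l' h. is_run F vs l' h \<and> l' \<le> k \<and> k \<le> h \<and>
       (vs ! l', vs ! h) \<in> segs (vs ! l) (jumps F (drop j vs)) (last vs)))"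
  using assms
proof (induction "length vs - j" arbitrary: l j rule: less_induct)
  case less
  show ?case
  proof (cases "Suc j = length vs")
    case True
    then have "drop j vs = [vs ! j]" by (metis Cons_nth_drop_Suc drop_all le_refl less.prems(2))
    moreover have "last vs = vs ! j" using True by (metis diff_Suc_1 last_conv_nth length_0_conv nat.distinct(1))
    ultimately have eq: "segs (vs ! l) (jumps F (drop j vs)) (last vs) = {(vs ! l, vs ! j)}" by simp
    have run: "is_run F vs l j" using less.prems True unfolding is_run_def by auto
    show ?thesis unfolding eq
    proof (intro conjI allI impI)
      fix k assume "l \<le> k \<and> k < length vs"
      then have "l \<le> k" "k \<le> j" using True by auto
      then show "\<exists>l' h. is_run F vs l' h \<and> l' \<le> k \<and> k \<le> h \<and> (vs ! l', vs ! h) \<in> {(vs ! l, vs ! j)}"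
        using run by blast
    qed (use run in blast)
  next
    case False
    then have j: "Suc j < length vs" using less.prems by simp
    have dr: "drop j vs = vs ! j # vs ! Suc j # drop (Suc (Suc j)) vs" "drop (Suc j) vs = vs ! Suc j # drop (Suc (Suc j)) vs"
      using j by (simp_all add: Cons_nth_drop_Suc)
    show ?thesis
    proof (cases "F (vs ! j) (vs ! Suc j)")
      case F: True
      let ?S = "segs (vs ! Suc j) (jumps F (drop (Suc j) vs)) (last vs)"
      have eq: "segs (vs ! l) (jumps F (drop j vs)) (last vs) = insert (vs ! l, vs ! j) ?S"
        using F unfolding dr by simp
      have run: "is_run F vs l j" using less.prems F j unfolding is_run_def by auto
      have IH: "?S \<subseteq> {(vs ! l, vs ! h) |l h. is_run F vs l h} \<and>
        (\<forall>k. Suc j \<le> k \<and> k < length vs \<longrightarrow> (\<exists>l' h. is_run F vs l' h \<and> l' \<le> k \<and> k \<le> h \<and> (vs ! l', vs ! h) \<in> ?S))"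
        by (rule less.hyps) (use j F in auto)
      show ?thesis unfolding eq
      proof (intro conjI allI impI)
        show "insert (vs ! l, vs ! j) ?S \<subseteq> {(vs ! l, vs ! h) |l h. is_run F vs l h}" using IH run by blast
        fix k assume k: "l \<le> k \<and> k < length vs"
        show "\<exists>l' h. is_run F vs l' h \<and> l' \<le> k \<and> k \<le> h \<and> (vs ! l', vs ! h) \<in> insert (vs ! l, vs ! j) ?S"
        proof (cases "k \<le> j")
          case True
          then show ?thesis using run k by blast
        next
          case False
          then have "Suc j \<le> k \<and> k < length vs" using k by simp
          then show ?thesis using IH by blast
        qed
      qed
    next
      case nF: False
      have eq: "jumps F (drop j vs) = jumps F (drop (Suc j) vs)" using nF unfolding dr by simp
      show ?thesis unfolding eq
        by (rule less.hyps) (use less.prems j nF in \<open>auto simp: less_Suc_eq\<close>)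
    qed
  qed
qed

lemma segs_runs:
  fixes F :: "'a \<Rightarrow> 'a \<Rightarrow> bool"
  assumes "vs \<noteq> []"
  defines "S \<equiv> segs (hd vs) (jumps F vs) (last vs)"
  shows "\<And>b a. (b, a) \<in> S \<Longrightarrow> \<exists>l h. is_run F vs l h \<and> b = vs ! l \<and> a = vs ! h"
    and "\<And>k. k < length vs \<Longrightarrow> \<exists>l h. is_run F vs l h \<and> l \<le> k \<and> k \<le> h \<and> (vs ! l, vs ! h) \<in> S"
proof -
  have *: "S \<subseteq> {(vs ! l, vs ! h) |l h. is_run F vs l h} \<and> (\<forall>k. 0 \<le> k \<and> k < length vs \<longrightarrow>
      (\<exists>l' h. is_run F vs l' h \<and> l' \<le> k \<and> k \<le> h \<and> (vs ! l', vs ! h) \<in> S))"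
    using segs_runs_aux[of 0 0 vs F] assms(1) unfolding S_def hd_conv_nth[OF assms(1)] by simp
  show "\<And>b a. (b, a) \<in> S \<Longrightarrow> \<exists>l h. is_run F vs l h \<and> b = vs ! l \<and> a = vs ! h"
    using * by blast
  show "\<And>k. k < length vs \<Longrightarrow> \<exists>l h. is_run F vs l h \<and> l \<le> k \<and> k \<le> h \<and> (vs ! l, vs ! h) \<in> S"
    using * by blast
qed

section \<open>Vertices that every walk between the ends of a run meets\<close>

lemma avoid_subpath:
  assumes "i \<le> j" "\<And>k. i \<le> k \<Longrightarrow> k < j \<Longrightarrow> H (vs ! k) (vs ! Suc k)" "\<And>k. i \<le> k \<Longrightarrow> k \<le> j \<Longrightarrow> vs ! k \<noteq> z"
  shows "avoid H z (vs ! i) (vs ! j)"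
  using assms
proof (induction j)
  case 0
  then show ?case by (auto intro: avoid_refl)
next
  case (Suc j)
  show ?case
  proof (cases "i = Suc j")
    case True
    then show ?thesis using Suc.prems(3) by (auto intro: avoid_refl)
  next
    case False
    then have "avoid H z (vs ! i) (vs ! j)" using Suc by auto
    moreover have "avoid H z (vs ! j) (vs ! Suc j)" using Suc.prems False by (intro avoid_step) auto
    ultimately show ?thesis by (rule avoid_trans)
  qed
qed

text \<open>If \<open>vs ! i\<close> and \<open>vs ! p\<close> were not adjacent, they would be separated by some \<open>vs ! m\<close> between them;
  but the ends of the run are connected without it.\<close>

lemma run_adjacent:
  assumes sym: "symp H"
    and bg: "\<And>u v. u \<noteq> v \<Longrightarrow> H\<^sup>*\<^sup>* u v \<Longrightarrow> (\<And>x. x \<noteq> u \<Longrightarrow> x \<noteq> v \<Longrightarrow> avoid H x u v) \<Longrightarrow> H u v"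
    and dist: "distinct vs" and h: "h < length vs"
    and run: "\<And>k. l \<le> k \<Longrightarrow> k < h \<Longrightarrow> H (vs ! k) (vs ! Suc k)"
    and ip: "l \<le> i" "i < p" "p \<le> h"
    and between: "\<And>m. i < m \<Longrightarrow> m < p \<Longrightarrow> avoid H (vs ! m) (vs ! l) (vs ! h)"
  shows "H (vs ! i) (vs ! p)"
proof (rule bg)
  have neq: "vs ! a \<noteq> vs ! b" if "a \<noteq> b" "a \<le> h" "b \<le> h" for a b
    using that nth_eq_iff_index_eq[OF dist, of a b] h by auto
  show "vs ! i \<noteq> vs ! p" using neq ip by auto
  have "j \<le> p \<Longrightarrow> i \<le> j \<Longrightarrow> H\<^sup>*\<^sup>* (vs ! i) (vs ! j)" for j
  proof (induction j)
    case (Suc j)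
    show ?case
    proof (cases "i = Suc j")
      case False
      then have "H\<^sup>*\<^sup>* (vs ! i) (vs ! j)" "H (vs ! j) (vs ! Suc j)" using Suc run[of j] ip by auto
      then show ?thesis by (rule rtranclp.rtrancl_into_rtrancl)
    qed simp
  qed simp
  then show "H\<^sup>*\<^sup>* (vs ! i) (vs ! p)" using ip by simp
  fix x assume x: "x \<noteq> vs ! i" "x \<noteq> vs ! p"
  have sub: "avoid H x (vs ! a) (vs ! b)" if "l \<le> a" "a \<le> b" "b \<le> h" "\<And>k. a \<le> k \<Longrightarrow> k \<le> b \<Longrightarrow> vs ! k \<noteq> x" for a b
    using avoid_subpath[of a b H vs x] that run by auto
  show "avoid H x (vs ! i) (vs ! p)"
  proof (cases "\<exists>m. i < m \<and> m < p \<and> x = vs ! m")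
    case True
    then obtain m where m: "i < m" "m < p" "x = vs ! m" by blast
    have "avoid H x (vs ! l) (vs ! i)" by (rule sub) (use m ip neq in auto)
    moreover have "avoid H x (vs ! p) (vs ! h)" by (rule sub) (use m ip neq in auto)
    moreover have "avoid H x (vs ! l) (vs ! h)" using between m by blast
    ultimately show ?thesis using avoid_sym[OF sym] avoid_trans by metis
  next
    case False
    have "vs ! k \<noteq> x" if "i \<le> k" "k \<le> p" for k
      using False x that by (metis le_neq_implies_less)
    then show ?thesis using sub ip by auto
  qed
qed

text \<open>A generating relation for the order of the skeleton: the jumps, and for each stretch the
  adjacent pairs of forced vertices such that the first separates the start \<open>b\<close> from
  the second. It may hold more than the successor pairs, since only its transitive closure is used.
  The ends of a stretch count as forced because \<open>avoid\<close> is false when the avoided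
  vertex is an end.\<close>

definition forced_step :: "('a \<Rightarrow> 'a \<Rightarrow> bool) \<Rightarrow> ('a \<times> 'a) set \<Rightarrow> ('a \<times> 'a) set \<Rightarrow> 'a \<Rightarrow> 'a \<Rightarrow> bool" where
  "forced_step H J S x y \<longleftrightarrow> (x, y) \<in> J \<or>
     (\<exists>b a. (b, a) \<in> S \<and> \<not> avoid H x b a \<and> \<not> avoid H y b a \<and> H x y \<and> \<not> avoid H x b y)"

text \<open>With the jumps of the path as guess, \<open>T\<close> turns out to be the order of
  positions on the set \<open>D\<close> of forced positions. The path itself then shows a fitting
  gap for each other vertex, and \<open>late\<close> never excludes that gap.\<close>

lemma accepts_complete:
  fixes E F H P :: vrel
  assumes dist: "distinct vs" and sn: "set vs = {..<n}" and n: "0 < n"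
    and path: "\<And>i. Suc i < length vs \<Longrightarrow> E (vs ! i) (vs ! Suc i)"
    and ext: "\<And>i j. i < length vs \<Longrightarrow> j < length vs \<Longrightarrow> P (vs ! i) (vs ! j) \<Longrightarrow> i \<le> j"
    and H: "\<And>u v. H u v \<longleftrightarrow> E u v \<and> \<not> F u v" and sym: "symp H" and irr: "\<And>u. \<not> H u u"
    and bg: "\<And>u v. u < n \<Longrightarrow> v < n \<Longrightarrow> u \<noteq> v \<Longrightarrow> H\<^sup>*\<^sup>* u v \<Longrightarrow> (\<And>x. x \<noteq> u \<Longrightarrow> x \<noteq> v \<Longrightarrow> avoid H x u v) \<Longrightarrow> H u v"
    and Hn: "\<And>u v. H u v \<Longrightarrow> u < n \<and> v < n"
  defines "J \<equiv> jumps F vs"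
  defines "T \<equiv> (forced_step H (set J) (segs (hd vs) J (last vs)))\<^sup>+\<^sup>+"
  shows "accepts n (hd vs) (last vs) T E H P"
proof -
  have bg': "H u v" if "u \<noteq> v" "H\<^sup>*\<^sup>* u v" "\<And>x. x \<noteq> u \<Longrightarrow> x \<noteq> v \<Longrightarrow> avoid H x u v" for u v
  proof -
    have "u < n" using that(1,2) Hn by (metis converse_rtranclpE)
    moreover have "v < n" using that(1,2) Hn by (metis rtranclp.cases)
    ultimately show ?thesis using bg that by blast
  qed
  have len: "length vs = n" using dist sn by (metis card_lessThan distinct_card)
  then have ne: "vs \<noteq> []" using n by auto
  define S where "S = segs (hd vs) J (last vs)"
  define N where "N = forced_step H (set J) S"
  have TN: "T = N\<^sup>+\<^sup>+" unfolding T_def N_def S_def ..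
  let ?R = "is_run F vs"
  note runs = segs_runs[OF ne, where F = F, folded J_def, folded S_def]
  have neq: "vs ! a \<noteq> vs ! b" if "a \<noteq> b" "a < n" "b < n" for a b
    using that nth_eq_iff_index_eq[OF dist, of a b] len by auto
  have runH: "H (vs ! k) (vs ! Suc k)" if "?R l h" "l \<le> k" "k < h" for l h k
    using that H path[of k] unfolding is_run_def by auto
  have sub: "avoid H x (vs ! a) (vs ! b)"
    if "?R l h" "l \<le> a" "a \<le> b" "b \<le> h" "\<And>k. a \<le> k \<Longrightarrow> k \<le> b \<Longrightarrow> vs ! k \<noteq> x" for a b l h x
    by (rule avoid_subpath) (use that runH[OF that(1)] in auto)
  \<comment> \<open>The positions that will form the skeleton: those whose vertex is met by every
    walk between the ends of its run.\<close>
  define D where "D = {i. i < n \<and> (\<exists>l h. ?R l h \<and> (vs ! l, vs ! h) \<in> S \<and> l \<le> i \<and> i \<le> h \<and>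
      \<not> avoid H (vs ! i) (vs ! l) (vs ! h))}"
  have run_le: "l \<le> h" "h < n" if "?R l h" for l h
    using that len unfolding is_run_def by auto
  have DI: "i \<in> D" if "?R l h" "(vs ! l, vs ! h) \<in> S" "l \<le> i" "i \<le> h"
    "\<not> avoid H (vs ! i) (vs ! l) (vs ! h)" for i l h
    unfolding D_def using that run_le(2)[OF that(1)] by (intro CollectI conjI exI[of _ l] exI[of _ h]) auto
  have Dn: "i < n" if "i \<in> D" for i using that unfolding D_def by simp
  have ends: "l \<in> D" "h \<in> D" if "?R l h" "(vs ! l, vs ! h) \<in> S" for l h
  proof -
    have "\<not> avoid H (vs ! l) (vs ! l) (vs ! h)" "\<not> avoid H (vs ! h) (vs ! l) (vs ! h)"
      unfolding avoid_def by auto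
    then show "l \<in> D" "h \<in> D" using DI[OF that] run_le[OF that(1)] by auto
  qed
  \<comment> \<open>Of two different runs through \<open>i\<close>, one would extend past an end of
    the other, and there an edge of F would lie inside a run.\<close>
  have run_unique: "l = l' \<and> h = h'" if "?R l h" "?R l' h'" "l \<le> i" "i \<le> h" "l' \<le> i" "i \<le> h'" for l h l' h' i
  proof -
    have L: "\<not> l < l'" if r: "?R l h" "?R l' h'" "l \<le> i" "i \<le> h" "l' \<le> i" "i \<le> h'" for l h l' h'
    proof
      assume "l < l'"
      then have "l \<le> l' - 1 \<and> l' - 1 < h" "Suc (l' - 1) = l'" "l' \<noteq> 0" using r by auto
      then show False using r(1,2) unfolding is_run_def by metis
    qed
    have R: "\<not> h < h'" if r: "?R l h" "?R l' h'" "l \<le> i" "i \<le> h" "l' \<le> i" "i \<le> h'" for l h l' h'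
    proof
      assume "h < h'"
      moreover have "h' < length vs" using r(2) unfolding is_run_def by simp
      ultimately have "l' \<le> h \<and> h < h'" "Suc h \<noteq> length vs" using r by auto
      then show False using r(1,2) unfolding is_run_def by metis
    qed
    show ?thesis using L[OF that] L[OF that(2,1,5,6,3,4)] R[OF that] R[OF that(2,1,5,6,3,4)] by simp
  qed
  have forced_D: "\<not> avoid H (vs ! i) (vs ! l) (vs ! h)" if "i \<in> D" "?R l h" "l \<le> i" "i \<le> h" for i l h
    using that run_unique unfolding D_def by blast
  \<comment> \<open>The run is itself a walk between its ends, so a vertex that all such walks meet
    lies on it.\<close>
  have in_run: "\<exists>i\<in>D. x = vs ! i \<and> l \<le> i \<and> i \<le> h"
    if r: "?R l h" "(vs ! l, vs ! h) \<in> S" "\<not> avoid H x (vs ! l) (vs ! h)" for l h x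
  proof -
    have "\<exists>k. l \<le> k \<and> k \<le> h \<and> vs ! k = x"
      using sub[OF r(1), of l h x] r unfolding is_run_def by blast
    then obtain k where k: "l \<le> k" "k \<le> h" "vs ! k = x" by blast
    then have "k \<in> D" using DI[OF r(1,2)] r(3) by simp
    then show ?thesis using k by blast
  qed
  have N_less: "\<exists>i\<in>D. \<exists>j\<in>D. i < j \<and> x = vs ! i \<and> y = vs ! j" if Nxy: "N x y" for x y
  proof (cases "(x, y) \<in> set J")
    case True
    then obtain k where k: "x = vs ! k" "y = vs ! Suc k" "Suc k < length vs" "F (vs ! k) (vs ! Suc k)"
      unfolding J_def set_jumps by blast
    obtain l h where lh: "?R l h" "l \<le> k" "k \<le> h" "(vs ! l, vs ! h) \<in> S" using runs(2)[of k] k by auto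
    have "h = k" using lh k(4) unfolding is_run_def by (metis le_neq_implies_less)
    then have kD: "k \<in> D" using ends lh by blast
    obtain l' h' where lh': "?R l' h'" "l' \<le> Suc k" "Suc k \<le> h'" "(vs ! l', vs ! h') \<in> S"
      using runs(2)[of "Suc k"] k by auto
    have "l' = Suc k" using lh' k(4) unfolding is_run_def by (metis Suc_le_lessD le_SucE)
    then have "Suc k \<in> D" using ends lh' by blast
    then show ?thesis using kD k by blast
  next
    case False
    then obtain b a where ba: "(b, a) \<in> S" "\<not> avoid H x b a" "\<not> avoid H y b a" "H x y" "\<not> avoid H x b y"
      using Nxy unfolding N_def forced_step_def by blast
    obtain l h where lh: "?R l h" "b = vs ! l" "a = vs ! h" using runs(1)[OF ba(1)] by blast
    have S: "(vs ! l, vs ! h) \<in> S" using ba(1) lh by simp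
    obtain i where i: "i \<in> D" "x = vs ! i" "l \<le> i" "i \<le> h" using in_run[OF lh(1) S] ba(2) lh by blast
    obtain j where j: "j \<in> D" "y = vs ! j" "l \<le> j" "j \<le> h" using in_run[OF lh(1) S] ba(3) lh by blast
    have "i < j"
    proof (rule ccontr)
      assume "\<not> i < j"
      moreover have "i \<noteq> j" using ba(4) irr i j by auto
      ultimately have "j < i" by simp
      \<comment> \<open>If \<open>y\<close> came before \<open>x\<close>, the initial part of the
        run would lead from \<open>b\<close> to \<open>y\<close> without meeting
        \<open>x\<close>.\<close>
      have "avoid H x (vs ! l) (vs ! j)"
        unfolding i(2) by (rule sub[OF lh(1)]) (use \<open>j < i\<close> i j Dn[OF i(1)] neq in auto)
      then show False using ba(5) lh j by simp
    qed
    then show ?thesis using i j by blast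
  qed
  have T_less: "\<exists>i\<in>D. \<exists>j\<in>D. i < j \<and> x = vs ! i \<and> y = vs ! j" if "T x y" for x y
    using that unfolding TN
  proof (induction rule: tranclp_induct)
    case (step y z)
    then obtain i j j' k where "i \<in> D" "j \<in> D" "i < j" "x = vs ! i" "y = vs ! j" "j' \<in> D" "k \<in> D" "j' < k" "y = vs ! j'" "z = vs ! k"
      using N_less[OF step.hyps(2)] by blast
    moreover from this have "j = j'" using neq Dn by metis
    ultimately show ?case by (metis less_trans)
  qed (use N_less in blast)
  \<comment> \<open>If position \<open>i\<close> ends its run, the next forced position is the head
    of the jump. Otherwise both positions lie in one run with no forced position between them, which
    is the situation of \<open>run_adjacent\<close>.\<close>
  have N_next: "N (vs ! i) (vs ! k)" and E_next: "E (vs ! i) (vs ! k)"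
    if ik: "i \<in> D" "k \<in> D" "i < k" "\<And>m. i < m \<Longrightarrow> m < k \<Longrightarrow> m \<notin> D" for i k
  proof -
    obtain l h where lh: "?R l h" "l \<le> i" "i \<le> h" "(vs ! l, vs ! h) \<in> S"
      using runs(2)[of i] Dn[OF ik(1)] len by auto
    have "N (vs ! i) (vs ! k) \<and> E (vs ! i) (vs ! k)"
    proof (cases "i = h")
      case True
      have kn: "k < n" using Dn ik(2) by blast
      then have hF: "F (vs ! h) (vs ! Suc h)" "Suc h < length vs"
        using lh(1) ik(3) True len unfolding is_run_def by auto
      have "(vs ! h, vs ! Suc h) \<in> set J" unfolding J_def set_jumps using hF by blast
      then have "N (vs ! h) (vs ! Suc h)" unfolding N_def forced_step_def by blast
      moreover from N_less[OF this] obtain j where "j \<in> D" "vs ! Suc h = vs ! j" by blast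
      then have "Suc h \<in> D" using neq Dn hF(2) len by metis
      then have "k = Suc h" using ik(3) ik(4)[of "Suc h"] True by (metis Suc_lessI lessI)
      ultimately show ?thesis using True path hF by auto
    next
      case False
      then have ih: "i < h" using lh by simp
      have hn: "h < length vs" using lh(1) unfolding is_run_def by simp
      have kh: "k \<le> h" using ends(2)[OF lh(1,4)] ik(4)[of h] ih by (meson not_le)
      have Hik: "H (vs ! i) (vs ! k)"
      proof (rule run_adjacent[OF sym bg' dist hn runH[OF lh(1)] lh(2) ik(3) kh])
        fix m assume m: "i < m" "m < k"
        then have "m \<notin> D" using ik(4) by blast
        then show "avoid H (vs ! m) (vs ! l) (vs ! h)" using DI[OF lh(1,4), of m] m lh(2) kh by auto
      qed
      \<comment> \<open>A walk from the start of the run to \<open>vs ! k\<close> around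
        \<open>vs ! i\<close> could be continued along the run to its end, although
        \<open>vs ! i\<close> is forced.\<close>
      have "\<not> avoid H (vs ! i) (vs ! l) (vs ! k)"
      proof
        assume a: "avoid H (vs ! i) (vs ! l) (vs ! k)"
        have "avoid H (vs ! i) (vs ! k) (vs ! h)"
          by (rule sub[OF lh(1)]) (use kh lh ik hn len neq in auto)
        then show False using avoid_trans[OF a] forced_D[OF ik(1) lh(1-3)] by blast
      qed
      then have "N (vs ! i) (vs ! k)"
        using lh Hik forced_D[OF ik(1) lh(1-3)] forced_D[OF ik(2) lh(1) _ kh] ik(3)
        unfolding N_def forced_step_def by auto
      then show ?thesis using Hik H by blast
    qed
    then show "N (vs ! i) (vs ! k)" "E (vs ! i) (vs ! k)" by auto
  qed
  \<comment> \<open>Chaining the steps between neighbouring forced positions gives the converse of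
    \<open>T_less\<close>.\<close>
  have less_T: "T (vs ! i) (vs ! j)" if "i \<in> D" "j \<in> D" "i < j" for i j
    using that
  proof (induction "j - i" arbitrary: i rule: less_induct)
    case less
    define k where "k = (LEAST k. k \<in> D \<and> i < k)"
    have k: "k \<in> D" "i < k" "\<And>m. i < m \<Longrightarrow> m < k \<Longrightarrow> m \<notin> D" "k \<le> j"
      using LeastI[of "\<lambda>k. k \<in> D \<and> i < k" j] not_less_Least[of _ "\<lambda>k. k \<in> D \<and> i < k"]
        Least_le[of "\<lambda>k. k \<in> D \<and> i < k" j] less.prems unfolding k_def by blast+
    have N: "N (vs ! i) (vs ! k)" using N_next less.prems k by blast
    show ?case
    proof (cases "k = j")
      case True
      then show ?thesis using N unfolding TN by blast
    next
      case False
      then have "T (vs ! k) (vs ! j)" using less.hyps[of k] k less.prems by auto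
      then show ?thesis using N unfolding TN by (rule tranclp_into_tranclp2[rotated])
    qed
  qed
  have T_iff: "T x y \<longleftrightarrow> (\<exists>i\<in>D. \<exists>j\<in>D. i < j \<and> x = vs ! i \<and> y = vs ! j)" for x y
    using T_less less_T by blast
  have hd: "hd vs = vs ! 0" and lst: "last vs = vs ! (n - 1)"
    using hd_conv_nth[OF ne] last_conv_nth[OF ne] len by auto
  have D0: "0 \<in> D"
  proof -
    obtain l h where "?R l h" "l \<le> 0" "0 \<le> h" "(vs ! l, vs ! h) \<in> S" using runs(2)[of 0] n len by auto
    then show ?thesis using ends by auto
  qed
  have Dl: "n - 1 \<in> D"
  proof -
    obtain l h where lh: "?R l h" "l \<le> n - 1" "n - 1 \<le> h" "(vs ! l, vs ! h) \<in> S"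
      using runs(2)[of "n - 1"] n len by auto
    then have "h = n - 1" using len unfolding is_run_def by auto
    then show ?thesis using ends lh by blast
  qed
  have pos: "\<exists>p<n. v = vs ! p" if "v < n" for v
    using that sn len by (metis in_set_conv_nth lessThan_iff)
  have vn: "vs ! p < n" if "p < n" for p using nth_mem[of p vs] that sn len by auto
  have inj: "i = j" if "vs ! i = vs ! j" "i < n" "j < n" for i j using neq that by blast
  have T_nth: "T (vs ! i) (vs ! j) \<longleftrightarrow> i \<in> D \<and> j \<in> D \<and> i < j" if "i < n" "j < n" for i j
    using T_iff inj Dn that by blast
  let ?W = "skel n (hd vs) T"
  have W_iff: "?W x \<longleftrightarrow> (\<exists>i\<in>D. x = vs ! i)" for x
  proof
    assume "?W x"
    then show "\<exists>i\<in>D. x = vs ! i" unfolding skel_def hd T_iff using D0 by blast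
  next
    assume "\<exists>i\<in>D. x = vs ! i"
    then obtain i where i: "i \<in> D" "x = vs ! i" by blast
    then have "i = 0 \<or> T (vs ! 0) x" using less_T D0 by blast
    then show "?W x" using i Dn vn unfolding skel_def hd by blast
  qed
  have W_nth: "?W (vs ! p) \<longleftrightarrow> p \<in> D" if "p < n" for p using W_iff inj Dn that by blast
  have succ: "skel_succ n (hd vs) T (vs ! i) (vs ! k) \<longleftrightarrow> i \<in> D \<and> k \<in> D \<and> i < k \<and> (\<forall>m. i < m \<and> m < k \<longrightarrow> m \<notin> D)"
    if "i < n" "k < n" for i k
  proof -
    have "(\<exists>z<n. ?W z \<and> T (vs ! i) z \<and> T z (vs ! k)) \<longleftrightarrow> i \<in> D \<and> k \<in> D \<and> (\<exists>m\<in>D. i < m \<and> m < k)"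
    proof
      assume "\<exists>z<n. ?W z \<and> T (vs ! i) z \<and> T z (vs ! k)"
      then obtain z where z: "z < n" "T (vs ! i) z" "T z (vs ! k)" by blast
      obtain m where "m < n" "z = vs ! m" using pos z(1) by blast
      then show "i \<in> D \<and> k \<in> D \<and> (\<exists>m\<in>D. i < m \<and> m < k)" using z T_nth that by blast
    next
      assume "i \<in> D \<and> k \<in> D \<and> (\<exists>m\<in>D. i < m \<and> m < k)"
      then show "\<exists>z<n. ?W z \<and> T (vs ! i) z \<and> T z (vs ! k)" using less_T W_iff vn Dn by blast
    qed
    then show ?thesis unfolding skel_succ_def using W_nth T_nth that by blast
  qed
  \<comment> \<open>The last forced position before \<open>p\<close>, that is, the gap in which the
    given path places the vertex at \<open>p\<close>.\<close>
  define pre where "pre = (\<lambda>p. Max {i \<in> D. i < p})"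
  have pre: "pre p \<in> D \<and> pre p < p \<and> (\<forall>m. pre p < m \<and> m < p \<longrightarrow> m \<notin> D)" if "p \<notin> D" for p
  proof -
    have "p \<noteq> 0" using that D0 by metis
    then have ne: "{i \<in> D. i < p} \<noteq> {}" using D0 by blast
    have fin: "finite {i \<in> D. i < p}" by simp
    have "pre p \<in> {i \<in> D. i < p}" unfolding pre_def by (rule Max_in[OF fin ne])
    moreover have "m \<le> pre p" if "m \<in> D" "m < p" for m unfolding pre_def using Max_ge[OF fin] that by blast
    ultimately show ?thesis by (auto simp: leD)
  qed
  have fits_pre: "fits n (hd vs) T H P (vs ! p) (vs ! pre p)" if p: "p < n" "p \<notin> D" for p
  proof -
    let ?i = "pre p"
    define k where "k = (LEAST k. k \<in> D \<and> p < k)"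
    have "p < n - 1" using p Dl by (metis One_nat_def Suc_pred less_Suc_eq n)
    then have k: "k \<in> D" "p < k" "\<And>m. p < m \<Longrightarrow> m < k \<Longrightarrow> m \<notin> D"
      using LeastI[of "\<lambda>k. k \<in> D \<and> p < k" "n - 1"] not_less_Least[of _ "\<lambda>k. k \<in> D \<and> p < k"] Dl
      unfolding k_def by blast+
    have gap: "m \<notin> D" if "?i < m" "m < k" for m
      using that pre[OF p(2)] k(3) p(2) by (metis linorder_neqE_nat)
    have kn: "k < n" "?i < n" using k(1) pre p Dn by auto
    obtain l h where lh: "?R l h" "l \<le> p" "p \<le> h" "(vs ! l, vs ! h) \<in> S" using runs(2)[of p] p len by auto
    have hn: "h < length vs" using lh(1) unfolding is_run_def by simp
    have li: "l \<le> ?i"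
    proof (rule ccontr)
      assume "\<not> l \<le> ?i"
      moreover have "l \<in> D" "l \<noteq> p" using ends[OF lh(1,4)] p by auto
      ultimately show False using pre[OF p(2)] lh(2) by auto
    qed
    have kh: "k \<le> h"
    proof (rule ccontr)
      assume "\<not> k \<le> h"
      moreover have "h \<in> D" "h \<noteq> p" using ends[OF lh(1,4)] p by auto
      ultimately show False using k(3)[of h] lh(3) by auto
    qed
    have av: "avoid H (vs ! m) (vs ! l) (vs ! h)" if "?i < m" "m < k" for m
      using gap[OF that] DI[OF lh(1,4), of m] that li kh by auto
    \<comment> \<open>No position strictly between \<open>pre p\<close> and \<open>k\<close> is
      forced, so the vertices at \<open>pre p\<close>, \<open>p\<close> and \<open>k\<close> are
      pairwise adjacent.\<close>
    note ra = run_adjacent[OF sym bg' dist hn runH[OF lh(1)]]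
    have ip: "?i < p" using pre p by blast
    have "H (vs ! ?i) (vs ! k)" by (rule ra) (use li kh ip k(2) av in auto)
    moreover have "H (vs ! ?i) (vs ! p)" by (rule ra) (use li kh ip k(2) av in auto)
    moreover have "H (vs ! p) (vs ! k)" by (rule ra) (use li kh ip k(2) av in auto)
    moreover have "skel_succ n (hd vs) T (vs ! ?i) (vs ! k)"
      using succ[OF kn(2,1)] gap pre[OF p(2)] k(1,2) by auto
    moreover have "(P x (vs ! p) \<longrightarrow> x = vs ! ?i \<or> T x (vs ! ?i)) \<and> (P (vs ! p) x \<longrightarrow> T (vs ! ?i) x)"
      if x: "?W x" for x
    proof -
      obtain m where m: "m \<in> D" "x = vs ! m" using x W_iff by blast
      have mn: "m < n" "m \<noteq> p" using m Dn p by auto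
      show ?thesis
      proof (intro conjI impI)
        assume "P x (vs ! p)"
        then have "m < p" using ext[of m p] mn p len m by fastforce
        then have "m \<le> ?i" using pre[OF p(2)] m by (meson not_le)
        then have "m = ?i \<or> m < ?i" by auto
        then show "x = vs ! ?i \<or> T x (vs ! ?i)" using less_T m pre[OF p(2)] by blast
      next
        assume "P (vs ! p) x"
        then have "p \<le> m" using ext[of p m] mn p len m by fastforce
        then show "T (vs ! ?i) x" using less_T m pre[OF p(2)] by auto
      qed
    qed
    ultimately show ?thesis unfolding fits_def using vn[OF kn(1)] sympD[OF sym] by blast
  qed
  \<comment> \<open>Lateness only ever rules out gaps before the one that the path uses. Were the
    gap \<open>pre p\<close> itself affected, some predecessor at a position \<open>q\<close> would
    be late there, so its gap would come after \<open>pre p\<close> by induction. But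
    \<open>q \<le> p\<close>, and then \<open>pre q\<close> would be a forced position strictly
    between \<open>pre p\<close> and \<open>p\<close>.\<close>
  have late: "T w (vs ! pre p)" if "late n (hd vs) T H P v w" "v = vs ! p" "p < n" "p \<notin> D" "?W w" for v w p
    using that
  proof (induction arbitrary: p rule: late.induct)
    case (1 v w)
    obtain k where k: "k \<in> D" "w = vs ! k" using 1 W_iff by blast
    let ?i = "pre p"
    have iD: "?i \<in> D" using pre 1 by blast
    show ?case
    proof (rule ccontr)
      assume "\<not> T w (vs ! ?i)"
      then have "\<not> k < ?i" using less_T k iD by blast
      then have "vs ! ?i = w \<or> T (vs ! ?i) w" using less_T k iD by (metis linorder_neqE_nat)
      moreover have "?W (vs ! ?i)" "vs ! ?i < n" using iD W_iff vn Dn by blast+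
      moreover have "fits n (hd vs) T H P v (vs ! ?i)" using fits_pre 1 by blast
      ultimately obtain u where u: "u < n" "P u v" "\<not> ?W u"
        "\<And>q. u = vs ! q \<Longrightarrow> q < n \<Longrightarrow> q \<notin> D \<Longrightarrow> ?W (vs ! ?i) \<Longrightarrow> T (vs ! ?i) (vs ! pre q)"
        using 1(3) unfolding late_step_def by blast
      obtain q where q: "q < n" "u = vs ! q" using pos u(1) by blast
      have qD: "q \<notin> D" using u(3) q W_iff by blast
      have "T (vs ! ?i) (vs ! pre q)" using u(4) q qD \<open>?W (vs ! ?i)\<close> by blast
      moreover have "pre q < n" using pre[OF qD] q by auto
      ultimately have "?i < pre q" using T_nth Dn[OF iD] by blast
      moreover have "q \<le> p" using ext[of q p] u(2) 1 q len by auto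
      then have "pre q < p" "pre q \<in> D" using pre[OF qD] by auto
      ultimately show False using pre[OF 1(6)] by blast
    qed
  qed
  show ?thesis
    unfolding accepts_def
  proof (intro conjI notI)
    assume "\<exists>x<n. ?W x \<and> T x x"
    then show False using T_less inj Dn by (metis less_irrefl)
  next
    assume "\<exists>x<n. \<exists>y<n. \<exists>z<n. ?W x \<and> ?W y \<and> ?W z \<and> T x y \<and> T y z \<and> \<not> T x z"
    then show False unfolding TN by (meson tranclp_trans)
  next
    assume "\<exists>x<n. \<exists>y<n. ?W x \<and> ?W y \<and> x \<noteq> y \<and> \<not> T x y \<and> \<not> T y x"
    then show False using W_iff less_T by (metis linorder_neqE_nat)
  next
    assume "\<exists>x<n. \<exists>y<n. skel_succ n (hd vs) T x y \<and> \<not> E x y"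
    then obtain x y where xy: "x < n" "y < n" "skel_succ n (hd vs) T x y" "\<not> E x y" by blast
    obtain i k where ik: "i < n" "x = vs ! i" "k < n" "y = vs ! k" using pos xy by blast
    then show False using E_next xy succ[OF ik(1,3)] by blast
  next
    assume "\<exists>x<n. \<exists>y<n. ?W x \<and> ?W y \<and> P x y \<and> x \<noteq> y \<and> \<not> T x y"
    then obtain x y where xy: "?W x" "?W y" "P x y" "x \<noteq> y" "\<not> T x y" by blast
    obtain i j where ij: "i \<in> D" "x = vs ! i" "j \<in> D" "y = vs ! j" using xy W_iff by blast
    have "i \<le> j" using ext[of i j] xy ij Dn len by auto
    then have "i < j" using xy(4) ij by (metis le_neq_implies_less)
    then show False using less_T ij xy by blast
  next
    show "?W (last vs)" using W_iff Dl lst by blast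
  next
    assume "\<exists>x<n. ?W x \<and> x \<noteq> last vs \<and> \<not> T x (last vs)"
    then obtain x where x: "?W x" "x \<noteq> last vs" "\<not> T x (last vs)" by blast
    obtain i where i: "i \<in> D" "x = vs ! i" using x W_iff by blast
    have "i < n - 1" using Dn[OF i(1)] x(2) i(2) lst by (metis One_nat_def Suc_pred less_Suc_eq n)
    then show False using less_T i Dl x lst by auto
  next
    assume "\<exists>v<n. \<not> ?W v \<and> \<not> (\<exists>w<n. ?W w \<and> \<not> late n (hd vs) T H P v w)"
    then obtain v where v: "v < n" "\<not> ?W v" "\<And>w. w < n \<Longrightarrow> ?W w \<Longrightarrow> late n (hd vs) T H P v w" by blast
    obtain p where p: "p < n" "v = vs ! p" using pos v(1) by blast
    have pD: "p \<notin> D" using v(2) p W_iff by blast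
    have i: "pre p \<in> D" using pre pD by blast
    have W: "?W (vs ! pre p)" using i W_iff by blast
    have "vs ! pre p < n" using Dn[OF i] vn by blast
    then have "late n (hd vs) T H P v (vs ! pre p)" using v(3) W by blast
    then have "T (vs ! pre p) (vs ! pre p)" using late p pD W by blast
    then show False using T_nth[of "pre p" "pre p"] Dn[OF i] by auto
  qed
qed

section \<open>Timed execution\<close>

declare split_paired_Ex [simp del] split_paired_All [simp del]

text \<open>The exact step count is relaxed to an upper bound, so that branches of different length
  can share one time polynomial.\<close>

definition runs :: "prog \<Rightarrow> state \<Rightarrow> nat \<Rightarrow> state \<Rightarrow> bool" where
  "runs c s T s' \<longleftrightarrow> (\<exists>t\<le>T. exec c s t s')"

lemma runs_mono: "runs c s T s' \<Longrightarrow> T \<le> T' \<Longrightarrow> runs c s T' s'"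
  unfolding runs_def using le_trans by blast

lemma runs_Seq:
  assumes "runs c s T s'" "runs d s' T' s''"
  shows "runs (Seq c d) s (T + T') s''"
  using assms exec.Seq unfolding runs_def by (metis add_mono)

lemma runs_Skip: "runs Skip s 1 s"
  and runs_Const: "runs (Const x m) s 1 ((fst s)(x := m), snd s)"
  and runs_Copy: "runs (Copy x y) s 1 ((fst s)(x := fst s y), snd s)"
  and runs_Inc: "runs (Inc x) s 1 ((fst s)(x := Suc (fst s x)), snd s)"
  and runs_Load: "runs (Load x A y) s 1 ((fst s)(x := snd s A (fst s y)), snd s)"
  and runs_Store: "runs (Store A x y) s 1 (fst s, (snd s)(A := (snd s A)(fst s x := fst s y)))"
  unfolding runs_def
  using exec.Skip[of s] exec.Const[of x m "fst s" "snd s"] exec.Copy[of x y "fst s" "snd s"]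
    exec.Inc[of x "fst s" "snd s"] exec.Load[of x A y "fst s" "snd s"]
    exec.Store[of A x y "fst s" "snd s"]
  by auto

lemma runs_If:
  assumes "fst s x < fst s y \<Longrightarrow> runs c s T s'" "\<not> fst s x < fst s y \<Longrightarrow> runs d s T s'"
  shows "runs (IfLess x y c d) s (T + 1) s'"
  using assms exec.IfTrue exec.IfFalse unfolding runs_def by (metis add_le_mono1)

text \<open>The variant bounds the number of iterations; each costs at most \<open>T\<close> and one
  step for the test, and the final failing test costs one more.\<close>

lemma runs_While:
  assumes step: "\<And>s. P s \<Longrightarrow> fst s x < fst s y \<Longrightarrow> \<exists>s'. runs c s T s' \<and> P s' \<and> \<mu> s' < (\<mu> s :: nat)"
    and "P s"
  shows "\<exists>s'. runs (WhileLess x y c) s (\<mu> s * (T + 1) + 1) s' \<and> P s' \<and> \<not> fst s' x < fst s' y"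
  using \<open>P s\<close>
proof (induction "\<mu> s" arbitrary: s rule: less_induct)
  case less
  show ?case
  proof (cases "fst s x < fst s y")
    case True
    obtain s1 where s1: "runs c s T s1" "P s1" "\<mu> s1 < \<mu> s"
      using step[OF less.prems True] by blast
    obtain s2 where s2: "runs (WhileLess x y c) s1 (\<mu> s1 * (T + 1) + 1) s2" "P s2" "\<not> fst s2 x < fst s2 y"
      using less.hyps[OF s1(3,2)] by blast
    have "Suc (\<mu> s1) * (T + 1) \<le> \<mu> s * (T + 1)"
      using s1(3) by (intro mult_right_mono) auto
    then have "T + (\<mu> s1 * (T + 1) + 1) + 1 \<le> \<mu> s * (T + 1) + 1"
      by simp
    moreover have "runs (WhileLess x y c) s (T + (\<mu> s1 * (T + 1) + 1) + 1) s2"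
      using s1(1) s2(1) exec.WhileTrue[OF True] unfolding runs_def
      by (meson add_le_mono add_le_mono1)
    ultimately show ?thesis using s2 runs_mono by blast
  next
    case False
    then show ?thesis using less.prems exec.WhileFalse[OF False] unfolding runs_def by (metis le_add2)
  qed
qed

definition for_loop :: "nat \<Rightarrow> nat \<Rightarrow> prog \<Rightarrow> prog" where
  "for_loop x y c = Seq (Const x 0) (WhileLess x y (Seq c (Inc x)))"

text \<open>By \<open>upd\<close> the invariant is independent of the counter, which is set and
  incremented outside the body. Each round costs two steps beyond the body, for the increment and
  the test; the other two are the initialisation and the last test.\<close>

lemma runs_for_loop:
  assumes step: "\<And>i u. i < n \<Longrightarrow> P i u \<Longrightarrow> fst u x = i \<Longrightarrow> \<exists>u'. runs c u T u' \<and> fst u' x = i \<and> P (Suc i) u'"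
    and upd: "\<And>i u v. P i u \<Longrightarrow> P i ((fst u)(x := v), snd u)" and y: "\<And>i u. P i u \<Longrightarrow> fst u y = n" and "P 0 s"
  shows "\<exists>s'. runs (for_loop x y c) s (n * (T + 2) + 2) s' \<and> P n s'"
proof -
  let ?s = "((fst s)(x := 0), snd s)"
  have inv: "fst ?s x \<le> n \<and> P (fst ?s x) ?s" using upd[OF \<open>P 0 s\<close>] by simp
  have "\<exists>s'. runs (WhileLess x y (Seq c (Inc x))) ?s ((n - fst ?s x) * (T + 1 + 1) + 1) s' \<and>
      (fst s' x \<le> n \<and> P (fst s' x) s') \<and> \<not> fst s' x < fst s' y"
  proof (rule runs_While[where P = "\<lambda>u. fst u x \<le> n \<and> P (fst u x) u" and \<mu> = "\<lambda>u. n - fst u x", OF _ inv])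
    fix u assume u: "fst u x \<le> n \<and> P (fst u x) u" "fst u x < fst u y"
    have lt: "fst u x < n" using u y by metis
    then obtain u' where u': "runs c u T u'" "fst u' x = fst u x" "P (Suc (fst u x)) u'" using step u by blast
    let ?v = "((fst u')(x := Suc (fst u' x)), snd u')"
    have "runs (Seq c (Inc x)) u (T + 1) ?v" by (rule runs_Seq[OF u'(1) runs_Inc])
    moreover have "P (fst ?v x) ?v" using upd[OF u'(3)] u'(2) by simp
    ultimately show "\<exists>s'. runs (Seq c (Inc x)) u (T + 1) s' \<and> (fst s' x \<le> n \<and> P (fst s' x) s') \<and>
        n - fst s' x < n - fst u x"
      using lt u'(2) by (intro exI[of _ ?v]) auto
  qed
  then obtain s' where s': "runs (WhileLess x y (Seq c (Inc x))) ?s (n * (T + 1 + 1) + 1) s'" "P n s'"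
    using y by fastforce
  have "1 + (n * (T + 1 + 1) + 1) = n * (T + 2) + 2" by simp
  then show ?thesis using runs_Seq[OF runs_Const s'(1)] s'(2) unfolding for_loop_def by metis
qed

text \<open>Compiled code uses the registers from \<open>L\<close> on as scratch space, so its
  correctness can only be stated up to their contents.\<close>

definition agree :: "nat \<Rightarrow> state \<Rightarrow> state \<Rightarrow> bool" where
  "agree L s s' \<longleftrightarrow> snd s = snd s' \<and> (\<forall>i<L. fst s i = fst s' i)"

lemma agree_refl: "agree L s s"
  by (simp add: agree_def)

lemma agree_trans: "agree L s s' \<Longrightarrow> agree L s' s'' \<Longrightarrow> agree L s s''"
  by (simp add: agree_def)

section \<open>First-order formulas over a RAM state\<close>

text \<open>Ternary relations on \<open>{..<n}\<close> are stored in arrays, \<open>n\<close> being the content of register 0. A binary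
  relation is the slice \<open>x = 0\<close>, which is the layout of the input matrices.\<close>

definition idx :: "nat \<Rightarrow> nat \<Rightarrow> nat \<Rightarrow> nat \<Rightarrow> nat" where
  "idx n x y z = (x * n + y) * n + z"

definition rel :: "state \<Rightarrow> nat \<Rightarrow> nat \<Rightarrow> nat \<Rightarrow> nat \<Rightarrow> bool" where
  "rel s A x y z \<longleftrightarrow> x < fst s 0 \<and> y < fst s 0 \<and> z < fst s 0 \<and> snd s A (idx (fst s 0) x y z) \<noteq> 0"

lemma mult_add_less_inj:
  fixes n :: nat
  assumes "a * n + b = c * n + d" "b < n" "d < n"
  shows "a = c \<and> b = d"
proof -
  have "(a * n + b) div n = a" "(c * n + d) div n = c" "(a * n + b) mod n = b" "(c * n + d) mod n = d"
    using assms(2,3) by auto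
  then show ?thesis using assms(1) by metis
qed

lemma idx_inj:
  assumes "idx n x y z = idx n x' y' z'" "y < n" "z < n" "y' < n" "z' < n"
  shows "x = x' \<and> y = y' \<and> z = z'"
  using assms mult_add_less_inj unfolding idx_def by meson

text \<open>Registers serve as the variables of a formula and array names as its relation symbols,
  so that a machine state is at once a structure and an assignment.\<close>

datatype fm =
    LessF nat nat
  | RelF nat nat nat nat
  | NegF fm
  | ConjF fm fm
  | ExF nat fm

fun holds :: "fm \<Rightarrow> state \<Rightarrow> bool" where
  "holds (LessF x y) s \<longleftrightarrow> fst s x < fst s y"
| "holds (RelF A x y z) s \<longleftrightarrow> rel s A (fst s x) (fst s y) (fst s z)"
| "holds (NegF \<phi>) s \<longleftrightarrow> \<not> holds \<phi> s"
| "holds (ConjF \<phi> \<psi>) s \<longleftrightarrow> holds \<phi> s \<and> holds \<psi> s"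
| "holds (ExF x \<phi>) s \<longleftrightarrow> (\<exists>v<fst s 0. holds \<phi> ((fst s)(x := v), snd s))"

text \<open>A quantifier may not bind register 0, which holds the size of the domain.\<close>

fun fm_ok :: "nat \<Rightarrow> fm \<Rightarrow> bool" where
  "fm_ok L (LessF x y) \<longleftrightarrow> x < L \<and> y < L"
| "fm_ok L (RelF A x y z) \<longleftrightarrow> x < L \<and> y < L \<and> z < L"
| "fm_ok L (NegF \<phi>) \<longleftrightarrow> fm_ok L \<phi>"
| "fm_ok L (ConjF \<phi> \<psi>) \<longleftrightarrow> fm_ok L \<phi> \<and> fm_ok L \<psi>"
| "fm_ok L (ExF x \<phi>) \<longleftrightarrow> 0 < x \<and> x < L \<and> fm_ok L \<phi>"

fun fm_arrays :: "fm \<Rightarrow> nat set" where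
  "fm_arrays (LessF x y) = {}"
| "fm_arrays (RelF A x y z) = {A}"
| "fm_arrays (NegF \<phi>) = fm_arrays \<phi>"
| "fm_arrays (ConjF \<phi> \<psi>) = fm_arrays \<phi> \<union> fm_arrays \<psi>"
| "fm_arrays (ExF x \<phi>) = fm_arrays \<phi>"

lemma fm_ok_mono: "fm_ok L \<phi> \<Longrightarrow> L \<le> M \<Longrightarrow> fm_ok M \<phi>"
  by (induction \<phi>) auto

lemma holds_cong:
  assumes "fm_ok L \<phi>" "0 < L" "\<forall>i<L. fst s i = fst s' i" "\<forall>A\<in>fm_arrays \<phi>. snd s A = snd s' A"
  shows "holds \<phi> s = holds \<phi> s'"
  using assms
proof (induction \<phi> arbitrary: s s')
  case (ExF x \<phi>)
  have "holds \<phi> ((fst s)(x := v), snd s) = holds \<phi> ((fst s')(x := v), snd s')" for v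
    by (rule ExF.IH) (use ExF.prems in auto)
  then show ?case using ExF.prems by auto
next
  case (ConjF \<phi> \<psi>)
  have "holds \<phi> s = holds \<phi> s'" "holds \<psi> s = holds \<psi> s'"
    using ConjF by (auto intro: ConjF.IH)
  then show ?case by simp
qed (auto simp: rel_def)

lemma holds_agree: "fm_ok L \<phi> \<Longrightarrow> 0 < L \<Longrightarrow> agree L s s' \<Longrightarrow> holds \<phi> s = holds \<phi> s'"
  by (rule holds_cong) (auto simp: agree_def)

text \<open>Replaces the content m of register \<open>M\<close> by m n + y. As there is no
  multiplication, register \<open>M + 3\<close> is incremented m n times, with \<open>M + 1\<close>
  and \<open>M + 2\<close> as loop counters.\<close>

definition muladd :: "nat \<Rightarrow> nat \<Rightarrow> prog" where
  "muladd M y = Seq (Copy (M + 3) y) (Seq (for_loop (M + 1) M (for_loop (M + 2) 0 (Inc (M + 3)))) (Copy M (M + 3)))"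

lemma runs_muladd:
  assumes "y < M" "0 < M"
  shows "\<exists>s'. runs (muladd M y) s (fst s M * (3 * fst s 0 + 4) + 4) s' \<and> agree M s' s \<and>
    fst s' M = fst s M * fst s 0 + fst s y"
proof -
  let ?n = "fst s 0" and ?m = "fst s M"
  define P where "P = (\<lambda>k u. agree M u s \<and> fst u M = ?m \<and> fst u (M + 3) = k + fst s y)"
  have P0: "fst u 0 = ?n" if "P k u" for k u using that assms(2) unfolding P_def agree_def by auto
  have inner: "\<exists>u'. runs (for_loop (M + 2) 0 (Inc (M + 3))) u (?n * (1 + 2) + 2) u' \<and>
      P (i * ?n + ?n) u' \<and> fst u' (M + 1) = i" if "P (i * ?n) u" "fst u (M + 1) = i" for i u
  proof (rule runs_for_loop[where P = "\<lambda>j u. P (i * ?n + j) u \<and> fst u (M + 1) = i"])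
    fix j u assume "P (i * ?n + j) u \<and> fst u (M + 1) = i" "fst u (M + 2) = j"
    then show "\<exists>u'. runs (Inc (M + 3)) u 1 u' \<and> fst u' (M + 2) = j \<and> P (i * ?n + Suc j) u' \<and> fst u' (M + 1) = i"
      using runs_Inc[of "M + 3" u]
      by (intro exI[of _ "((fst u)(M + 3 := Suc (fst u (M + 3))), snd u)"]) (auto simp: P_def agree_def)
  qed (use that P0 in \<open>auto simp: P_def agree_def\<close>)
  have "\<exists>u. runs (for_loop (M + 1) M (for_loop (M + 2) 0 (Inc (M + 3)))) ((fst s)(M + 3 := fst s y), snd s)
      (?m * (?n * (1 + 2) + 2 + 2) + 2) u \<and> P (?m * ?n) u"
  proof (rule runs_for_loop)
    fix i u assume "P (i * ?n) u" "fst u (M + 1) = i"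
    then show "\<exists>u'. runs (for_loop (M + 2) 0 (Inc (M + 3))) u (?n * (1 + 2) + 2) u' \<and> fst u' (M + 1) = i \<and> P (Suc i * ?n) u'"
      using inner[of i u] by (auto simp: add.commute)
  qed (auto simp: P_def agree_def)
  then obtain u where u: "runs (for_loop (M + 1) M (for_loop (M + 2) 0 (Inc (M + 3)))) ((fst s)(M + 3 := fst s y), snd s)
      (?m * (?n * (1 + 2) + 2 + 2) + 2) u" "P (?m * ?n) u" by blast
  have "1 + ((?m * (?n * (1 + 2) + 2 + 2) + 2) + 1) = ?m * (3 * ?n + 4) + 4" by (simp add: algebra_simps)
  then have "runs (muladd M y) s (?m * (3 * ?n + 4) + 4) ((fst u)(M := fst u (M + 3)), snd u)"
    using runs_Seq[OF runs_Copy runs_Seq[OF u(1) runs_Copy]] unfolding muladd_def by metis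
  then show ?thesis using u(2) unfolding P_def
    by (intro exI[of _ "((fst u)(M := fst u (M + 3)), snd u)"]) (auto simp: agree_def)
qed

definition idxcode :: "nat \<Rightarrow> nat \<Rightarrow> nat \<Rightarrow> nat \<Rightarrow> prog" where
  "idxcode M x y z = Seq (Copy M x) (Seq (muladd M y) (muladd M z))"

text \<open>The two calls of \<open>muladd\<close> multiply numbers of at most n and n^2 by n. A
  call with factor m takes at most m (3 n + 4) + 4 steps, and the initial copy takes one; this
  explains 9 = 4 + 4 + 1.\<close>

definition idxtime :: "nat poly" where
  "idxtime = ([:0, 1:] + [:0, 0, 1:]) * [:4, 3:] + [:9:]"

lemma runs_idxcode:
  assumes "x < M" "y < M" "z < M" "fst s x < fst s 0" "fst s y < fst s 0"
  shows "\<exists>s'. runs (idxcode M x y z) s (poly idxtime (fst s 0)) s' \<and> agree M s' s \<and>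
    fst s' M = idx (fst s 0) (fst s x) (fst s y) (fst s z)"
proof -
  have M: "0 < M" using assms by simp
  let ?n = "fst s 0"
  let ?s1 = "((fst s)(M := fst s x), snd s)"
  obtain s2 where s2: "runs (muladd M y) ?s1 (fst s x * (3 * ?n + 4) + 4) s2" "agree M s2 s"
      "fst s2 M = fst s x * ?n + fst s y"
    using runs_muladd[OF assms(2) M, of ?s1] assms(2) M unfolding agree_def by auto
  have n2: "fst s2 0 = ?n" "fst s2 z = fst s z" using s2(2) M assms unfolding agree_def by auto
  obtain s3 where s3: "runs (muladd M z) s2 (fst s2 M * (3 * ?n + 4) + 4) s3" "agree M s3 s2"
      "fst s3 M = fst s2 M * ?n + fst s z"
    using runs_muladd[OF assms(3) M, of s2] unfolding n2 by auto
  have "runs (idxcode M x y z) s (1 + ((fst s x * (3 * ?n + 4) + 4) + (fst s2 M * (3 * ?n + 4) + 4))) s3"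
    unfolding idxcode_def by (rule runs_Seq[OF runs_Copy runs_Seq[OF s2(1) s3(1)]])
  moreover have "1 + ((fst s x * (3 * ?n + 4) + 4) + (fst s2 M * (3 * ?n + 4) + 4)) \<le> poly idxtime ?n"
  proof -
    have "Suc (fst s x) * ?n \<le> ?n * ?n" using assms(4) by (intro mult_right_mono) auto
    then have "fst s2 M \<le> ?n * ?n" using s2(3) assms(5) by simp
    then have "(fst s x + fst s2 M) * (3 * ?n + 4) \<le> (?n + ?n * ?n) * (3 * ?n + 4)"
      using assms(4) by (intro mult_right_mono add_mono) auto
    then show ?thesis unfolding idxtime_def by (simp add: algebra_simps)
  qed
  ultimately have "runs (idxcode M x y z) s (poly idxtime ?n) s3" by (rule runs_mono)
  then show ?thesis using s3 s2 agree_trans[OF s3(2) s2(2)] unfolding idx_def by auto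
qed

text \<open>An argument out of range could produce the index of a different cell, so such an access
  is skipped.\<close>

definition guarded :: "nat \<Rightarrow> nat \<Rightarrow> nat \<Rightarrow> prog \<Rightarrow> prog" where
  "guarded x y z c = IfLess x 0 (IfLess y 0 (IfLess z 0 c Skip) Skip) Skip"

lemma runs_guarded:
  assumes "fst s x < fst s 0 \<Longrightarrow> fst s y < fst s 0 \<Longrightarrow> fst s z < fst s 0 \<Longrightarrow> runs c s T s'"
    and "\<not> (fst s x < fst s 0 \<and> fst s y < fst s 0 \<and> fst s z < fst s 0) \<Longrightarrow> s' = s"
    and "1 \<le> T"
  shows "runs (guarded x y z c) s (T + 3) s'"
proof -
  have "runs Skip s T' s" if "T' \<ge> 1" for T' using runs_mono[OF runs_Skip that] .
  then have "runs (guarded x y z c) s (T + 1 + 1 + 1) s'"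
    unfolding guarded_def by (intro runs_If) (use assms in auto)
  then show ?thesis by (simp add: eval_nat_numeral)
qed

text \<open>The truth value is left in register \<open>L\<close>. A subformula is compiled with a
  larger offset as soon as some value has to outlive it. A quantifier saves the old content of its
  register in \<open>L + 1\<close> and restores it in the end, so that all registers below
  \<open>L\<close> are preserved.\<close>

fun fcode :: "nat \<Rightarrow> fm \<Rightarrow> prog" where
  "fcode L (LessF x y) = IfLess x y (Const L 1) (Const L 0)"
| "fcode L (RelF A x y z) = Seq (Const L 0)
     (guarded x y z (Seq (idxcode (L + 1) x y z) (Seq (Load (L + 1) A (L + 1)) (IfLess L (L + 1) (Const L 1) Skip))))"
| "fcode L (NegF \<phi>) = Seq (fcode L \<phi>) (Seq (Const (L + 1) 1) (IfLess L (L + 1) (Const L 1) (Const L 0)))"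
| "fcode L (ConjF \<phi> \<psi>) = Seq (fcode L \<phi>) (Seq (fcode (L + 1) \<psi>)
     (IfLess (L + 1) L (Const L 0) Skip))"
| "fcode L (ExF x \<phi>) = Seq (Copy (L + 1) x) (Seq (Const L 0) (Seq (for_loop (L + 2) 0
     (Seq (Copy x (L + 2)) (Seq (fcode (L + 3) \<phi>) (IfLess L (L + 3) (Const L 1) Skip)))) (Copy x (L + 1))))"

fun ftime :: "fm \<Rightarrow> nat poly" where
  "ftime (LessF x y) = [:2:]"
| "ftime (RelF A x y z) = idxtime + [:7:]"
| "ftime (NegF \<phi>) = ftime \<phi> + [:3:]"
| "ftime (ConjF \<phi> \<psi>) = ftime \<phi> + ftime \<psi> + [:2:]"
| "ftime (ExF x \<phi>) = [:0, 1:] * (ftime \<phi> + [:5:]) + [:5:]"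

lemma runs_fcode:
  assumes "fm_ok L \<phi>" "0 < L"
  shows "\<exists>s'. runs (fcode L \<phi>) s (poly (ftime \<phi>) (fst s 0)) s' \<and> agree L s' s \<and>
    fst s' L = of_bool (holds \<phi> s)"
  using assms
proof (induction \<phi> arbitrary: L s)
  case (LessF x y)
  have "runs (fcode L (LessF x y)) s (1 + 1) ((fst s)(L := of_bool (fst s x < fst s y)), snd s)"
    unfolding fcode.simps
    by (rule runs_If) (use runs_Const[of L 1 s] runs_Const[of L 0 s] in auto)
  then show ?case by (intro exI[of _ "((fst s)(L := of_bool (fst s x < fst s y)), snd s)"]) (auto simp: agree_def numeral_2_eq_2)
next
  case (RelF A x y z)
  let ?n = "fst s 0"
  let ?s1 = "((fst s)(L := 0), snd s)"
  let ?c = "Seq (idxcode (L + 1) x y z) (Seq (Load (L + 1) A (L + 1)) (IfLess L (L + 1) (Const L 1) Skip))"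
  let ?T = "poly idxtime ?n + (1 + (1 + 1))"
  have "\<exists>s'. runs (guarded x y z ?c) ?s1 (?T + 3) s' \<and> agree L s' s \<and> fst s' L = of_bool (holds (RelF A x y z) s)"
  proof (cases "fst s x < ?n \<and> fst s y < ?n \<and> fst s z < ?n")
    case True
    have xyz: "x < L + 1" "y < L + 1" "z < L + 1" "x \<noteq> L" "y \<noteq> L" "z \<noteq> L" using RelF.prems by auto
    obtain s2 where s2: "runs (idxcode (L + 1) x y z) ?s1 (poly idxtime ?n) s2" "agree (L + 1) s2 ?s1"
        "fst s2 (L + 1) = idx ?n (fst s x) (fst s y) (fst s z)"
      using runs_idxcode[OF xyz(1-3), of ?s1] True xyz RelF.prems by auto
    let ?s3 = "((fst s2)(L + 1 := snd s2 A (fst s2 (L + 1))), snd s2)"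
    let ?s4 = "((fst ?s3)(L := of_bool (snd s2 A (fst s2 (L + 1)) \<noteq> 0)), snd s2)"
    have L0: "fst s2 L = 0" using s2(2) unfolding agree_def by auto
    then have eq: "snd s2 A (fst s2 (L + 1)) = 0 \<Longrightarrow> ?s4 = ?s3" by auto
    have i4: "runs (IfLess L (L + 1) (Const L 1) Skip) ?s3 (1 + 1) ?s4"
      by (rule runs_If) (use runs_Const[of L 1 ?s3] runs_Skip[of ?s3] eq L0 in auto)
    have "runs (guarded x y z ?c) ?s1 (?T + 3) ?s4"
      by (rule runs_guarded, rule runs_Seq[OF s2(1) runs_Seq[OF runs_Load i4]])
        (use True xyz RelF.prems in auto)
    then show ?thesis using s2 True by (intro exI[of _ ?s4]) (auto simp: agree_def rel_def)
  next
    case False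
    then have "runs (guarded x y z ?c) ?s1 (?T + 3) ?s1"
      by (intro runs_guarded) (use RelF.prems in auto)
    then show ?thesis using False by (intro exI[of _ ?s1]) (auto simp: agree_def rel_def)
  qed
  then obtain s' where s': "runs (guarded x y z ?c) ?s1 (?T + 3) s'" "agree L s' s"
    "fst s' L = of_bool (holds (RelF A x y z) s)" by blast
  have "1 + (?T + 3) = poly (ftime (RelF A x y z)) ?n" by simp
  with runs_Seq[OF runs_Const s'(1)] have "runs (fcode L (RelF A x y z)) s (poly (ftime (RelF A x y z)) ?n) s'"
    by (metis fcode.simps(2))
  then show ?case using s' by blast
next
  case (NegF \<phi>)
  obtain s1 where s1: "runs (fcode L \<phi>) s (poly (ftime \<phi>) (fst s 0)) s1" "agree L s1 s"
    "fst s1 L = of_bool (holds \<phi> s)" using NegF.IH[of L s] NegF.prems by auto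
  let ?s2 = "((fst s1)(L + 1 := 1), snd s1)"
  let ?s3 = "((fst ?s2)(L := of_bool (\<not> holds \<phi> s)), snd s1)"
  have "runs (IfLess L (L + 1) (Const L 1) (Const L 0)) ?s2 (1 + 1) ?s3"
    by (rule runs_If) (use runs_Const[of L 1 ?s2] runs_Const[of L 0 ?s2] s1 in \<open>auto split: if_splits\<close>)
  from runs_Seq[OF s1(1) runs_Seq[OF runs_Const this]]
  have "runs (fcode L (NegF \<phi>)) s (poly (ftime (NegF \<phi>)) (fst s 0)) ?s3"
    by (simp add: eval_nat_numeral)
  then show ?case using s1 by (intro exI[of _ ?s3]) (auto simp: agree_def)
next
  case (ConjF \<phi> \<psi>)
  obtain s1 where s1: "runs (fcode L \<phi>) s (poly (ftime \<phi>) (fst s 0)) s1" "agree L s1 s"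
    "fst s1 L = of_bool (holds \<phi> s)" using ConjF.IH(1)[of L s] ConjF.prems by auto
  have ok: "fm_ok (L + 1) \<psi>" using ConjF.prems fm_ok_mono by auto
  obtain s2 where s2: "runs (fcode (L + 1) \<psi>) s1 (poly (ftime \<psi>) (fst s1 0)) s2" "agree (L + 1) s2 s1"
    "fst s2 (L + 1) = of_bool (holds \<psi> s1)" using ConjF.IH(2)[OF ok, of s1] by auto
  have h: "holds \<psi> s1 = holds \<psi> s" using holds_agree[OF _ _ s1(2)] ConjF.prems by auto
  have n1: "fst s1 0 = fst s 0" using s1(2) ConjF.prems unfolding agree_def by simp
  have L2: "fst s2 L = of_bool (holds \<phi> s)" using s2(2) s1(3) unfolding agree_def by simp
  let ?s3 = "((fst s2)(L := of_bool (holds \<phi> s \<and> holds \<psi> s)), snd s2)"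
  \<comment> \<open>The stored value changes only when \<phi> holds and \<psi> fails, and this is
    the case in which register \<open>L + 1\<close> is less than register \<open>L\<close>.\<close>
  have eq: "?s3 = s2" if "\<not> fst s2 (L + 1) < fst s2 L"
  proof -
    have "fst s2 L = of_bool (holds \<phi> s \<and> holds \<psi> s)"
      using that L2 s2(3) h by (auto split: if_splits)
    then show ?thesis by (metis fun_upd_triv prod.collapse)
  qed
  have "runs (IfLess (L + 1) L (Const L 0) Skip) s2 (1 + 1) ?s3"
    by (rule runs_If) (use runs_Const[of L 0 s2] runs_Skip[of s2] s2(3) L2 h eq in \<open>auto split: if_splits\<close>)
  from runs_Seq[OF s1(1) runs_Seq[OF s2(1) this]]
  have "runs (fcode L (ConjF \<phi> \<psi>)) s (poly (ftime (ConjF \<phi> \<psi>)) (fst s 0)) ?s3"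
    by (simp add: n1 eval_nat_numeral add_ac)
  then show ?case using s1 s2 by (intro exI[of _ ?s3]) (auto simp: agree_def)
next
  case (ExF x \<phi>)
  let ?n = "fst s 0"
  let ?s1 = "((fst s)(L + 1 := fst s x), snd s)"
  let ?s2 = "((fst ?s1)(L := 0), snd ?s1)"
  have x: "0 < x" "x < L" and ok: "fm_ok L \<phi>" using ExF.prems by auto
  \<comment> \<open>The bound register \<open>x\<close> is exempt from the invariant during the
    loop; register \<open>L\<close> holds the disjunction over the values tried so far.\<close>
  define P where "P = (\<lambda>i u. snd u = snd s \<and> (\<forall>j<L. j \<noteq> x \<longrightarrow> fst u j = fst s j) \<and> fst u (L + 1) = fst s x \<and>
     fst u L = of_bool (\<exists>v<i. holds \<phi> ((fst s)(x := v), snd s)))"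
  let ?body = "Seq (Copy x (L + 2)) (Seq (fcode (L + 3) \<phi>) (IfLess L (L + 3) (Const L 1) Skip))"
  let ?T = "1 + (poly (ftime \<phi>) ?n + (1 + 1))"
  have "\<exists>s'. runs (for_loop (L + 2) 0 ?body) ?s2 (?n * (?T + 2) + 2) s' \<and> P ?n s'"
  proof (rule runs_for_loop)
    fix i u assume i: "i < ?n" and u: "P i u" "fst u (L + 2) = i"
    let ?u1 = "((fst u)(x := fst u (L + 2)), snd u)"
    obtain u2 where u2: "runs (fcode (L + 3) \<phi>) ?u1 (poly (ftime \<phi>) (fst ?u1 0)) u2" "agree (L + 3) u2 ?u1"
      "fst u2 (L + 3) = of_bool (holds \<phi> ?u1)"
      using ExF.IH[OF fm_ok_mono[OF ok], of "L + 3" ?u1] by auto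
    have h: "holds \<phi> ?u1 = holds \<phi> ((fst s)(x := i), snd s)"
      by (rule holds_agree[OF ok]) (use x u in \<open>auto simp: agree_def P_def\<close>)
    have n1: "fst ?u1 0 = ?n" using u x unfolding P_def by auto
    have L2: "fst u2 L = of_bool (\<exists>v<i. holds \<phi> ((fst s)(x := v), snd s))"
      using u2(2) u x unfolding agree_def P_def by auto
    let ?B = "\<exists>v<Suc i. holds \<phi> ((fst s)(x := v), snd s)"
    let ?u3 = "((fst u2)(L := of_bool ?B), snd u2)"
    have eq: "?u3 = u2" if "\<not> fst u2 L < fst u2 (L + 3)"
    proof -
      have "fst u2 L = of_bool ?B"
        using that L2 u2(3) h by (auto split: if_splits simp: less_Suc_eq)
      then show ?thesis by (metis fun_upd_triv prod.collapse)
    qed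
    have "runs (IfLess L (L + 3) (Const L 1) Skip) u2 (1 + 1) ?u3"
      by (rule runs_If) (use runs_Const[of L 1 u2] runs_Skip[of u2] u2(3) L2 h eq in \<open>auto split: if_splits simp: less_Suc_eq\<close>)
    then have "runs ?body u ?T ?u3"
      by (intro runs_Seq[OF runs_Copy runs_Seq]) (use u2(1) n1 in auto)
    moreover have "P (Suc i) ?u3" "fst ?u3 (L + 2) = i"
      using u u2(2) x unfolding P_def agree_def by auto
    ultimately show "\<exists>u'. runs ?body u ?T u' \<and> fst u' (L + 2) = i \<and> P (Suc i) u'" by blast
  qed (use x in \<open>auto simp: P_def\<close>)
  then obtain s4 where s4: "runs (for_loop (L + 2) 0 ?body) ?s2 (?n * (?T + 2) + 2) s4"
    "P ?n s4" by blast
  let ?s5 = "((fst s4)(x := fst s4 (L + 1)), snd s4)"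
  have "1 + (1 + ((?n * (?T + 2) + 2) + 1)) = poly (ftime (ExF x \<phi>)) ?n"
    by (simp add: algebra_simps)
  with runs_Seq[OF runs_Copy runs_Seq[OF runs_Const runs_Seq[OF s4(1) runs_Copy]]]
  have "runs (fcode L (ExF x \<phi>)) s (poly (ftime (ExF x \<phi>)) ?n) ?s5"
    by (metis fcode.simps(5))
  then show ?case using s4(2) x by (intro exI[of _ ?s5]) (auto simp: agree_def P_def)
qed

section \<open>A structured language with polynomial running time\<close>

text \<open>Both loop constructs run exactly n times, so every command has polynomial running time
  by construction. The one loop that is not polynomial, over the table of guesses, is kept outside
  this language.\<close>

datatype cmd =
    SkipC
  | ConstC nat nat
  | CopyC nat nat
  | IncC nat
  | LoadC nat nat nat
  | StoreC nat nat nat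
  | PutC nat nat nat nat fm
  | SeqC cmd cmd (infixr ";;" 60)
  | IfC fm cmd cmd
  | ForC nat cmd
  | RepC cmd

fun sem :: "cmd \<Rightarrow> state \<Rightarrow> state" where
  "sem SkipC s = s"
| "sem (ConstC x m) s = ((fst s)(x := m), snd s)"
| "sem (CopyC x y) s = ((fst s)(x := fst s y), snd s)"
| "sem (IncC x) s = ((fst s)(x := Suc (fst s x)), snd s)"
| "sem (LoadC x A y) s = ((fst s)(x := snd s A (fst s y)), snd s)"
| "sem (StoreC A x y) s = (fst s, (snd s)(A := (snd s A)(fst s x := fst s y)))"
| "sem (PutC A x y z \<phi>) s =
     (if fst s x < fst s 0 \<and> fst s y < fst s 0 \<and> fst s z < fst s 0
      then (fst s, (snd s)(A := (snd s A)(idx (fst s 0) (fst s x) (fst s y) (fst s z) := of_bool (holds \<phi> s))))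
      else s)"
| "sem (c ;; d) s = sem d (sem c s)"
| "sem (IfC \<phi> c d) s = (if holds \<phi> s then sem c s else sem d s)"
| "sem (ForC x c) s = fold (\<lambda>i s. sem c ((fst s)(x := i), snd s)) [0..<fst s 0] s"
| "sem (RepC c) s = (sem c ^^ fst s 0) s"

fun wregs :: "cmd \<Rightarrow> nat set" where
  "wregs (ConstC x m) = {x}"
| "wregs (CopyC x y) = {x}"
| "wregs (IncC x) = {x}"
| "wregs (LoadC x A y) = {x}"
| "wregs (c ;; d) = wregs c \<union> wregs d"
| "wregs (IfC \<phi> c d) = wregs c \<union> wregs d"
| "wregs (ForC x c) = insert x (wregs c)"
| "wregs (RepC c) = wregs c"
| "wregs _ = {}"

fun warrs :: "cmd \<Rightarrow> nat set" where
  "warrs (StoreC A x y) = {A}"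
| "warrs (PutC A x y z \<phi>) = {A}"
| "warrs (c ;; d) = warrs c \<union> warrs d"
| "warrs (IfC \<phi> c d) = warrs c \<union> warrs d"
| "warrs (ForC x c) = warrs c"
| "warrs (RepC c) = warrs c"
| "warrs _ = {}"

fun cmd_ok :: "nat \<Rightarrow> cmd \<Rightarrow> bool" where
  "cmd_ok L SkipC \<longleftrightarrow> True"
| "cmd_ok L (ConstC x m) \<longleftrightarrow> 0 < x \<and> x < L"
| "cmd_ok L (CopyC x y) \<longleftrightarrow> 0 < x \<and> x < L \<and> y < L"
| "cmd_ok L (IncC x) \<longleftrightarrow> 0 < x \<and> x < L"
| "cmd_ok L (LoadC x A y) \<longleftrightarrow> 0 < x \<and> x < L \<and> y < L"
| "cmd_ok L (StoreC A x y) \<longleftrightarrow> x < L \<and> y < L"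
| "cmd_ok L (PutC A x y z \<phi>) \<longleftrightarrow> x < L \<and> y < L \<and> z < L \<and> fm_ok L \<phi>"
| "cmd_ok L (c ;; d) \<longleftrightarrow> cmd_ok L c \<and> cmd_ok L d"
| "cmd_ok L (IfC \<phi> c d) \<longleftrightarrow> fm_ok L \<phi> \<and> cmd_ok L c \<and> cmd_ok L d"
| "cmd_ok L (ForC x c) \<longleftrightarrow> 0 < x \<and> x < L \<and> cmd_ok L c"
| "cmd_ok L (RepC c) \<longleftrightarrow> cmd_ok L c"

lemma cmd_ok_mono: "cmd_ok L c \<Longrightarrow> L \<le> M \<Longrightarrow> cmd_ok M c"
  by (induction c) (auto intro: fm_ok_mono)

lemma cmd_ok_wregs: "cmd_ok L c \<Longrightarrow> x \<in> wregs c \<Longrightarrow> 0 < x \<and> x < L"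
  by (induction c) auto

lemma fold_upt_inv:
  assumes "P 0 s" "\<And>i s. i < n \<Longrightarrow> P i s \<Longrightarrow> P (Suc i) (f i s)"
  shows "P n (fold f [0..<n] s)"
proof -
  have "k \<le> n \<Longrightarrow> P k (fold f [0..<k] s)" for k
    by (induction k) (use assms in auto)
  then show ?thesis by simp
qed

lemma funpow_inv:
  assumes "P 0 s" "\<And>i s. i < n \<Longrightarrow> P i s \<Longrightarrow> P (Suc i) (f s)"
  shows "P n ((f ^^ n) s)"
proof -
  have "k \<le> n \<Longrightarrow> P k ((f ^^ k) s)" for k
    by (induction k) (use assms in auto)
  then show ?thesis by simp
qed

text \<open>\<open>Q D\<close> is meant to say that the indices in \<open>D\<close> have been
  processed; round \<open>i\<close> adds the set \<open>A i\<close>. This suits nested loops, in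
  which one outer round processes a whole family.\<close>

lemma sem_ForC_UN:
  assumes "fst s 0 = n" "Q D s"
    and "\<And>i u. i < n \<Longrightarrow> Q (D \<union> (\<Union>k<i. A k)) u \<Longrightarrow> Q (D \<union> (\<Union>k<i. A k) \<union> A i) (sem c ((fst u)(x := i), snd u))"
  shows "Q (D \<union> (\<Union>k<n. A k)) (sem (ForC x c) s)"
  unfolding sem.simps assms(1)
proof (rule fold_upt_inv[where P = "\<lambda>i. Q (D \<union> (\<Union>k<i. A k))"])
  show "Q (D \<union> (\<Union>k<Suc i. A k)) (sem c ((fst u)(x := i), snd u))"
    if "i < n" "Q (D \<union> (\<Union>k<i. A k)) u" for i u
    using assms(3)[OF that] by (simp add: lessThan_Suc Un_ac)
qed (use assms(2) in simp)

lemma sem_frame_reg: "x \<notin> wregs c \<Longrightarrow> fst (sem c s) x = fst s x"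
proof (induction c arbitrary: s)
  case (ForC y c)
  show ?case unfolding sem.simps
    by (rule fold_upt_inv[where P = "\<lambda>i u. fst u x = fst s x"]) (use ForC in auto)
next
  case (RepC c)
  show ?case unfolding sem.simps
    by (rule funpow_inv[where P = "\<lambda>i u. fst u x = fst s x"]) (use RepC in auto)
qed auto

lemma sem_frame_arr: "A \<notin> warrs c \<Longrightarrow> snd (sem c s) A = snd s A"
proof (induction c arbitrary: s)
  case (ForC y c)
  show ?case unfolding sem.simps
    by (rule fold_upt_inv[where P = "\<lambda>i u. snd u A = snd s A"]) (use ForC in auto)
next
  case (RepC c)
  show ?case unfolding sem.simps
    by (rule funpow_inv[where P = "\<lambda>i u. snd u A = snd s A"]) (use RepC in auto)
qed auto

lemma sem_reg0: "cmd_ok L c \<Longrightarrow> fst (sem c s) 0 = fst s 0"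
  using sem_frame_reg cmd_ok_wregs by blast

text \<open>A compiled command leaves garbage in the scratch registers; this allows the next command
  to be run from such a state instead of the specified one.\<close>

lemma sem_agree: "cmd_ok L c \<Longrightarrow> 0 < L \<Longrightarrow> agree L s s' \<Longrightarrow> agree L (sem c s) (sem c s')"
proof (induction c arbitrary: s s')
  case (PutC A x y z \<phi>)
  then show ?case using holds_agree[of L \<phi> s s'] by (auto simp: agree_def)
next
  case (IfC \<phi> c d)
  then show ?case using holds_agree[of L \<phi> s s'] by auto
next
  case (ForC x c)
  have n: "fst s' 0 = fst s 0" using ForC.prems by (simp add: agree_def)
  have "agree L (fold (\<lambda>i s. sem c ((fst s)(x := i), snd s)) [0..<k] s)
           (fold (\<lambda>i s. sem c ((fst s)(x := i), snd s)) [0..<k] s')" for k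
  proof (induction k)
    case (Suc k)
    then show ?case using ForC.prems by (simp, intro ForC.IH) (auto simp: agree_def)
  qed (use ForC.prems in simp)
  then show ?case using n by simp
next
  case (RepC c)
  have n: "fst s' 0 = fst s 0" using RepC.prems by (simp add: agree_def)
  have "agree L ((sem c ^^ k) s) ((sem c ^^ k) s')" for k
    by (induction k) (use RepC in auto)
  then show ?case using n by simp
qed (auto simp: agree_def)

text \<open>A loop counts in register \<open>L\<close> and its body is compiled with
  \<open>L + 1\<close>, out of reach of the counter. \<open>ForC\<close> hands the body a copy in
  \<open>x\<close>, so changes of \<open>x\<close> in the body do not affect the loop.\<close>

fun ccode :: "nat \<Rightarrow> cmd \<Rightarrow> prog" where
  "ccode L SkipC = Skip"
| "ccode L (ConstC x m) = Const x m"
| "ccode L (CopyC x y) = Copy x y"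
| "ccode L (IncC x) = Inc x"
| "ccode L (LoadC x A y) = Load x A y"
| "ccode L (StoreC A x y) = Store A x y"
| "ccode L (PutC A x y z \<phi>) = Seq (fcode L \<phi>)
     (guarded x y z (Seq (idxcode (L + 1) x y z) (Store A (L + 1) L)))"
| "ccode L (c ;; d) = Seq (ccode L c) (ccode L d)"
| "ccode L (IfC \<phi> c d) = Seq (fcode L \<phi>) (Seq (Const (L + 1) 0) (IfLess (L + 1) L (ccode L c) (ccode L d)))"
| "ccode L (ForC x c) = for_loop L 0 (Seq (Copy x L) (ccode (L + 1) c))"
| "ccode L (RepC c) = for_loop L 0 (ccode (L + 1) c)"

fun ctime :: "cmd \<Rightarrow> nat poly" where
  "ctime (PutC A x y z \<phi>) = ftime \<phi> + idxtime + [:4:]"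
| "ctime (c ;; d) = ctime c + ctime d"
| "ctime (IfC \<phi> c d) = ftime \<phi> + ctime c + ctime d + [:2:]"
| "ctime (ForC x c) = [:0, 1:] * (ctime c + [:3:]) + [:2:]"
| "ctime (RepC c) = [:0, 1:] * (ctime c + [:2:]) + [:2:]"
| "ctime _ = [:1:]"

lemma runs_ccode:
  assumes "cmd_ok L c" "0 < L"
  shows "\<exists>s'. runs (ccode L c) s (poly (ctime c) (fst s 0)) s' \<and> agree L s' (sem c s)"
  using assms
proof (induction c arbitrary: L s)
  case SkipC
  then show ?case using runs_Skip agree_refl by fastforce
next
  case (ConstC x m)
  then show ?case using runs_Const agree_refl by fastforce
next
  case (CopyC x y)
  then show ?case using runs_Copy agree_refl by fastforce
next
  case (IncC x)
  then show ?case using runs_Inc agree_refl by fastforce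
next
  case (LoadC x A y)
  then show ?case using runs_Load agree_refl by fastforce
next
  case (StoreC A x y)
  then show ?case using runs_Store agree_refl by fastforce
next
  case (PutC A x y z \<phi>)
  let ?n = "fst s 0"
  obtain s1 where s1: "runs (fcode L \<phi>) s (poly (ftime \<phi>) ?n) s1" "agree L s1 s"
    "fst s1 L = of_bool (holds \<phi> s)" using runs_fcode[of L \<phi> s] PutC.prems by auto
  let ?c = "Seq (idxcode (L + 1) x y z) (Store A (L + 1) L)"
  have v: "x < L" "y < L" "z < L" using PutC.prems by auto
  have e: "fst s1 x = fst s x" "fst s1 y = fst s y" "fst s1 z = fst s z" "fst s1 0 = ?n"
    using s1(2) v PutC.prems unfolding agree_def by auto
  have "\<exists>s'. runs (guarded x y z ?c) s1 ((poly idxtime ?n + 1) + 3) s' \<and>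
      agree L s' (sem (PutC A x y z \<phi>) s)"
  proof (cases "fst s x < ?n \<and> fst s y < ?n \<and> fst s z < ?n")
    case True
    obtain s2 where s2: "runs (idxcode (L + 1) x y z) s1 (poly idxtime ?n) s2" "agree (L + 1) s2 s1"
      "fst s2 (L + 1) = idx ?n (fst s x) (fst s y) (fst s z)"
      using runs_idxcode[of x "L + 1" y z s1] v True unfolding e by auto
    let ?s3 = "(fst s2, (snd s2)(A := (snd s2 A)(fst s2 (L + 1) := fst s2 L)))"
    have "runs (guarded x y z ?c) s1 ((poly idxtime ?n + 1) + 3) ?s3"
      by (rule runs_guarded, rule runs_Seq[OF s2(1) runs_Store]) (use True e in auto)
    moreover have "fst s2 L = of_bool (holds \<phi> s)" using s1(3) s2(2) by (simp add: agree_def)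
    then have "agree L ?s3 (sem (PutC A x y z \<phi>) s)"
      using s1(2) s2(2,3) True by (auto simp: agree_def)
    ultimately show ?thesis by blast
  next
    case False
    then have "runs (guarded x y z ?c) s1 ((poly idxtime ?n + 1) + 3) s1"
      by (intro runs_guarded) (use e in auto)
    then show ?thesis using False s1(2) by auto
  qed
  then obtain s' where "runs (guarded x y z ?c) s1 ((poly idxtime ?n + 1) + 3) s'"
      "agree L s' (sem (PutC A x y z \<phi>) s)" by blast
  moreover have "poly (ftime \<phi>) ?n + ((poly idxtime ?n + 1) + 3) = poly (ctime (PutC A x y z \<phi>)) ?n"
    by simp
  ultimately show ?case using runs_Seq[OF s1(1)] by (metis ccode.simps(7))
next
  case (SeqC c d)
  obtain s1 where s1: "runs (ccode L c) s (poly (ctime c) (fst s 0)) s1" "agree L s1 (sem c s)"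
    using SeqC.IH(1)[of L s] SeqC.prems by auto
  obtain s2 where s2: "runs (ccode L d) s1 (poly (ctime d) (fst s1 0)) s2" "agree L s2 (sem d s1)"
    using SeqC.IH(2)[of L s1] SeqC.prems by auto
  have "fst s1 0 = fst s 0" using s1(2) SeqC.prems sem_reg0[of L c s] unfolding agree_def by auto
  moreover have "agree L s2 (sem d (sem c s))"
    using agree_trans[OF s2(2)] sem_agree[OF _ _ s1(2)] SeqC.prems by auto
  ultimately show ?case using runs_Seq[OF s1(1) s2(1)] by (intro exI[of _ s2]) auto
next
  case (IfC \<phi> c d)
  obtain s1 where s1: "runs (fcode L \<phi>) s (poly (ftime \<phi>) (fst s 0)) s1" "agree L s1 s"
    "fst s1 L = of_bool (holds \<phi> s)" using runs_fcode[of L \<phi> s] IfC.prems by auto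
  let ?s2 = "((fst s1)(L + 1 := 0), snd s1)"
  let ?n = "fst s 0"
  have a2: "agree L ?s2 s" using s1(2) by (simp add: agree_def)
  have n2: "fst ?s2 0 = ?n" using a2 IfC.prems by (simp add: agree_def)
  have "\<exists>s'. runs (IfLess (L + 1) L (ccode L c) (ccode L d)) ?s2 (poly (ctime c) ?n + poly (ctime d) ?n + 1) s' \<and>
    agree L s' (sem (IfC \<phi> c d) s)"
  proof (cases "holds \<phi> s")
    case True
    obtain s3 where s3: "runs (ccode L c) ?s2 (poly (ctime c) ?n) s3" "agree L s3 (sem c ?s2)"
      using IfC.IH(1)[of L ?s2] IfC.prems n2 by auto
    have "runs (IfLess (L + 1) L (ccode L c) (ccode L d)) ?s2 (poly (ctime c) ?n + poly (ctime d) ?n + 1) s3"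
      by (rule runs_If) (use runs_mono[OF s3(1)] True s1(3) in auto)
    then show ?thesis using True agree_trans[OF s3(2) sem_agree[OF _ _ a2]] IfC.prems by auto
  next
    case False
    obtain s3 where s3: "runs (ccode L d) ?s2 (poly (ctime d) ?n) s3" "agree L s3 (sem d ?s2)"
      using IfC.IH(2)[of L ?s2] IfC.prems n2 by auto
    have "runs (IfLess (L + 1) L (ccode L c) (ccode L d)) ?s2 (poly (ctime c) ?n + poly (ctime d) ?n + 1) s3"
      by (rule runs_If) (use runs_mono[OF s3(1)] False s1(3) in auto)
    then show ?thesis using False agree_trans[OF s3(2) sem_agree[OF _ _ a2]] IfC.prems by auto
  qed
  then obtain s' where s': "runs (IfLess (L + 1) L (ccode L c) (ccode L d)) ?s2 (poly (ctime c) ?n + poly (ctime d) ?n + 1) s'"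
    "agree L s' (sem (IfC \<phi> c d) s)" by blast
  have "poly (ftime \<phi>) ?n + (1 + (poly (ctime c) ?n + poly (ctime d) ?n + 1)) = poly (ctime (IfC \<phi> c d)) ?n"
    by simp
  then show ?case using runs_Seq[OF s1(1) runs_Seq[OF runs_Const s'(1)]] s'(2) by (metis ccode.simps(9))
next
  case (ForC x c)
  let ?n = "fst s 0"
  let ?f = "\<lambda>i s. sem c ((fst s)(x := i), snd s)"
  have x: "0 < x" "x < L" and ok: "cmd_ok L c" "cmd_ok (L + 1) c" using ForC.prems cmd_ok_mono by auto
  define P where "P = (\<lambda>i u. agree L u (fold ?f [0..<i] s))"
  have n0: "fst (fold ?f [0..<i] s) 0 = ?n" for i
    by (induction i) (use x sem_reg0[OF ok(1)] in auto)
  have n1: "fst u 0 = ?n" if "P i u" for i u using that n0 ForC.prems unfolding P_def agree_def by auto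
  let ?T = "1 + poly (ctime c) ?n"
  have "\<exists>s'. runs (ccode L (ForC x c)) s (?n * (?T + 2) + 2) s' \<and> P ?n s'"
    unfolding ccode.simps
  proof (rule runs_for_loop)
    fix i u assume i: "i < ?n" and u: "P i u" "fst u L = i"
    let ?u1 = "((fst u)(x := fst u L), snd u)"
    have u10: "fst ?u1 0 = ?n" using n1[OF u(1)] x by simp
    obtain u2 where u2: "runs (ccode (L + 1) c) ?u1 (poly (ctime c) ?n) u2" "agree (L + 1) u2 (sem c ?u1)"
      using ForC.IH[OF ok(2), of ?u1] unfolding u10 by auto
    have "agree L ?u1 ((fst (fold ?f [0..<i] s))(x := i), snd (fold ?f [0..<i] s))"
      using u unfolding P_def agree_def by auto
    then have "agree L (sem c ?u1) (fold ?f [0..<Suc i] s)"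
      using sem_agree[OF ok(1)] ForC.prems by simp
    moreover have "L \<notin> wregs c" using cmd_ok_wregs[OF ok(1)] by blast
    then have "fst (sem c ?u1) L = i" using sem_frame_reg[of L c ?u1] u x by auto
    ultimately have "P (Suc i) u2" "fst u2 L = i" using u2(2) unfolding P_def agree_def by auto
    moreover have "runs (Seq (Copy x L) (ccode (L + 1) c)) u ?T u2" by (rule runs_Seq[OF runs_Copy u2(1)])
    ultimately show "\<exists>u'. runs (Seq (Copy x L) (ccode (L + 1) c)) u ?T u' \<and> fst u' L = i \<and> P (Suc i) u'" by blast
  qed (use n1 in \<open>auto simp: P_def agree_def\<close>)
  moreover have eq: "poly (ctime (ForC x c)) ?n = ?n * (?T + 2) + 2" by (simp add: algebra_simps)
  ultimately show ?case unfolding eq P_def sem.simps by blast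
next
  case (RepC c)
  let ?n = "fst s 0"
  have ok: "cmd_ok L c" "cmd_ok (L + 1) c" using RepC.prems cmd_ok_mono by auto
  define P where "P = (\<lambda>i u. agree L u ((sem c ^^ i) s))"
  have n0: "fst ((sem c ^^ i) s) 0 = ?n" for i
    by (induction i) (use sem_reg0[OF ok(1)] in auto)
  have n1: "fst u 0 = ?n" if "P i u" for i u using that n0 RepC.prems unfolding P_def agree_def by auto
  let ?T = "poly (ctime c) ?n"
  have "\<exists>s'. runs (ccode L (RepC c)) s (?n * (?T + 2) + 2) s' \<and> P ?n s'"
    unfolding ccode.simps
  proof (rule runs_for_loop)
    fix i u assume i: "i < ?n" and u: "P i u" "fst u L = i"
    obtain u2 where u2: "runs (ccode (L + 1) c) u ?T u2" "agree (L + 1) u2 (sem c u)"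
      using RepC.IH[OF ok(2), of u] unfolding n1[OF u(1)] by auto
    have "agree L (sem c u) ((sem c ^^ Suc i) s)"
      using sem_agree[OF ok(1)] u RepC.prems unfolding P_def by simp
    moreover have "L \<notin> wregs c" using cmd_ok_wregs[OF ok(1)] by blast
    then have "fst (sem c u) L = i" using sem_frame_reg[of L c u] u by auto
    ultimately have "P (Suc i) u2" "fst u2 L = i" using u2(2) unfolding P_def agree_def by auto
    then show "\<exists>u'. runs (ccode (L + 1) c) u ?T u' \<and> fst u' L = i \<and> P (Suc i) u'" using u2(1) by blast
  qed (use n1 in \<open>auto simp: P_def agree_def\<close>)
  moreover have eq: "poly (ctime (RepC c)) ?n = ?n * (?T + 2) + 2" by (simp add: algebra_simps)
  ultimately show ?case unfolding eq P_def sem.simps by blast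
qed

section \<open>Defining relations by formulas and by least fixed points\<close>

definition upd3 :: "state \<Rightarrow> nat \<Rightarrow> nat \<Rightarrow> nat \<Rightarrow> state" where
  "upd3 s a b c = ((fst s)(1 := a, 2 := b, 3 := c), snd s)"

definition DefC :: "nat \<Rightarrow> fm \<Rightarrow> cmd" where
  "DefC A \<phi> = ForC 1 (ForC 2 (ForC 3 (PutC A 1 2 3 \<phi>)))"

lemma wregs_DefC [simp]: "wregs (DefC A \<phi>) = {1, 2, 3}"
  by (auto simp: DefC_def)

lemma warrs_DefC [simp]: "warrs (DefC A \<phi>) = {A}"
  by (auto simp: DefC_def)

lemma cmd_ok_DefC [simp]: "cmd_ok L (DefC A \<phi>) \<longleftrightarrow> 3 < L \<and> fm_ok L \<phi>"
  by (auto simp: DefC_def)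

lemma rel_PutC:
  assumes "fst s x < fst s 0" "fst s y < fst s 0" "fst s z < fst s 0"
  shows "rel (sem (PutC A x y z \<phi>) s) A a b c \<longleftrightarrow>
    (if (a, b, c) = (fst s x, fst s y, fst s z) then holds \<phi> s else rel s A a b c)"
  using assms idx_inj[of "fst s 0" a b c "fst s x" "fst s y" "fst s z"] unfolding rel_def by auto

text \<open>The formula must not read the array that is being written: then each entry is evaluated
  as in the initial state, whatever has been written before.\<close>

lemma rel_DefC:
  assumes "A \<notin> fm_arrays \<phi>" "fm_ok L \<phi>" "0 < L" "a < fst s 0" "b < fst s 0" "c < fst s 0"
  shows "rel (sem (DefC A \<phi>) s) A a b c \<longleftrightarrow> holds \<phi> (upd3 s a b c)"
proof -
  let ?n = "fst s 0"
  \<comment> \<open>\<open>D\<close> collects the argument triples whose entries already have their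
    final value.\<close>
  define Q where "Q = (\<lambda>D u. (\<forall>j. j \<notin> {1, 2, 3} \<longrightarrow> fst u j = fst s j) \<and> (\<forall>B. B \<noteq> A \<longrightarrow> snd u B = snd s B) \<and>
    (\<forall>a b c. a < ?n \<and> b < ?n \<and> c < ?n \<and> (a, b, c) \<in> D \<longrightarrow> rel u A a b c = holds \<phi> (upd3 s a b c)))"
  have Q_reg: "Q D ((fst u)(x := i), snd u)" if "Q D u" "x \<in> {1, 2, 3}" for D u x i
    using that unfolding Q_def rel_def by auto
  have n: "fst u 0 = ?n" if "Q D u" for D u using that unfolding Q_def by auto
  have put: "Q (insert (i, j, k) D) (sem (PutC A 1 2 3 \<phi>) u)"
    if q: "Q D u" and ijk: "i < ?n" "j < ?n" "k < ?n" "fst u 1 = i" "fst u 2 = j" "fst u 3 = k" for D u i j k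
  proof -
    have h: "holds \<phi> u = holds \<phi> (upd3 s i j k)"
      by (rule holds_cong[OF assms(2,3)]) (use assms(1) q ijk in \<open>auto simp: upd3_def Q_def\<close>)
    have "rel (sem (PutC A 1 2 3 \<phi>) u) A a b c \<longleftrightarrow> (if (a, b, c) = (i, j, k) then holds \<phi> u else rel u A a b c)"
      if abc: "a < ?n" "b < ?n" "c < ?n" for a b c
      using rel_PutC[of u 1 2 3 A \<phi> a b c] ijk n[OF q] by simp
    then show ?thesis using q h ijk n[OF q] unfolding Q_def by auto
  qed
  have f3: "Q (D \<union> (\<Union>k<?n. {(i, j, k)})) (sem (ForC 3 (PutC A 1 2 3 \<phi>)) u)"
    if q: "Q D u" and ij: "i < ?n" "j < ?n" "fst u 1 = i" "fst u 2 = j" for D u i j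
  proof -
    have "Q (D \<union> (\<Union>k<?n. {(i, j, k)})) (sem (ForC 3 (PutC A 1 2 3 \<phi>)) u) \<and>
        fst (sem (ForC 3 (PutC A 1 2 3 \<phi>)) u) 1 = i \<and> fst (sem (ForC 3 (PutC A 1 2 3 \<phi>)) u) 2 = j"
    proof (rule sem_ForC_UN[where Q = "\<lambda>D u. Q D u \<and> fst u 1 = i \<and> fst u 2 = j"])
      fix k v assume k: "k < ?n" and v: "Q (D \<union> (\<Union>k<k. {(i, j, k)})) v \<and> fst v 1 = i \<and> fst v 2 = j"
      let ?v = "((fst v)(3 := k), snd v)"
      have "Q (insert (i, j, k) (D \<union> (\<Union>k<k. {(i, j, k)}))) (sem (PutC A 1 2 3 \<phi>) ?v)"
        by (rule put[OF Q_reg]) (use v k ij in auto)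
      then show "Q (D \<union> (\<Union>k<k. {(i, j, k)}) \<union> {(i, j, k)}) (sem (PutC A 1 2 3 \<phi>) ?v) \<and>
          fst (sem (PutC A 1 2 3 \<phi>) ?v) 1 = i \<and> fst (sem (PutC A 1 2 3 \<phi>) ?v) 2 = j"
        using v by (simp del: sem.simps add: sem_frame_reg)
    qed (use q ij n[OF q] in auto)
    then show ?thesis by blast
  qed
  have f2: "Q (D \<union> (\<Union>j<?n. \<Union>k<?n. {(i, j, k)})) (sem (ForC 2 (ForC 3 (PutC A 1 2 3 \<phi>))) u)"
    if q: "Q D u" and i: "i < ?n" "fst u 1 = i" for D u i
  proof -
    let ?c = "ForC 3 (PutC A 1 2 3 \<phi>)"
    have "Q (D \<union> (\<Union>j<?n. \<Union>k<?n. {(i, j, k)})) (sem (ForC 2 ?c) u) \<and> fst (sem (ForC 2 ?c) u) 1 = i"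
    proof (rule sem_ForC_UN[where Q = "\<lambda>D u. Q D u \<and> fst u 1 = i"])
      fix j v assume j: "j < ?n" and v: "Q (D \<union> (\<Union>j<j. \<Union>k<?n. {(i, j, k)})) v \<and> fst v 1 = i"
      show "Q (D \<union> (\<Union>j<j. \<Union>k<?n. {(i, j, k)}) \<union> (\<Union>k<?n. {(i, j, k)})) (sem ?c ((fst v)(2 := j), snd v)) \<and>
          fst (sem ?c ((fst v)(2 := j), snd v)) 1 = i"
        using f3[OF Q_reg, of _ v 2 i j] v j i by (simp del: sem.simps add: sem_frame_reg)
    qed (use q i n[OF q] in auto)
    then show ?thesis by blast
  qed
  have "Q ({} \<union> (\<Union>i<?n. \<Union>j<?n. \<Union>k<?n. {(i, j, k)})) (sem (DefC A \<phi>) s)"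
    unfolding DefC_def
  proof (rule sem_ForC_UN)
    fix i v assume i: "i < ?n" and v: "Q ({} \<union> (\<Union>i<i. \<Union>j<?n. \<Union>k<?n. {(i, j, k)})) v"
    show "Q ({} \<union> (\<Union>i<i. \<Union>j<?n. \<Union>k<?n. {(i, j, k)}) \<union> (\<Union>j<?n. \<Union>k<?n. {(i, j, k)}))
        (sem (ForC 2 (ForC 3 (PutC A 1 2 3 \<phi>))) ((fst v)(1 := i), snd v))"
      by (rule f2[OF Q_reg]) (use v i in auto)
  qed (auto simp: Q_def)
  then show ?thesis using assms unfolding Q_def by auto
qed

text \<open>The iterates from the empty set increase within \<open>U\<close>. Without a repetition
  in the first \<open>card U + 1\<close> steps they would gain an element each time and outgrow
  \<open>U\<close>.\<close>

lemma funpow_lfp: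
  fixes f :: "'a set \<Rightarrow> 'a set"
  assumes "mono f" "finite U" "\<And>X. f X \<subseteq> U"
  shows "(f ^^ card U) {} = lfp f"
proof -
  let ?X = "\<lambda>k. (f ^^ k) {}"
  have inc: "?X k \<subseteq> ?X (Suc k)" for k
  proof (induction k)
    case (Suc k)
    show ?case using monoD[OF assms(1) Suc] by simp
  qed simp
  have sub: "?X k \<subseteq> U" for k using assms(3) by (cases k) auto
  have "\<exists>k\<le>card U. ?X (Suc k) = ?X k"
  proof (rule ccontr)
    assume "\<not> (\<exists>k\<le>card U. ?X (Suc k) = ?X k)"
    then have ne: "?X k \<noteq> ?X (Suc k)" if "k \<le> card U" for k using that by metis
    have "k \<le> Suc (card U) \<Longrightarrow> k \<le> card (?X k)" for k
    proof (induction k)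
      case (Suc k)
      have "?X k \<subset> ?X (Suc k)" using inc[of k] ne[of k] Suc.prems by auto
      then have "card (?X k) < card (?X (Suc k))"
        by (intro psubset_card_mono finite_subset[OF sub assms(2)])
      then show ?case using Suc by simp
    qed simp
    from this[of "Suc (card U)"] card_mono[OF assms(2) sub] show False
      by (meson Suc_n_not_le_n le_refl le_trans)
  qed
  then obtain k where k: "k \<le> card U" "?X (Suc k) = ?X k" by blast
  have "?X (k + j) = ?X k" for j by (induction j) (use k(2) in auto)
  then have "?X (card U) = ?X k" using k(1) by (metis le_add_diff_inverse)
  moreover have "lfp f = ?X k" using lfp_Kleene_iter[OF assms(1) k(2)[folded bot_set_def]] by simp
  ultimately show ?thesis by simp
qed

text \<open>A round evaluates the formula into the buffer \<open>B\<close> before copying to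
  \<open>A\<close>, so that all triples are updated simultaneously. Three nested repetitions give
  n^3 rounds, as many as there are triples.\<close>

definition LfpC :: "nat \<Rightarrow> nat \<Rightarrow> fm \<Rightarrow> cmd" where
  "LfpC A B \<phi> = DefC A (LessF 0 0) ;; RepC (RepC (RepC (DefC B \<phi> ;; DefC A (RelF B 1 2 3))))"

lemma wregs_LfpC [simp]: "wregs (LfpC A B \<phi>) = {1, 2, 3}"
  by (auto simp: LfpC_def)

lemma warrs_LfpC [simp]: "warrs (LfpC A B \<phi>) = {A, B}"
  by (auto simp: LfpC_def)

lemma cmd_ok_LfpC [simp]: "cmd_ok L (LfpC A B \<phi>) \<longleftrightarrow> 3 < L \<and> fm_ok L \<phi>"
  by (auto simp: LfpC_def)

lemma funpow_RepC:
  assumes "0 \<notin> wregs c"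
  shows "(sem (RepC c) ^^ k) s = (sem c ^^ (fst s 0 * k)) s"
proof (induction k)
  case (Suc k)
  have "fst ((sem (RepC c) ^^ k) s) 0 = fst s 0"
    by (rule funpow_inv[where P = "\<lambda>i u. fst u 0 = fst s 0"])
      (use assms sem_frame_reg[of 0 "RepC c"] in \<open>auto simp del: sem.simps\<close>)
  then show ?case using Suc by (simp add: funpow_add)
qed simp

lemma sem_RepC2: "0 \<notin> wregs c \<Longrightarrow> sem (RepC (RepC c)) s = (sem c ^^ (fst s 0 * fst s 0)) s"
  using funpow_RepC[of c "fst s 0" s] by simp

lemma sem_RepC3: "0 \<notin> wregs c \<Longrightarrow> sem (RepC (RepC (RepC c))) s = (sem c ^^ (fst s 0 * fst s 0 * fst s 0)) s"
  using sem_RepC2[of "RepC c" s] funpow_RepC[of c "fst s 0 * fst s 0" s]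
  by (simp add: mult.assoc del: sem.simps)

text \<open>Each round applies \<open>f\<close> to the content of \<open>A\<close>. The
  correspondence \<open>step\<close> is asked only for states that differ from \<open>s\<close> in
  the argument registers and in the two arrays, which is all that a round changes.\<close>

lemma rel_LfpC:
  assumes "A \<noteq> B" "B \<notin> fm_arrays \<phi>" "fm_ok L \<phi>" "0 < L"
    and "mono f" "\<And>X. f X \<subseteq> {..<fst s 0} \<times> {..<fst s 0} \<times> {..<fst s 0}"
    and step: "\<And>u a b c. (\<And>j. j \<notin> {1, 2, 3} \<Longrightarrow> fst u j = fst s j) \<Longrightarrow> (\<And>C. C \<notin> {A, B} \<Longrightarrow> snd u C = snd s C) \<Longrightarrow>
      a < fst s 0 \<Longrightarrow> b < fst s 0 \<Longrightarrow> c < fst s 0 \<Longrightarrow>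
      holds \<phi> (upd3 u a b c) \<longleftrightarrow> (a, b, c) \<in> f {(a, b, c). rel u A a b c}"
  shows "{(a, b, c). rel (sem (LfpC A B \<phi>) s) A a b c} = lfp f"
proof -
  let ?n = "fst s 0"
  let ?s0 = "sem (DefC A (LessF 0 0)) s"
  let ?c = "DefC B \<phi> ;; DefC A (RelF B 1 2 3)"
  have n0: "fst ?s0 0 = ?n" by (simp add: sem_frame_reg)
  have "(\<forall>j. j \<notin> {1, 2, 3} \<longrightarrow> fst ((sem ?c ^^ (?n * ?n * ?n)) ?s0) j = fst s j) \<and> (\<forall>C. C \<notin> {A, B} \<longrightarrow> snd ((sem ?c ^^ (?n * ?n * ?n)) ?s0) C = snd s C) \<and>
      {(a, b, c). rel ((sem ?c ^^ (?n * ?n * ?n)) ?s0) A a b c} = (f ^^ (?n * ?n * ?n)) {}"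
  proof (rule funpow_inv[where P = "\<lambda>k u. (\<forall>j. j \<notin> {1, 2, 3} \<longrightarrow> fst u j = fst s j) \<and> (\<forall>C. C \<notin> {A, B} \<longrightarrow> snd u C = snd s C) \<and>
      {(a, b, c). rel u A a b c} = (f ^^ k) {}"])
    have "\<not> rel ?s0 A a b c" for a b c
    proof (cases "a < ?n \<and> b < ?n \<and> c < ?n")
      case True
      then show ?thesis using rel_DefC[of A "LessF 0 0" 1 a s b c] by simp
    next
      case False
      then show ?thesis unfolding rel_def n0 by blast
    qed
    then show "(\<forall>j. j \<notin> {1, 2, 3} \<longrightarrow> fst ?s0 j = fst s j) \<and> (\<forall>C. C \<notin> {A, B} \<longrightarrow> snd ?s0 C = snd s C) \<and>
      {(a, b, c). rel ?s0 A a b c} = (f ^^ 0) {}"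
      by (simp add: sem_frame_reg sem_frame_arr)
  next
    fix k u assume u: "(\<forall>j. j \<notin> {1, 2, 3} \<longrightarrow> fst u j = fst s j) \<and> (\<forall>C. C \<notin> {A, B} \<longrightarrow> snd u C = snd s C) \<and>
      {(a, b, c). rel u A a b c} = (f ^^ k) {}"
    let ?u1 = "sem (DefC B \<phi>) u"
    have nu: "fst u 0 = ?n" using u by simp
    have n1: "fst ?u1 0 = ?n" using nu by (simp add: sem_frame_reg)
    have n2: "fst (sem ?c u) 0 = ?n" using nu by (simp add: sem_frame_reg)
    have "rel (sem ?c u) A a b c \<longleftrightarrow> (a, b, c) \<in> f ((f ^^ k) {})" for a b c
    proof (cases "a < ?n \<and> b < ?n \<and> c < ?n")
      case True
      have "rel (sem ?c u) A a b c \<longleftrightarrow> holds (RelF B 1 2 3) (upd3 ?u1 a b c)"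
        using rel_DefC[of A "RelF B 1 2 3" 4 a ?u1 b c] True n1 assms(1) by simp
      also have "\<dots> \<longleftrightarrow> rel ?u1 B a b c" by (simp add: upd3_def rel_def)
      also have "\<dots> \<longleftrightarrow> holds \<phi> (upd3 u a b c)"
        using rel_DefC[OF assms(2-4), of a u b c] True nu by simp
      also have "\<dots> \<longleftrightarrow> (a, b, c) \<in> f {(a, b, c). rel u A a b c}"
        using step[of u a b c] u True by blast
      finally show ?thesis using u by simp
    next
      case False
      then have "(a, b, c) \<notin> f ((f ^^ k) {})" using assms(6) by blast
      moreover have "\<not> rel (sem ?c u) A a b c" using False unfolding rel_def n2 by blast
      ultimately show ?thesis by blast
    qed
    then show "(\<forall>j. j \<notin> {1, 2, 3} \<longrightarrow> fst (sem ?c u) j = fst s j) \<and> (\<forall>C. C \<notin> {A, B} \<longrightarrow> snd (sem ?c u) C = snd s C) \<and>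
      {(a, b, c). rel (sem ?c u) A a b c} = (f ^^ Suc k) {}"
      using u by (auto simp: sem_frame_reg sem_frame_arr)
  qed
  then have "{(a, b, c). rel ((sem ?c ^^ (?n * ?n * ?n)) ?s0) A a b c} = (f ^^ (?n * ?n * ?n)) {}" by blast
  moreover have "sem (LfpC A B \<phi>) s = (sem ?c ^^ (?n * ?n * ?n)) ?s0"
    using sem_RepC3[of ?c ?s0] n0 unfolding LfpC_def sem.simps(8)[of "DefC A (LessF 0 0)"] by simp
  moreover have "(f ^^ (?n * ?n * ?n)) {} = lfp f"
    using funpow_lfp[OF assms(5) _ assms(6)] by (simp add: mult.assoc)
  ultimately show ?thesis by simp
qed

section \<open>The test as a program\<close>

text \<open>Registers: 0 holds \<open>n\<close>, 1 to 3 are the argument registers of relation definitions, 4 holds zero,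
  5 and 6 hold the first and the last vertex of the path, 7 the answer, 8 the current row and 9 the
  number of rows of the table of guesses, 10 to 13 serve to read a row, 14 and 15 are loop variables, and
  the registers from 16 on are bound in formulas. Arrays: 0 to 2 hold the input, 3 the relation
  \<^const>\<open>avoid\<close>, 5 the order of the skeleton, 6 \<^const>\<open>late\<close>, 7 \<^const>\<open>forced_step\<close>, 8 the used edges,
  9 the ends of the runs, 10 to 12 parent row and last edge of a row; 4 is scratch space.\<close>

notation ConjF (infixr "\<^bold>\<and>" 35)

abbreviation "TrueF \<equiv> NegF (LessF 0 0)"
abbreviation "DisjF \<phi> \<psi> \<equiv> NegF (NegF \<phi> \<^bold>\<and> NegF \<psi>)"

definition EqF :: "nat \<Rightarrow> nat \<Rightarrow> fm" where
  "EqF x y = (NegF (LessF x y) \<^bold>\<and> NegF (LessF y x))"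

lemma EqF_simps [simp]: "holds (EqF x y) s \<longleftrightarrow> fst s x = fst s y" "fm_ok L (EqF x y) \<longleftrightarrow> x < L \<and> y < L"
  "fm_arrays (EqF x y) = {}"
  by (auto simp: EqF_def)

abbreviation "EF x y \<equiv> RelF 0 4 x y"
abbreviation "PF x y \<equiv> RelF 1 4 x y"
abbreviation "FF x y \<equiv> RelF 2 4 x y"
abbreviation "HF x y \<equiv> EF x y \<^bold>\<and> NegF (FF x y)"
abbreviation "TF x y \<equiv> RelF 5 4 x y"

text \<open>Bound registers are chosen to prevent capture in nested formulas: \<open>SuccF\<close>
  binds 22, \<open>FitsF\<close> 20 and 21, \<open>LateF\<close> 18 and 19, and
  \<open>AcceptF\<close> 16 to 18. \<open>SkelF\<close> binds none.\<close>

definition SkelF :: "nat \<Rightarrow> fm" where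
  "SkelF x = DisjF (EqF x 5) (TF 5 x)"

definition SuccF :: "nat \<Rightarrow> nat \<Rightarrow> fm" where
  "SuccF x y = (SkelF x \<^bold>\<and> SkelF y \<^bold>\<and> TF x y \<^bold>\<and> NegF (ExF 22 (SkelF 22 \<^bold>\<and> TF x 22 \<^bold>\<and> TF 22 y)))"

definition FitsF :: "nat \<Rightarrow> nat \<Rightarrow> fm" where
  "FitsF v w = (ExF 20 (SuccF w 20 \<^bold>\<and> HF w 20 \<^bold>\<and> HF v w \<^bold>\<and> HF v 20) \<^bold>\<and>
     NegF (ExF 21 (SkelF 21 \<^bold>\<and> DisjF (PF 21 v \<^bold>\<and> NegF (EqF 21 w) \<^bold>\<and> NegF (TF 21 w)) (PF v 21 \<^bold>\<and> NegF (TF w 21)))))"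

text \<open>Register 1 is a dummy argument: the fixed point computes the same binary relation in
  every slice, and afterwards only slice 0 is read. The same device occurs in
  \<open>OrderF\<close>.\<close>

definition LateF :: fm where
  "LateF = NegF (ExF 18 (SkelF 18 \<^bold>\<and> DisjF (EqF 18 3) (TF 18 3) \<^bold>\<and> FitsF 2 18 \<^bold>\<and>
     NegF (ExF 19 (PF 19 2 \<^bold>\<and> NegF (SkelF 19) \<^bold>\<and> RelF 6 1 19 18))))"

definition AcceptF :: fm where
  "AcceptF =
     (NegF (ExF 16 (SkelF 16 \<^bold>\<and> TF 16 16)) \<^bold>\<and>
      NegF (ExF 16 (ExF 17 (ExF 18 (SkelF 16 \<^bold>\<and> SkelF 17 \<^bold>\<and> SkelF 18 \<^bold>\<and> TF 16 17 \<^bold>\<and> TF 17 18 \<^bold>\<and> NegF (TF 16 18))))) \<^bold>\<and>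
      NegF (ExF 16 (ExF 17 (SkelF 16 \<^bold>\<and> SkelF 17 \<^bold>\<and> NegF (EqF 16 17) \<^bold>\<and> NegF (TF 16 17) \<^bold>\<and> NegF (TF 17 16)))) \<^bold>\<and>
      NegF (ExF 16 (ExF 17 (SuccF 16 17 \<^bold>\<and> NegF (EF 16 17)))) \<^bold>\<and>
      NegF (ExF 16 (ExF 17 (SkelF 16 \<^bold>\<and> SkelF 17 \<^bold>\<and> PF 16 17 \<^bold>\<and> NegF (EqF 16 17) \<^bold>\<and> NegF (TF 16 17)))) \<^bold>\<and>
      SkelF 6 \<^bold>\<and>
      NegF (ExF 16 (SkelF 16 \<^bold>\<and> NegF (EqF 16 6) \<^bold>\<and> NegF (TF 16 6))) \<^bold>\<and>
      NegF (ExF 16 (NegF (SkelF 16) \<^bold>\<and> NegF (ExF 17 (SkelF 17 \<^bold>\<and> NegF (RelF 6 4 16 17))))))"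

text \<open>Walks are extended at their far end. The avoided vertex is a genuine third argument, in
  register 1; for its sake the arrays hold ternary relations.\<close>

definition AvoidF :: fm where
  "AvoidF = (NegF (EqF 2 1) \<^bold>\<and> NegF (EqF 3 1) \<^bold>\<and> DisjF (EqF 2 3) (ExF 16 (RelF 3 1 2 16 \<^bold>\<and> HF 16 3)))"

definition ForcedF :: fm where
  "ForcedF = DisjF (RelF 8 4 2 3) (ExF 16 (ExF 17 (RelF 9 4 16 17 \<^bold>\<and> NegF (RelF 3 2 16 17) \<^bold>\<and>
     NegF (RelF 3 3 16 17) \<^bold>\<and> HF 2 3 \<^bold>\<and> NegF (RelF 3 2 16 3))))"

definition OrderF :: fm where
  "OrderF = DisjF (RelF 7 4 2 3) (ExF 16 (RelF 5 1 2 16 \<^bold>\<and> RelF 7 4 16 3))"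

text \<open>Each phase reads relations computed by earlier ones. Register 7 is raised to 1 but never
  reset, so over all guesses it accumulates a disjunction.\<close>

definition test :: "bool \<Rightarrow> cmd" where
  "test cyc = LfpC 3 4 AvoidF ;; DefC 7 ForcedF ;; LfpC 5 4 OrderF ;; LfpC 6 4 LateF ;;
     IfC (AcceptF \<^bold>\<and> (if cyc then EF 5 6 else TrueF)) (ConstC 7 1) SkipC"

section \<open>Evaluation of the formulas in a state that holds the input\<close>

definition graph_ctx :: "nat \<Rightarrow> vrel \<Rightarrow> vrel \<Rightarrow> vrel \<Rightarrow> state \<Rightarrow> bool" where
  "graph_ctx n E P F s \<longleftrightarrow> fst s 0 = n \<and> fst s 4 = 0 \<and>
     (\<forall>u<n. \<forall>v<n. (rel s 0 0 u v \<longleftrightarrow> E u v) \<and> (rel s 1 0 u v \<longleftrightarrow> P u v) \<and> (rel s 2 0 u v \<longleftrightarrow> F u v))"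

definition order_ctx :: "nat \<Rightarrow> vrel \<Rightarrow> state \<Rightarrow> bool" where
  "order_ctx n T s \<longleftrightarrow> (\<forall>u<n. \<forall>v<n. rel s 5 0 u v \<longleftrightarrow> T u v)"

lemma rel_upd [simp]: "x \<noteq> 0 \<Longrightarrow> rel (f(x := v), a) A = rel (f, a) A"
  by (intro ext) (simp add: rel_def)

lemma rel_cong: "fst s 0 = fst u 0 \<Longrightarrow> snd s A = snd u A \<Longrightarrow> rel s A = rel u A"
  by (intro ext) (simp add: rel_def)

lemma graph_ctx_cong:
  "fst s 0 = fst u 0 \<Longrightarrow> fst s 4 = fst u 4 \<Longrightarrow> snd s 0 = snd u 0 \<Longrightarrow> snd s 1 = snd u 1 \<Longrightarrow> snd s 2 = snd u 2 \<Longrightarrow>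
   graph_ctx n E P F s = graph_ctx n E P F u"
  unfolding graph_ctx_def using rel_cong[of s u] by auto

lemma order_ctx_cong: "fst s 0 = fst u 0 \<Longrightarrow> snd s 5 = snd u 5 \<Longrightarrow> order_ctx n T s = order_ctx n T u"
  unfolding order_ctx_def using rel_cong[of s u] by auto

lemma ctx_upd [simp]:
  "x \<noteq> 0 \<Longrightarrow> x \<noteq> 4 \<Longrightarrow> graph_ctx n E P F (f(x := v), a) = graph_ctx n E P F (f, a)"
  "x \<noteq> 0 \<Longrightarrow> order_ctx n T (f(x := v), a) = order_ctx n T (f, a)"
  by (rule graph_ctx_cong; simp) (rule order_ctx_cong; simp)

lemma graph_ctx_n: "graph_ctx n E P F s \<Longrightarrow> fst s 0 = n"
  by (simp add: graph_ctx_def)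

context
  fixes n :: nat and E P F T :: vrel
begin

lemma holds_graph:
  assumes "graph_ctx n E P F s" "fst s x < n" "fst s y < n"
  shows "holds (EF x y) s \<longleftrightarrow> E (fst s x) (fst s y)" "holds (PF x y) s \<longleftrightarrow> P (fst s x) (fst s y)"
    "holds (FF x y) s \<longleftrightarrow> F (fst s x) (fst s y)"
  using assms by (auto simp: graph_ctx_def)

lemma holds_TF:
  assumes "graph_ctx n E P F s" "order_ctx n T s" "fst s x < n" "fst s y < n"
  shows "holds (TF x y) s \<longleftrightarrow> T (fst s x) (fst s y)"
  using assms by (auto simp: graph_ctx_def order_ctx_def)

lemma holds_SkelF:
  assumes "graph_ctx n E P F s" "order_ctx n T s" "fst s x < n" "fst s 5 < n"
  shows "holds (SkelF x) s \<longleftrightarrow> skel n (fst s 5) T (fst s x)"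
  using holds_TF[OF assms(1,2,4,3)] assms(3) by (simp add: skel_def SkelF_def)

lemma holds_SuccF:
  assumes "graph_ctx n E P F s" "order_ctx n T s" "fst s x < n" "fst s y < n" "fst s 5 < n" "x \<noteq> 22" "y \<noteq> 22"
  shows "holds (SuccF x y) s \<longleftrightarrow> skel_succ n (fst s 5) T (fst s x) (fst s y)"
  unfolding SuccF_def skel_succ_def
  using assms by (simp add: graph_ctx_n[OF assms(1)] holds_SkelF
    holds_TF del: holds.simps(2) cong: conj_cong)

lemma holds_FitsF:
  assumes "graph_ctx n E P F s" "order_ctx n T s" "fst s v < n" "fst s w < n" "fst s 5 < n" "v < 20" "w < 20"
  shows "holds (FitsF v w) s \<longleftrightarrow> fits n (fst s 5) T (\<lambda>u v. E u v \<and> \<not> F u v) P (fst s v) (fst s w)"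
  unfolding FitsF_def fits_def
  using assms by (simp add: graph_ctx_n[OF assms(1)] holds_graph
    holds_SkelF holds_TF
    holds_SuccF del: holds.simps(2) One_nat_def cong: conj_cong)

lemma holds_LateF:
  assumes "graph_ctx n E P F s" "order_ctx n T s" "fst s 1 < n" "fst s 2 < n" "fst s 3 < n" "fst s 5 < n"
  shows "holds LateF s \<longleftrightarrow> late_step n (fst s 5) T (\<lambda>u v. E u v \<and> \<not> F u v) P (\<lambda>u w. rel s 6 (fst s 1) u w) (fst s 2) (fst s 3)"
  unfolding LateF_def late_step_def
  using assms by (simp add: graph_ctx_n[OF assms(1)] holds.simps(2)[of 6] holds_graph
    holds_SkelF holds_TF
    holds_FitsF del: holds.simps(2) One_nat_def cong: conj_cong)

lemma holds_AcceptF: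
  assumes "graph_ctx n E P F s" "order_ctx n T s" "fst s 5 < n" "fst s 6 < n"
    and late: "\<And>v w. v < n \<Longrightarrow> w < n \<Longrightarrow> rel s 6 0 v w \<longleftrightarrow> late n (fst s 5) T (\<lambda>u v. E u v \<and> \<not> F u v) P v w"
  shows "holds AcceptF s \<longleftrightarrow> accepts n (fst s 5) (fst s 6) T E (\<lambda>u v. E u v \<and> \<not> F u v) P"
proof -
  have z: "fst s 4 = 0" using assms(1) by (simp add: graph_ctx_def)
  show ?thesis
    unfolding AcceptF_def accepts_def
    by (simp add: assms z graph_ctx_n[OF assms(1)] holds.simps(2)[of 6] holds_graph
      holds_SkelF holds_TF
      holds_SuccF del: holds.simps(2) One_nat_def cong: conj_cong)
qed

end

section \<open>Avoiding walks, transitive closure and lateness as least fixed points of set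
  operators\<close>

lemma lfp_avoid:
  fixes H :: vrel
  assumes "\<And>u v. H u v \<Longrightarrow> u < n \<and> v < n"
  defines "f \<equiv> \<lambda>X. {(x, u, v). x < n \<and> u < n \<and> v < n \<and> u \<noteq> x \<and> v \<noteq> x \<and> (u = v \<or> (\<exists>w<n. (x, u, w) \<in> X \<and> H w v))}"
  shows "mono f" "f X \<subseteq> {..<n} \<times> {..<n} \<times> {..<n}"
    "(x, u, v) \<in> lfp f \<longleftrightarrow> x < n \<and> u < n \<and> v < n \<and> avoid H x u v"
proof -
  show mono: "mono f" unfolding f_def mono_def by blast
  show "f X \<subseteq> {..<n} \<times> {..<n} \<times> {..<n}" unfolding f_def by auto
  let ?K = "{(x, u, v). x < n \<and> u < n \<and> v < n \<and> avoid H x u v}"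
  have "f ?K \<subseteq> ?K"
  proof (clarify, intro conjI)
    fix x u v assume "(x, u, v) \<in> f ?K"
    then have *: "x < n" "u < n" "v < n" "u \<noteq> x" "v \<noteq> x" "u = v \<or> (\<exists>w<n. avoid H x u w \<and> H w v)"
      unfolding f_def by auto
    then show "x < n" "u < n" "v < n" by auto
    show "avoid H x u v" using *(6)
    proof
      assume "\<exists>w<n. avoid H x u w \<and> H w v"
      then obtain w where w: "avoid H x u w" "H w v" by blast
      then have "w \<noteq> x" unfolding avoid_def by blast
      then show ?thesis using avoid_trans[OF w(1)] avoid_step[of H w v x] w(2) *(5) by blast
    qed (use * avoid_refl in auto)
  qed
  then have "lfp f \<subseteq> ?K" by (rule lfp_lowerbound)
  moreover have "(x, u, v) \<in> lfp f" if xu: "x < n" "u < n" and av: "avoid H x u v" for x u v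
  proof -
    have "(\<lambda>a b. H a b \<and> a \<noteq> x \<and> b \<noteq> x)\<^sup>*\<^sup>* u v" "u \<noteq> x" using av unfolding avoid_def by auto
    then show ?thesis
    proof (induction rule: rtranclp_induct)
      case base
      then show ?case using xu by (subst lfp_unfold[OF mono]) (auto simp: f_def)
    next
      case (step y z)
      then have "(x, u, y) \<in> lfp f" "H y z" "z \<noteq> x" "u \<noteq> x" by auto
      moreover have "y < n" "z < n" using assms(1)[OF \<open>H y z\<close>] by auto
      ultimately show ?case using xu by (subst lfp_unfold[OF mono]) (auto simp: f_def)
    qed
  qed
  ultimately show "(x, u, v) \<in> lfp f \<longleftrightarrow> x < n \<and> u < n \<and> v < n \<and> avoid H x u v" by blast
qed

lemma lfp_tranclp:
  fixes N :: vrel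
  assumes "\<And>u v. N u v \<Longrightarrow> u < n \<and> v < n"
  defines "f \<equiv> \<lambda>X. {(a, u, v). a < n \<and> u < n \<and> v < n \<and> (N u v \<or> (\<exists>w<n. (a, u, w) \<in> X \<and> N w v))}"
  shows "mono f" "f X \<subseteq> {..<n} \<times> {..<n} \<times> {..<n}"
    "(a, u, v) \<in> lfp f \<longleftrightarrow> a < n \<and> N\<^sup>+\<^sup>+ u v"
proof -
  show mono: "mono f" unfolding f_def mono_def by blast
  show "f X \<subseteq> {..<n} \<times> {..<n} \<times> {..<n}" unfolding f_def by auto
  let ?K = "{(a, u, v). a < n \<and> N\<^sup>+\<^sup>+ u v}"
  have "f ?K \<subseteq> ?K" unfolding f_def by (auto intro: tranclp.trancl_into_trancl)
  then have "lfp f \<subseteq> ?K" by (rule lfp_lowerbound)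
  moreover have "(a, u, v) \<in> lfp f" if a: "a < n" and N: "N\<^sup>+\<^sup>+ u v" for a u v
    using N
  proof (induction rule: tranclp_induct)
    case (base y)
    then show ?case using a assms(1) by (subst lfp_unfold[OF mono]) (auto simp: f_def)
  next
    case (step y z)
    have "u < n" using step.hyps(1) assms(1) by (metis tranclpD)
    then show ?case using a assms(1)[OF step.hyps(2)] step.hyps(2) step.IH
      by (subst lfp_unfold[OF mono]) (auto simp: f_def)
  qed
  ultimately show "(a, u, v) \<in> lfp f \<longleftrightarrow> a < n \<and> N\<^sup>+\<^sup>+ u v" by blast
qed

text \<open>The coordinate \<open>a\<close> only selects a slice and is carried along unchanged;
  within a slice, rule induction on \<open>late\<close> rebuilds the fixed point.\<close>

lemma lfp_late:
  fixes n s :: nat and T H P :: vrel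
  defines "f \<equiv> \<lambda>X. {(a, v, w). a < n \<and> v < n \<and> w < n \<and> late_step n s T H P (\<lambda>u w. (a, u, w) \<in> X) v w}"
  shows "mono f" "f X \<subseteq> {..<n} \<times> {..<n} \<times> {..<n}"
    "(a, v, w) \<in> lfp f \<longleftrightarrow> a < n \<and> late n s T H P v w"
proof -
  show mono: "mono f"
  proof (rule monoI)
    fix X Y :: "(nat \<times> nat \<times> nat) set" assume XY: "X \<subseteq> Y"
    have "late_step n s T H P (\<lambda>u w. (a, u, w) \<in> X) v w \<longrightarrow> late_step n s T H P (\<lambda>u w. (a, u, w) \<in> Y) v w" for a v w
      by (rule late_step_mono) (use XY in blast)
    then show "f X \<subseteq> f Y" unfolding f_def by blast
  qed
  show "f X \<subseteq> {..<n} \<times> {..<n} \<times> {..<n}" unfolding f_def by auto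
  let ?K = "{(a, v, w). a < n \<and> late n s T H P v w}"
  have "f ?K \<subseteq> ?K"
  proof clarify
    fix a v w assume "(a, v, w) \<in> f ?K"
    then have "a < n" "v < n" "w < n" "late_step n s T H P (late n s T H P) v w" unfolding f_def by auto
    then show "a < n \<and> late n s T H P v w" using late.intros by blast
  qed
  then have "lfp f \<subseteq> ?K" by (rule lfp_lowerbound)
  moreover have "(a, v, w) \<in> lfp f" if a: "a < n" and l: "late n s T H P v w" for a v w
    using l
  proof (induction rule: late.induct)
    case (1 v w)
    have "late_step n s T H P (\<lambda>u w. (a, u, w) \<in> lfp f) v w"
      using 1(3) late_step_mono[of "\<lambda>u w. late n s T H P u w \<and> (a, u, w) \<in> lfp f" "\<lambda>u w. (a, u, w) \<in> lfp f"] by blast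
    then show ?case using 1(1,2) a by (subst lfp_unfold[OF mono]) (auto simp: f_def)
  qed
  ultimately show "(a, v, w) \<in> lfp f \<longleftrightarrow> a < n \<and> late n s T H P v w" by blast
qed

lemma fm_facts [simp]:
  "fm_ok 25 AvoidF" "fm_ok 25 ForcedF" "fm_ok 25 OrderF" "fm_ok 25 LateF" "fm_ok 25 AcceptF"
  "fm_arrays AvoidF = {0, 2, 3}" "fm_arrays ForcedF = {0, 2, 3, 8, 9}" "fm_arrays OrderF = {5, 7}"
  "fm_arrays LateF = {0, 1, 2, 5, 6}"
  by (auto simp: AvoidF_def ForcedF_def OrderF_def LateF_def AcceptF_def FitsF_def SuccF_def SkelF_def)

lemma test_facts [simp]:
  "cmd_ok 25 (test cyc)" "wregs (test cyc) = {1, 2, 3, 7}" "warrs (test cyc) = {3, 4, 5, 6, 7}"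
  by (auto simp: test_def)

text \<open>The states \<open>s1\<close> to \<open>s4\<close> are those after the computation of
  \<open>avoid\<close>, of \<open>forced_step\<close>, of its transitive closure and of
  \<open>late\<close>. The frame properties keep the input and the relations still needed intact
  from one state to the next.\<close>

lemma sem_test:
  fixes E P F :: vrel and s :: state
  defines "H \<equiv> \<lambda>u v. E u v \<and> \<not> F u v"
  assumes ctx: "graph_ctx n E P F s" and st: "fst s 5 < n" "fst s 6 < n"
    and E: "\<And>u v. E u v \<Longrightarrow> u < n \<and> v < n"
    and J: "J \<subseteq> {..<n} \<times> {..<n}" "\<And>u v. u < n \<Longrightarrow> v < n \<Longrightarrow> rel s 8 0 u v \<longleftrightarrow> (u, v) \<in> J"
    and S: "S \<subseteq> {..<n} \<times> {..<n}" "\<And>u v. u < n \<Longrightarrow> v < n \<Longrightarrow> rel s 9 0 u v \<longleftrightarrow> (u, v) \<in> S"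
  shows "fst (sem (test cyc) s) 7 =
    (if accepts n (fst s 5) (fst s 6) (forced_step H J S)\<^sup>+\<^sup>+ E H P \<and> (cyc \<longrightarrow> E (fst s 5) (fst s 6)) then 1 else fst s 7)"
proof -
  have n0: "0 < n" using st by simp
  have Hn: "u < n \<and> v < n" if "H u v" for u v using that E unfolding H_def by blast
  have n: "fst s 0 = n" and z: "fst s 4 = 0" using ctx by (auto simp: graph_ctx_def)
  define s1 where "s1 = sem (LfpC 3 4 AvoidF) s"
  have r1: "fst s1 j = fst s j" if "j \<notin> {1, 2, 3}" for j using that unfolding s1_def by (simp add: sem_frame_reg)
  have a1: "snd s1 A = snd s A" if "A \<notin> {3, 4}" for A using that unfolding s1_def by (simp add: sem_frame_arr)
  have c1: "graph_ctx n E P F s1" using ctx graph_ctx_cong[of s1 s] r1 a1 by simp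
  note lfp = lfp_avoid[of H n, OF Hn]
  have "{(x, u, v). rel s1 3 x u v} = lfp (\<lambda>X. {(x, u, v). x < n \<and> u < n \<and> v < n \<and> u \<noteq> x \<and> v \<noteq> x \<and> (u = v \<or> (\<exists>w<n. (x, u, w) \<in> X \<and> H w v))})"
    unfolding s1_def
  proof (rule rel_LfpC[where L = 25])
    fix u a b c
    assume fr: "\<And>j. j \<notin> {1, 2, 3} \<Longrightarrow> fst u j = fst s j" "\<And>C. C \<notin> {3, 4} \<Longrightarrow> snd u C = snd s C"
      and abc: "a < fst s 0" "b < fst s 0" "c < fst s 0"
    have cu: "graph_ctx n E P F u" using ctx graph_ctx_cong[of u s] fr by simp
    have "holds (EF 16 3) ((fst (upd3 u a b c))(16 := w), snd (upd3 u a b c)) = E w c"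
      "holds (FF 16 3) ((fst (upd3 u a b c))(16 := w), snd (upd3 u a b c)) = F w c" if "w < n" for w
      using holds_graph[of n E P F "((fst (upd3 u a b c))(16 := w), snd (upd3 u a b c))" 16 3] cu that abc n
      by (simp_all add: upd3_def del: holds.simps)
    then show "holds AvoidF (upd3 u a b c) \<longleftrightarrow> (a, b, c) \<in> {(x, ua, v). x < n \<and> ua < n \<and> v < n \<and> ua \<noteq> x \<and> v \<noteq> x \<and>
        (ua = v \<or> (\<exists>w<n. (x, ua, w) \<in> {(a, b, c). rel u 3 a b c} \<and> H w v))}"
      using abc fr(1)[of 0] n unfolding AvoidF_def H_def
      by (simp add: upd3_def holds.simps(2)[of 3] del: holds.simps(2) cong: conj_cong) blast
  qed (use lfp(1,2) n in auto)
  then have R1: "rel s1 3 x u v \<longleftrightarrow> x < n \<and> u < n \<and> v < n \<and> avoid H x u v" for x u v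
    using lfp(3)[of x u v] by blast
  define s2 where "s2 = sem (DefC 7 ForcedF) s1"
  have r2: "fst s2 j = fst s j" if "j \<notin> {1, 2, 3}" for j
    using that r1 unfolding s2_def by (simp add: sem_frame_reg)
  have a2: "snd s2 A = snd s A" if "A \<notin> {3, 4, 7}" for A
    using that a1 unfolding s2_def by (simp add: sem_frame_arr)
  have c2: "graph_ctx n E P F s2" using ctx graph_ctx_cong[of s2 s] r2 a2 by simp
  have R2: "rel s2 7 0 u v \<longleftrightarrow> forced_step H J S u v" if uv: "u < n" "v < n" for u v
  proof -
    let ?u = "upd3 s1 0 u v"
    let ?w = "\<lambda>b a. ((fst ?u)(16 := b, 17 := a), snd ?u)"
    have z1: "fst s1 4 = 0" "fst s1 0 = n" using r1 z n by auto
    have J1: "rel s1 8 0 u v \<longleftrightarrow> (u, v) \<in> J" "rel s1 9 0 u v \<longleftrightarrow> (u, v) \<in> S" if "u < n" "v < n" for u v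
      using J(2) S(2) that rel_cong[of s1 s] r1 a1 by auto
    have g: "holds (EF 2 3) (?w b a) = E u v" "holds (FF 2 3) (?w b a) = F u v" for b a
      using holds_graph[of n E P F "?w b a" 2 3] c1 uv by (simp_all add: upd3_def del: holds.simps)
    have rr: "rel (fst ?u, snd ?u) A = rel s1 A" "rel ?u A = rel s1 A" for A
      by (auto intro!: rel_cong simp: upd3_def)
    have E1: "rel s1 0 0 u v = E u v" "rel s1 2 0 u v = F u v" using c1 uv by (auto simp: graph_ctx_def)
    have "rel s2 7 0 u v \<longleftrightarrow> holds ForcedF ?u"
      unfolding s2_def by (rule rel_DefC[where L = 25]) (use uv n0 z1 in auto)
    also have "\<dots> \<longleftrightarrow> (u, v) \<in> J \<or> (\<exists>b<n. \<exists>a<n. (b, a) \<in> S \<and> \<not> avoid H u b a \<and> \<not> avoid H v b a \<and> H u v \<and> \<not> avoid H u b v)"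
      unfolding ForcedF_def holds.simps(3-5) g
      using uv z1 by (simp add: rr cong: conj_cong, simp add: upd3_def R1 J1(1) E1 H_def) (use J1(2) uv in blast)
    also have "\<dots> \<longleftrightarrow> forced_step H J S u v"
      unfolding forced_step_def using S(1) by blast
    finally show ?thesis .
  qed
  have N: "u < n \<and> v < n" if "forced_step H J S u v" for u v
    using that Hn J(1) unfolding forced_step_def by blast
  let ?T = "(forced_step H J S)\<^sup>+\<^sup>+"
  define s3 where "s3 = sem (LfpC 5 4 OrderF) s2"
  have r3: "fst s3 j = fst s j" if "j \<notin> {1, 2, 3}" for j
    using that r2 unfolding s3_def by (simp add: sem_frame_reg)
  have a3: "snd s3 A = snd s A" if "A \<notin> {3, 4, 5, 7}" for A
    using that a2 unfolding s3_def by (simp add: sem_frame_arr)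
  have c3: "graph_ctx n E P F s3" using ctx graph_ctx_cong[of s3 s] r3 a3 by simp
  note lfp = lfp_tranclp[of "forced_step H J S" n, OF N]
  have "{(x, u, v). rel s3 5 x u v} = lfp (\<lambda>X. {(a, u, v). a < n \<and> u < n \<and> v < n \<and> (forced_step H J S u v \<or> (\<exists>w<n. (a, u, w) \<in> X \<and> forced_step H J S w v))})"
    unfolding s3_def
  proof (rule rel_LfpC[where L = 25])
    fix u a b c
    assume fr: "\<And>j. j \<notin> {1, 2, 3} \<Longrightarrow> fst u j = fst s2 j" "\<And>C. C \<notin> {5, 4} \<Longrightarrow> snd u C = snd s2 C"
      and abc: "a < fst s2 0" "b < fst s2 0" "c < fst s2 0"
    have z2: "fst u 4 = 0" "fst u 0 = n" "fst s2 0 = n" using r2 fr(1) z n by auto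
    have N2: "rel u 7 0 v w \<longleftrightarrow> forced_step H J S v w" if "v < n" "w < n" for v w
      using R2[OF that] rel_cong[of u s2 7] fr by simp
    have rr: "rel (fst (upd3 u a b c), snd (upd3 u a b c)) A = rel u A" "rel (upd3 u a b c) A = rel u A" for A
      by (auto intro!: rel_cong simp: upd3_def)
    show "holds OrderF (upd3 u a b c) \<longleftrightarrow> (a, b, c) \<in> {(a, ua, v). a < n \<and> ua < n \<and> v < n \<and>
        (forced_step H J S ua v \<or> (\<exists>w<n. (a, ua, w) \<in> {(a, b, c). rel u 5 a b c} \<and> forced_step H J S w v))}"
      using abc z2 unfolding OrderF_def
      by (simp add: rr cong: conj_cong, simp add: upd3_def N2 cong: conj_cong) blast
  qed (use lfp(1,2) r2 n in auto)
  then have "rel s3 5 a u v \<longleftrightarrow> a < n \<and> ?T u v" for a u v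
    using lfp(3)[of a u v] by blast
  then have o3: "order_ctx n ?T s3" unfolding order_ctx_def using n0 by blast
  define s4 where "s4 = sem (LfpC 6 4 LateF) s3"
  have r4: "fst s4 j = fst s j" if "j \<notin> {1, 2, 3}" for j
    using that r3 unfolding s4_def by (simp add: sem_frame_reg)
  have a4: "snd s4 A = snd s A" if "A \<notin> {3, 4, 5, 6, 7}" for A
    using that a3 unfolding s4_def by (simp add: sem_frame_arr)
  have c4: "graph_ctx n E P F s4" using ctx graph_ctx_cong[of s4 s] r4 a4 by simp
  have "snd s4 5 = snd s3 5" unfolding s4_def by (simp add: sem_frame_arr)
  then have o4: "order_ctx n ?T s4" using o3 order_ctx_cong[of s4 s3] r3 r4 by simp
  note lfp = lfp_late[where n = n and s = "fst s 5" and T = ?T and H = H and P = P]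
  have "{(x, u, v). rel s4 6 x u v} = lfp (\<lambda>X. {(a, v, w). a < n \<and> v < n \<and> w < n \<and> late_step n (fst s 5) ?T H P (\<lambda>u w. (a, u, w) \<in> X) v w})"
    unfolding s4_def
  proof (rule rel_LfpC[where L = 25])
    fix u a b c
    assume fr: "\<And>j. j \<notin> {1, 2, 3} \<Longrightarrow> fst u j = fst s3 j" "\<And>C. C \<notin> {6, 4} \<Longrightarrow> snd u C = snd s3 C"
      and abc: "a < fst s3 0" "b < fst s3 0" "c < fst s3 0"
    have cu: "graph_ctx n E P F (upd3 u a b c)" "order_ctx n ?T (upd3 u a b c)"
      using c3 o3 graph_ctx_cong[of "upd3 u a b c" s3] order_ctx_cong[of "upd3 u a b c" s3] fr by (auto simp: upd3_def)
    have 5: "fst u 5 = fst s 5" using r3 fr(1) by simp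
    have rr: "rel (upd3 u a b c) A = rel u A" for A
      by (auto intro!: rel_cong simp: upd3_def)
    have "holds LateF (upd3 u a b c) \<longleftrightarrow> late_step n (fst (upd3 u a b c) 5) ?T (\<lambda>u v. E u v \<and> \<not> F u v) P
        (\<lambda>ua w. rel (upd3 u a b c) 6 (fst (upd3 u a b c) 1) ua w) (fst (upd3 u a b c) 2) (fst (upd3 u a b c) 3)"
      by (rule holds_LateF[OF cu]) (use abc st 5 r3 n in \<open>auto simp: upd3_def\<close>)
    then show "holds LateF (upd3 u a b c) \<longleftrightarrow> (a, b, c) \<in> {(a, v, w). a < n \<and> v < n \<and> w < n \<and>
        late_step n (fst s 5) ?T H P (\<lambda>ua w. (a, ua, w) \<in> {(a, b, c). rel u 6 a b c}) v w}"
      using abc n 5 r3 rr by (simp add: upd3_def H_def)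
  qed (use lfp(1,2) r3 n in auto)
  then have late: "rel s4 6 a v w \<longleftrightarrow> a < n \<and> late n (fst s 5) ?T H P v w" for a v w
    using lfp(3)[where a = a and v = v and w = w] by blast
  have "holds AcceptF s4 \<longleftrightarrow> accepts n (fst s4 5) (fst s4 6) ?T E (\<lambda>u v. E u v \<and> \<not> F u v) P"
    by (rule holds_AcceptF[OF c4 o4]) (use st r4 late n0 in \<open>auto simp: H_def\<close>)
  then have acc: "holds AcceptF s4 \<longleftrightarrow> accepts n (fst s 5) (fst s 6) ?T E H P"
    using r4 by (simp add: H_def)
  have "holds (EF 5 6) s4 = E (fst s 5) (fst s 6)" using holds_graph(1)[OF c4, of 5 6] r4 st by simp
  moreover have "sem (test cyc) s = sem (IfC (AcceptF \<^bold>\<and> (if cyc then EF 5 6 else TrueF)) (ConstC 7 1) SkipC) s4"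
    unfolding test_def s4_def s3_def s2_def s1_def by simp
  ultimately show ?thesis using acc r4 by (cases cyc) (simp_all del: holds.simps(2))
qed

section \<open>The table of guesses\<close>

text \<open>A tree of sequences: row 0 is the empty one, and any other row stores just the number of
  its parent and its last edge. Thus appending an edge to a row takes constant time and
  space.\<close>

definition table :: "(nat \<times> nat) list list \<Rightarrow> state \<Rightarrow> bool" where
  "table rows s \<longleftrightarrow> rows \<noteq> [] \<and> rows ! 0 = [] \<and>
     (\<forall>r. 0 < r \<and> r < length rows \<longrightarrow> snd s 10 r < length rows \<and>
        rows ! r = rows ! (snd s 10 r) @ [(snd s 11 r, snd s 12 r)])"

definition valid_seq :: "('a \<Rightarrow> 'a \<Rightarrow> bool) \<Rightarrow> ('a \<times> 'a) list \<Rightarrow> bool" where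
  "valid_seq F es \<longleftrightarrow> (\<forall>(a, b)\<in>set es. F a b) \<and> distinct (map (\<lambda>(a, b). {a, b}) es)"

text \<open>Parent links yield a row from its last edge backwards. Register 11 holds the end of the
  stretch whose start is still to be read: the last vertex of the path at the beginning, later the
  tail of the edge read most recently. At row 0 nothing happens any more.\<close>

definition walk_step :: cmd where
  "walk_step = IfC (LessF 4 10)
     (LoadC 12 11 10 ;; LoadC 13 12 10 ;; PutC 8 4 12 13 TrueF ;; PutC 9 4 13 11 TrueF ;; CopyC 11 12 ;; LoadC 10 10 10)
     SkipC"

text \<open>No row is longer than n^2, so n^2 rounds suffice. The last command closes the first
  stretch, which begins at the first vertex of the path.\<close>

definition walk :: cmd where
  "walk = DefC 8 (LessF 0 0) ;; DefC 9 (LessF 0 0) ;; CopyC 10 8 ;; CopyC 11 6 ;;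
     RepC (RepC walk_step) ;; PutC 9 4 5 11 TrueF"

text \<open>Only the used edges in array 8 matter here; the ends 0 are placeholders that keep all
  arguments in range.\<close>

definition expand :: cmd where
  "expand = ConstC 5 0 ;; ConstC 6 0 ;; walk ;; ForC 14 (ForC 15
     (IfC (FF 14 15 \<^bold>\<and> NegF (RelF 8 4 14 15) \<^bold>\<and> NegF (RelF 8 4 15 14))
        (StoreC 10 9 8 ;; StoreC 11 9 14 ;; StoreC 12 9 15 ;; IncC 9) SkipC))"

text \<open>The table doubles as a queue with its head in register 8 and its tail in register 9. One
  round appends the extensions of the head row and tests that row with all pairs of ends.\<close>

definition body :: "bool \<Rightarrow> cmd" where
  "body cyc = expand ;; ForC 5 (ForC 6 (walk ;; test cyc)) ;; IncC 8"

text \<open>Without vertices there is nothing to search, and the empty list is a path but not a cycle.\<close>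

definition init :: "bool \<Rightarrow> cmd" where
  "init cyc = IfC (ExF 16 TrueF) (ConstC 9 1) (ConstC 7 (of_bool (\<not> cyc)))"

lemma walk_facts [simp]:
  "cmd_ok 25 walk" "wregs walk = {1, 2, 3, 10, 11, 12, 13}" "warrs walk = {8, 9}"
  "wregs walk_step = {10, 11, 12, 13}" "warrs walk_step = {8, 9}"
  by (auto simp: walk_def walk_step_def)

lemma expand_facts [simp]:
  "cmd_ok 25 expand" "wregs expand = {1, 2, 3, 5, 6, 9, 10, 11, 12, 13, 14, 15}" "warrs expand = {8, 9, 10, 11, 12}"
  by (auto simp: expand_def)

lemma body_facts [simp]: "cmd_ok 25 (body cyc)" "cmd_ok 25 (init cyc)"
  by (auto simp: body_def init_def)

lemma table_cong:
  "snd s 10 = snd u 10 \<Longrightarrow> snd s 11 = snd u 11 \<Longrightarrow> snd s 12 = snd u 12 \<Longrightarrow> table rows s = table rows u"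
  by (simp add: table_def)

lemma table_upd [simp]: "table rows (f(x := v), a) = table rows (f, a)"
  by (rule table_cong) simp_all

text \<open>For reading backwards, \<open>segs\<close> is split into the first stretch, of which
  only the end is known yet, and the stretches in \<open>rest_segs\<close>, which are
  complete.\<close>

definition first_of :: "('a \<times> 'a) list \<Rightarrow> 'a \<Rightarrow> 'a" where
  "first_of es t = (case es of [] \<Rightarrow> t | e # _ \<Rightarrow> fst e)"

definition rest_segs :: "('a \<times> 'a) list \<Rightarrow> 'a \<Rightarrow> ('a \<times> 'a) set" where
  "rest_segs es t = (case es of [] \<Rightarrow> {} | e # xs \<Rightarrow> segs (snd e) xs t)"

lemma segs_first_rest: "segs s es t = insert (s, first_of es t) (rest_segs es t)"
  by (cases es) (auto simp: first_of_def rest_segs_def)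

lemma segs_bound:
  assumes "s < n" "t < n" "set es \<subseteq> {..<n} \<times> {..<n}"
  shows "segs s es t \<subseteq> {..<n} \<times> {..<n}"
  using assms by (induction s es t rule: segs.induct) auto

lemma sem_walk:
  assumes n: "fst s 0 = n" "0 < n" and z: "fst s 4 = 0" and tab: "table rows s" and q: "fst s 8 < length rows"
    and bnd: "\<And>es. es \<in> set rows \<Longrightarrow> set es \<subseteq> {..<n} \<times> {..<n} \<and> length es \<le> n * n"
    and st: "fst s 5 < n" "fst s 6 < n" and uv: "u < n" "v < n"
  shows "rel (sem walk s) 8 0 u v \<longleftrightarrow> (u, v) \<in> set (rows ! fst s 8)"
    and "rel (sem walk s) 9 0 u v \<longleftrightarrow> (u, v) \<in> segs (fst s 5) (rows ! fst s 8) (fst s 6)"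
proof -
  let ?row = "rows ! fst s 8" and ?t = "fst s 6"
  have rowb: "set ?row \<subseteq> {..<n} \<times> {..<n}" "length ?row \<le> n * n" using bnd[OF nth_mem[OF q]] by auto
  define s1 where "s1 = sem (DefC 8 (LessF 0 0) ;; DefC 9 (LessF 0 0) ;; CopyC 10 8 ;; CopyC 11 6) s"
  \<comment> \<open>\<open>suf\<close> is the part of the row read in \<open>k\<close> rounds and
    \<open>pre\<close> the part still to come. As rows have length at most n^2, the disjunction in
    the invariant makes \<open>pre\<close> empty after n^2 rounds.\<close>
  define Inv where "Inv = (\<lambda>k u. \<exists>pre suf. fst u 0 = n \<and> fst u 4 = 0 \<and> fst u 5 = fst s 5 \<and> fst u 10 < length rows \<and>
     snd u 10 = snd s 10 \<and> snd u 11 = snd s 11 \<and> snd u 12 = snd s 12 \<and>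
     rows ! (fst u 10) = pre \<and> ?row = pre @ suf \<and> (pre = [] \<or> length suf = k) \<and> fst u 11 = first_of suf ?t \<and>
     (\<forall>a<n. \<forall>b<n. (rel u 8 0 a b \<longleftrightarrow> (a, b) \<in> set suf) \<and> (rel u 9 0 a b \<longleftrightarrow> (a, b) \<in> rest_segs suf ?t)))"
  have "\<not> rel s1 8 0 a b \<and> \<not> rel s1 9 0 a b" if "a < n" "b < n" for a b
  proof -
    let ?s8 = "sem (DefC 8 (LessF 0 0)) s" and ?s9 = "sem (DefC 9 (LessF 0 0)) (sem (DefC 8 (LessF 0 0)) s)"
    have n8: "fst ?s8 0 = n" "fst ?s9 0 = n" using n by (simp_all add: sem_frame_reg)
    have "\<not> rel ?s8 8 0 a b" using rel_DefC[of 8 "LessF 0 0" 1 0 s a b] that n by simp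
    moreover have "\<not> rel ?s9 9 0 a b" using rel_DefC[of 9 "LessF 0 0" 1 0 ?s8 a b] that n n8 by simp
    moreover have "rel ?s9 8 = rel ?s8 8" by (rule rel_cong) (simp_all add: sem_frame_reg sem_frame_arr)
    ultimately show ?thesis unfolding s1_def by simp
  qed
  then have "Inv 0 s1"
    unfolding Inv_def using n z q unfolding s1_def
    by (intro exI[of _ ?row] exI[of _ "[]"]) (simp add: sem_frame_reg sem_frame_arr first_of_def rest_segs_def)
  moreover have "Inv (Suc k) (sem walk_step u)" if inv: "Inv k u" for k u
  proof -
    obtain pre suf where I: "fst u 0 = n" "fst u 4 = 0" "fst u 5 = fst s 5" "fst u 10 < length rows"
     "snd u 10 = snd s 10" "snd u 11 = snd s 11" "snd u 12 = snd s 12"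
     "rows ! (fst u 10) = pre" "?row = pre @ suf" "pre = [] \<or> length suf = k" "fst u 11 = first_of suf ?t"
     "\<And>a b. a < n \<Longrightarrow> b < n \<Longrightarrow> (rel u 8 0 a b \<longleftrightarrow> (a, b) \<in> set suf) \<and> (rel u 9 0 a b \<longleftrightarrow> (a, b) \<in> rest_segs suf ?t)"
      using inv unfolding Inv_def by blast
    show ?thesis
    proof (cases "0 < fst u 10")
      case False
      then have "pre = []" using I(8) tab unfolding table_def by simp
      moreover have "sem walk_step u = u" using False I(2) by (simp add: walk_step_def)
      ultimately show ?thesis unfolding Inv_def using I by auto
    next
      case True
      let ?c = "fst u 10"
      define a where "a = snd s 11 ?c"
      define b where "b = snd s 12 ?c"
      have par: "snd s 10 ?c < length rows" "pre = rows ! (snd s 10 ?c) @ [(a, b)]"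
        using tab True I(4,8) unfolding table_def a_def b_def by auto
      have ab: "a < n" "b < n" using rowb(1) unfolding I(9) par(2) by auto
      have suf: "set suf \<subseteq> {..<n} \<times> {..<n}" using rowb(1) unfolding I(9) by auto
      have nx: "first_of suf ?t < n" using suf st(2) unfolding first_of_def by (cases suf) auto
      define u1 where "u1 = sem (LoadC 12 11 10 ;; LoadC 13 12 10) u"
      define u2 where "u2 = sem (PutC 8 4 12 13 TrueF) u1"
      define u3 where "u3 = sem (PutC 9 4 13 11 TrueF) u2"
      have sem: "sem walk_step u = sem (CopyC 11 12 ;; LoadC 10 10 10) u3"
        using True I(2) unfolding walk_step_def u3_def u2_def u1_def by simp
      have u1: "fst u1 = (fst u)(12 := a, 13 := b)" "snd u1 = snd u"
        using I(6,7) unfolding u1_def a_def b_def by auto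
      have u2: "fst u2 = fst u1" unfolding u2_def by simp
      have u3: "fst u3 = fst u1" unfolding u3_def using u2 by simp
      have a3: "snd u3 A = snd u A" if "A \<notin> {8, 9}" for A
        unfolding u3_def u2_def using that u1(2) by simp
      have r2: "rel u2 8 0 x y \<longleftrightarrow> (x, y) = (a, b) \<or> rel u 8 0 x y" for x y
      proof -
        have "rel u1 8 = rel u 8" by (rule rel_cong) (use u1 in auto)
        then show ?thesis unfolding u2_def
          using rel_PutC[of u1 4 12 13 8 TrueF 0 x y] ab n I(1,2) u1 by auto
      qed
      have r3: "rel u3 9 0 x y \<longleftrightarrow> (x, y) = (b, first_of suf ?t) \<or> rel u 9 0 x y" for x y
      proof -
        have "rel u2 9 = rel u 9" by (rule rel_cong) (use u1 u2 u2_def in auto)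
        then show ?thesis unfolding u3_def
          using rel_PutC[of u2 4 13 11 9 TrueF 0 x y] ab nx n I(1,2,11) u1 u2 by auto
      qed
      have r38: "rel u3 8 = rel u2 8" by (rule rel_cong) (use u3_def in auto)
      have rs: "rel (sem walk_step u) A = rel u3 A" for A unfolding sem by (rule rel_cong) auto
      have "rest_segs ((a, b) # suf) ?t = insert (b, first_of suf ?t) (rest_segs suf ?t)"
        using segs_first_rest[of b suf ?t] by (simp add: rest_segs_def)
      then have "\<forall>x<n. \<forall>y<n. (rel (sem walk_step u) 8 0 x y \<longleftrightarrow> (x, y) \<in> set ((a, b) # suf)) \<and>
          (rel (sem walk_step u) 9 0 x y \<longleftrightarrow> (x, y) \<in> rest_segs ((a, b) # suf) ?t)"
        using r2 r3 r38 rs I(12) by auto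
      moreover have "?row = rows ! (snd s 10 ?c) @ (a, b) # suf" using I(9) par(2) by simp
      moreover have "length suf = k" using I(10) par(2) by auto
      moreover have "fst (sem walk_step u) 10 = snd s 10 ?c" "fst (sem walk_step u) 11 = a"
        unfolding sem using u3 u1 a3[of 10] I(5) by auto
      ultimately show ?thesis unfolding Inv_def using I par
        by (intro exI[of _ "rows ! (snd s 10 ?c)"] exI[of _ "(a, b) # suf"])
          (simp add: sem_frame_reg sem_frame_arr first_of_def)
    qed
  qed
  ultimately have "Inv (n * n) ((sem walk_step ^^ (n * n)) s1)"
    by (rule funpow_inv)
  moreover have "fst s1 0 = n" using n unfolding s1_def by (simp add: sem_frame_reg)
  then have "sem (RepC (RepC walk_step)) s1 = (sem walk_step ^^ (n * n)) s1"
    using sem_RepC2[of walk_step s1] by simp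
  ultimately obtain s2 where s2: "Inv (n * n) s2" "s2 = sem (RepC (RepC walk_step)) s1" by simp
  then obtain pre suf where I: "fst s2 0 = n" "fst s2 4 = 0" "fst s2 5 = fst s 5" "?row = pre @ suf" 
     "pre = [] \<or> length suf = n * n" "fst s2 11 = first_of suf ?t"
     "\<And>a b. a < n \<Longrightarrow> b < n \<Longrightarrow> (rel s2 8 0 a b \<longleftrightarrow> (a, b) \<in> set suf) \<and> (rel s2 9 0 a b \<longleftrightarrow> (a, b) \<in> rest_segs suf ?t)"
    unfolding Inv_def by blast
  have row: "suf = ?row" using I(4,5) rowb(2) by auto
  have nx: "first_of suf ?t < n" using rowb(1) st(2) unfolding row first_of_def by (cases ?row) auto
  have sem: "sem walk s = sem (PutC 9 4 5 11 TrueF) s2"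
    unfolding s2(2) s1_def walk_def by simp
  have "rel (sem walk s) 8 = rel s2 8" unfolding sem by (rule rel_cong) auto
  then show "rel (sem walk s) 8 0 u v \<longleftrightarrow> (u, v) \<in> set ?row" using I(7) uv row by simp
  show "rel (sem walk s) 9 0 u v \<longleftrightarrow> (u, v) \<in> segs (fst s 5) ?row ?t"
    unfolding sem segs_first_rest
    using rel_PutC[of s2 4 5 11 9 TrueF 0 u v] I(1-3) I(6,7)[unfolded row] uv nx[unfolded row] st n(2) by auto
qed

definition exts :: "nat \<Rightarrow> vrel \<Rightarrow> (nat \<times> nat) list \<Rightarrow> (nat \<times> nat) set" where
  "exts n F es = {(u, v). u < n \<and> v < n \<and> F u v \<and> (u, v) \<notin> set es \<and> (v, u) \<notin> set es}"

lemma table_append: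
  assumes "table rows s" "q < length rows"
    "snd u 10 = (snd s 10)(length rows := q)" "snd u 11 = (snd s 11)(length rows := a)" "snd u 12 = (snd s 12)(length rows := b)"
  shows "table (rows @ [rows ! q @ [(a, b)]]) u"
  unfolding table_def
proof (intro conjI allI impI)
  have ne: "rows \<noteq> []" using assms(1) unfolding table_def by blast
  then show "(rows @ [rows ! q @ [(a, b)]]) ! 0 = []" using assms(1) unfolding table_def by (simp add: nth_append)
  fix r assume r: "0 < r \<and> r < length (rows @ [rows ! q @ [(a, b)]])"
  show "snd u 10 r < length (rows @ [rows ! q @ [(a, b)]])"
    using r assms unfolding table_def by (cases "r = length rows") (auto simp: less_Suc_eq)
  show "(rows @ [rows ! q @ [(a, b)]]) ! r = (rows @ [rows ! q @ [(a, b)]]) ! (snd u 10 r) @ [(snd u 11 r, snd u 12 r)]"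
    using r assms unfolding table_def by (cases "r = length rows") (auto simp: nth_append less_Suc_eq)
qed simp

text \<open>The list \<open>xs\<close> enumerates the possible next edges in the order of scanning;
  only its distinctness and its set matter later.\<close>

lemma sem_expand:
  assumes ctx: "graph_ctx n E P F s" and n: "0 < n" and tab: "table rows s"
    and q: "fst s 8 < length rows" and cnt: "fst s 9 = length rows"
    and bnd: "\<And>es. es \<in> set rows \<Longrightarrow> set es \<subseteq> {..<n} \<times> {..<n} \<and> length es \<le> n * n"
  shows "\<exists>xs. distinct xs \<and> set xs = exts n F (rows ! fst s 8) \<and>
    table (rows @ map (\<lambda>e. rows ! fst s 8 @ [e]) xs) (sem expand s) \<and>
    fst (sem expand s) 9 = length rows + length xs"
proof -
  let ?q = "fst s 8"
  let ?row = "rows ! ?q"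
  define s1 where "s1 = sem (ConstC 5 0 ;; ConstC 6 0 ;; walk) s"
  let ?s0 = "sem (ConstC 6 0) (sem (ConstC 5 0) s)"
  have s10: "s1 = sem walk ?s0" unfolding s1_def by simp
  have n0: "fst s 0 = n" "fst s 4 = 0" using ctx by (auto simp: graph_ctx_def)
  have t0: "table rows ?s0" using tab by (simp add: table_def)
  have J: "rel s1 8 0 u v \<longleftrightarrow> (u, v) \<in> set ?row" if "u < n" "v < n" for u v
    unfolding s10 using sem_walk(1)[of ?s0 n rows u v] n0 n t0 q bnd that by simp
  define Q where "Q = (\<lambda>D u. \<exists>xs. distinct xs \<and> set xs = D \<inter> exts n F ?row \<and>
     table (rows @ map (\<lambda>e. ?row @ [e]) xs) u \<and> fst u 9 = length rows + length xs \<and>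
     (\<forall>j. j \<notin> {9, 14, 15} \<longrightarrow> fst u j = fst s1 j) \<and> (\<forall>A. A \<notin> {10, 11, 12} \<longrightarrow> snd u A = snd s1 A))"
  have s1r: "fst s1 0 = n" "fst s1 4 = 0" "fst s1 8 = ?q" "fst s1 9 = length rows"
    using n0 cnt unfolding s10 by (simp_all add: sem_frame_reg)
  have s1g: "graph_ctx n E P F s1"
    using ctx graph_ctx_cong[of s1 s] s1r n0 unfolding s10 by (simp add: sem_frame_arr)
  let ?i = "IfC (FF 14 15 \<^bold>\<and> NegF (RelF 8 4 14 15) \<^bold>\<and> NegF (RelF 8 4 15 14))
        (StoreC 10 9 8 ;; StoreC 11 9 14 ;; StoreC 12 9 15 ;; IncC 9) SkipC"
  have Q_upd: "Q D ((fst u)(x := i), snd u)" if "Q D u" "x \<in> {14, 15}" for D u x i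
    using that unfolding Q_def by (elim exE, intro exI) auto
  have step: "Q (insert (i, j) D) (sem ?i u)"
    if Qu: "Q D u" and ij: "fst u 14 = i" "fst u 15 = j" "i < n" "j < n" "(i, j) \<notin> D" for D u i j
  proof -
    obtain xs where xs: "distinct xs" "set xs = D \<inter> exts n F ?row" "table (rows @ map (\<lambda>e. ?row @ [e]) xs) u"
      "fst u 9 = length rows + length xs" "\<And>j. j \<notin> {9, 14, 15} \<Longrightarrow> fst u j = fst s1 j"
      "\<And>A. A \<notin> {10, 11, 12} \<Longrightarrow> snd u A = snd s1 A" using Qu unfolding Q_def by blast
    have u: "fst u 0 = n" "fst u 4 = 0" "fst u 8 = ?q" using xs(5) s1r by auto
    have ug: "graph_ctx n E P F u" using s1g graph_ctx_cong[of u s1] xs(5,6) by simp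
    have "rel u 8 = rel s1 8" by (rule rel_cong) (use xs(5,6) in auto)
    then have ext: "holds (FF 14 15 \<^bold>\<and> NegF (RelF 8 4 14 15) \<^bold>\<and> NegF (RelF 8 4 15 14)) u \<longleftrightarrow> (i, j) \<in> exts n F ?row"
      using holds_graph(3)[OF ug, of 14 15] ij J u unfolding exts_def by auto
    let ?u = "sem (StoreC 10 9 8 ;; StoreC 11 9 14 ;; StoreC 12 9 15 ;; IncC 9) u"
    have i: "sem ?i u = (if (i, j) \<in> exts n F ?row then ?u else u)"
      by (simp only: sem.simps(1,9) ext)
    show ?thesis
    proof (cases "(i, j) \<in> exts n F ?row")
      case False
      then have "sem ?i u = u" using i by (simp only: if_False)
      then show ?thesis using Qu False unfolding Q_def by simp
    next
      case True
      have sem: "sem ?i u = ?u" using i True by (simp only: if_True)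
      let ?rows = "rows @ map (\<lambda>e. ?row @ [e]) xs"
      have "table (?rows @ [?rows ! ?q @ [(i, j)]]) ?u"
        by (rule table_append[OF xs(3)]) (use q xs(4) u ij in \<open>auto simp: fun_eq_iff\<close>)
      then have "table (rows @ map (\<lambda>e. ?row @ [e]) (xs @ [(i, j)])) ?u" using q by (simp add: nth_append)
      moreover have "distinct (xs @ [(i, j)])" "set (xs @ [(i, j)]) = insert (i, j) D \<inter> exts n F ?row"
        using xs(1,2) ij(5) True by auto
      ultimately show ?thesis unfolding sem Q_def using xs(4-6)
        by (intro exI[of _ "xs @ [(i, j)]"]) simp
    qed
  qed
  have inner: "Q (D \<union> (\<Union>j<n. {(i, j)})) (sem (ForC 15 ?i) u)"
    if Qu: "Q D u" and i: "fst u 14 = i" "i < n" "\<And>v. (i, v) \<notin> D" for D u i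
  proof -
    have nu: "fst u 0 = n" using Qu s1r unfolding Q_def by auto
    have "Q (D \<union> (\<Union>j<n. {(i, j)})) (sem (ForC 15 ?i) u) \<and> fst (sem (ForC 15 ?i) u) 14 = i"
    proof (rule sem_ForC_UN[where Q = "\<lambda>D u. Q D u \<and> fst u 14 = i", OF nu])
      fix k w assume k: "k < n" and w: "Q (D \<union> (\<Union>j<k. {(i, j)})) w \<and> fst w 14 = i"
      let ?w = "((fst w)(15 := k), snd w)"
      have "Q (insert (i, k) (D \<union> (\<Union>j<k. {(i, j)}))) (sem ?i ?w)"
        by (rule step[OF Q_upd]) (use w k i in auto)
      then show "Q (D \<union> (\<Union>j<k. {(i, j)}) \<union> {(i, k)}) (sem ?i ?w) \<and> fst (sem ?i ?w) 14 = i"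
        using w by (simp add: sem_frame_reg del: sem.simps)
    qed (use Qu i in auto)
    then show ?thesis by blast
  qed
  have "Q ({} \<union> (\<Union>i<n. \<Union>j<n. {(i, j)})) (sem (ForC 14 (ForC 15 ?i)) s1)"
  proof (rule sem_ForC_UN[OF s1r(1)])
    have "table rows s1" using tab unfolding s10 by (simp add: table_def sem_frame_arr)
    then show "Q {} s1" unfolding Q_def using s1r by (intro exI[of _ "[]"]) simp
  next
    fix k w assume k: "k < n" and w: "Q ({} \<union> (\<Union>i<k. \<Union>j<n. {(i, j)})) w"
    show "Q ({} \<union> (\<Union>i<k. \<Union>j<n. {(i, j)}) \<union> (\<Union>j<n. {(k, j)})) (sem (ForC 15 ?i) ((fst w)(14 := k), snd w))"
      by (rule inner[OF Q_upd]) (use w k in auto)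
  qed
  moreover have "sem expand s = sem (ForC 14 (ForC 15 ?i)) s1" unfolding expand_def s1_def by simp
  moreover have "({} \<union> (\<Union>i<n. \<Union>j<n. {(i, j)})) \<inter> exts n F ?row = exts n F ?row" unfolding exts_def by auto
  ultimately show ?thesis unfolding Q_def by (metis (no_types, lifting))
qed

definition good :: "bool \<Rightarrow> nat \<Rightarrow> vrel \<Rightarrow> vrel \<Rightarrow> vrel \<Rightarrow> (nat \<times> nat) list \<Rightarrow> bool" where
  "good cyc n E P F es \<longleftrightarrow> (\<exists>s<n. \<exists>t<n. accepts n s t
     (forced_step (\<lambda>u v. E u v \<and> \<not> F u v) (set es) (segs s es t))\<^sup>+\<^sup>+ E (\<lambda>u v. E u v \<and> \<not> F u v) P \<and> (cyc \<longrightarrow> E s t))"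

lemma sem_checks:
  assumes ctx: "graph_ctx n E P F s" and n: "0 < n" and tab: "table rows s"
    and q: "fst s 8 < length rows" and E: "\<And>u v. E u v \<Longrightarrow> u < n \<and> v < n"
    and bnd: "\<And>es. es \<in> set rows \<Longrightarrow> set es \<subseteq> {..<n} \<times> {..<n} \<and> length es \<le> n * n"
  shows "fst (sem (ForC 5 (ForC 6 (walk ;; test cyc))) s) 7 = (if good cyc n E P F (rows ! fst s 8) then 1 else fst s 7)"
proof -
  let ?row = "rows ! fst s 8"
  let ?H = "\<lambda>u v. E u v \<and> \<not> F u v"
  define A where "A = (\<lambda>a b. accepts n a b (forced_step ?H (set ?row) (segs a ?row b))\<^sup>+\<^sup>+ E ?H P \<and> (cyc \<longrightarrow> E a b))"
  \<comment> \<open>\<open>D\<close> holds the pairs of ends already tried; the answer register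
    records whether one of them passed and otherwise keeps its former value.\<close>
  define Q where "Q = (\<lambda>D u. (\<forall>j. j \<notin> {1, 2, 3, 5, 6, 7, 10, 11, 12, 13} \<longrightarrow> fst u j = fst s j) \<and>
     (\<forall>A. A \<notin> {3, 4, 5, 6, 7, 8, 9} \<longrightarrow> snd u A = snd s A) \<and>
     fst u 7 = (if \<exists>(a, b)\<in>D. A a b then 1 else fst s 7))"
  have n0: "fst s 0 = n" "fst s 4 = 0" using ctx by (auto simp: graph_ctx_def)
  have row: "set ?row \<subseteq> {..<n} \<times> {..<n}" using bnd[OF nth_mem[OF q]] by blast
  have Q_upd: "Q D ((fst u)(x := i), snd u)" if "Q D u" "x \<in> {5, 6}" for D u x i
    using that unfolding Q_def by auto
  have step: "Q (insert (i, j) D) (sem (walk ;; test cyc) u)"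
    if Qu: "Q D u" and ij: "fst u 5 = i" "fst u 6 = j" "i < n" "j < n" for D u i j
  proof -
    have u: "fst u 0 = n" "fst u 4 = 0" "fst u 8 = fst s 8" using Qu n0 unfolding Q_def by auto
    have tu: "table rows u" using tab Qu table_cong[of u s] unfolding Q_def by simp
    let ?w = "sem walk u"
    have wr: "fst ?w j = fst u j" if "j \<notin> {1, 2, 3, 10, 11, 12, 13}" for j
      using that by (simp add: sem_frame_reg)
    have wa: "snd ?w A = snd u A" if "A \<notin> {8, 9}" for A using that by (simp add: sem_frame_arr)
    have gw: "graph_ctx n E P F ?w"
      using ctx graph_ctx_cong[of ?w s] wr wa Qu unfolding Q_def by simp
    have JS: "rel ?w 8 0 a b \<longleftrightarrow> (a, b) \<in> set ?row" "rel ?w 9 0 a b \<longleftrightarrow> (a, b) \<in> segs i ?row j" if "a < n" "b < n" for a b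
      using sem_walk[of u n rows a b] u n tu q bnd ij that by simp_all
    have "fst (sem (test cyc) ?w) 7 = (if A i j then 1 else fst ?w 7)"
      using sem_test[OF gw _ _ E row _ segs_bound[OF ij(3,4) row], of cyc] JS ij wr unfolding A_def by simp
    then have "fst (sem (walk ;; test cyc) u) 7 = (if \<exists>(a, b)\<in>insert (i, j) D. A a b then 1 else fst s 7)"
      using wr[of 7] Qu unfolding Q_def by auto
    then show ?thesis using Qu unfolding Q_def by (simp add: sem_frame_reg sem_frame_arr)
  qed
  let ?c = "walk ;; test cyc"
  have inner: "Q (D \<union> (\<Union>j<n. {(i, j)})) (sem (ForC 6 ?c) u)" if Qu: "Q D u" and i: "fst u 5 = i" "i < n" for D u i
  proof -
    have nu: "fst u 0 = n" using Qu n0 unfolding Q_def by auto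
    have "Q (D \<union> (\<Union>j<n. {(i, j)})) (sem (ForC 6 ?c) u) \<and> fst (sem (ForC 6 ?c) u) 5 = i"
    proof (rule sem_ForC_UN[where Q = "\<lambda>D u. Q D u \<and> fst u 5 = i", OF nu])
      fix k w assume k: "k < n" and w: "Q (D \<union> (\<Union>j<k. {(i, j)})) w \<and> fst w 5 = i"
      let ?w = "((fst w)(6 := k), snd w)"
      have "Q (insert (i, k) (D \<union> (\<Union>j<k. {(i, j)}))) (sem ?c ?w)"
        by (rule step[OF Q_upd]) (use w k i in auto)
      then show "Q (D \<union> (\<Union>j<k. {(i, j)}) \<union> {(i, k)}) (sem ?c ?w) \<and> fst (sem ?c ?w) 5 = i"
        using w by (simp add: sem_frame_reg del: sem.simps)
    qed (use Qu i in auto)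
    then show ?thesis by blast
  qed
  have "Q ({} \<union> (\<Union>i<n. \<Union>j<n. {(i, j)})) (sem (ForC 5 (ForC 6 ?c)) s)"
  proof (rule sem_ForC_UN[OF n0(1)])
    show "Q {} s" unfolding Q_def by simp
  next
    fix k w assume k: "k < n" and w: "Q ({} \<union> (\<Union>i<k. \<Union>j<n. {(i, j)})) w"
    show "Q ({} \<union> (\<Union>i<k. \<Union>j<n. {(i, j)}) \<union> (\<Union>j<n. {(k, j)})) (sem (ForC 6 ?c) ((fst w)(5 := k), snd w))"
      by (rule inner[OF Q_upd]) (use w k in auto)
  qed
  then have "fst (sem (ForC 5 (ForC 6 ?c)) s) 7 =
      (if \<exists>(a, b)\<in>{} \<union> (\<Union>i<n. \<Union>j<n. {(i, j)}). A a b then 1 else fst s 7)"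
    unfolding Q_def by blast
  moreover have "(\<exists>(a, b)\<in>{} \<union> (\<Union>i<n. \<Union>j<n. {(i, j)}). A a b) \<longleftrightarrow> good cyc n E P F ?row"
    unfolding good_def A_def by auto
  ultimately show ?thesis by simp
qed

section \<open>Counting the guesses\<close>

text \<open>A sequence is determined by its list of distinct edges together with one bit per edge
  for the direction, namely whether the first vertex is the smaller one. With f =
  \<open>card F\<close>, each length m \<le> f admits at most f! edge lists and at most 2^f bit
  lists, and the f + 1 lengths turn f! into (f + 1)!.\<close>

lemma card_valid_seq:
  fixes F :: "nat set set"
  assumes fin: "finite F" and two: "\<And>e. e \<in> F \<Longrightarrow> card e = 2"
  defines "V \<equiv> {es. valid_seq (\<lambda>u v. {u, v} \<in> F) es}"
  shows "finite V" "card V \<le> fact (card F + 1) * 2 ^ card F"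
proof -
  let ?f = "card F"
  let ?D = "\<lambda>m. {xs. length xs = m \<and> distinct xs \<and> set xs \<subseteq> F}"
  let ?B = "\<lambda>m. {bs :: bool list. set bs \<subseteq> UNIV \<and> length bs = m}"
  let ?X = "\<Union>m\<le>?f. ?D m \<times> ?B m"
  let ?h = "\<lambda>es. (map (\<lambda>(a, b). {a, b}) es, map (\<lambda>(a, b). a < b) es)"
  have finD: "finite (?D m)" for m
    by (rule finite_subset[OF _ finite_lists_length_eq[OF fin, of m]]) auto
  have finB: "finite (?B m)" for m by (rule finite_lists_length_eq) simp
  have finX: "finite ?X" using finD finB by blast
  have neq: "a \<noteq> b" if "{a, b} \<in> F" for a b using two[OF that] by auto
  have inj: "inj_on ?h V"
  proof (rule inj_onI)
    fix es es' assume e: "es \<in> V" "es' \<in> V" "?h es = ?h es'"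
    have len: "length es = length es'" using e(3) by (metis length_map prod.inject)
    show "es = es'"
    proof (rule nth_equalityI[OF len])
      fix i assume i: "i < length es"
      obtain a b where ab: "es ! i = (a, b)" by force
      obtain c d where cd: "es' ! i = (c, d)" by force
      have "{a, b} = {c, d}" "(a < b) = (c < d)"
        using arg_cong[OF e(3), of "\<lambda>p. fst p ! i"] arg_cong[OF e(3), of "\<lambda>p. snd p ! i"] i len ab cd by auto
      moreover have "{a, b} \<in> F" using e(1) i ab nth_mem[OF i] unfolding V_def valid_seq_def by fastforce
      then have "a \<noteq> b" by (rule neq)
      ultimately show "es ! i = es' ! i" unfolding ab cd by (auto simp: doubleton_eq_iff)
    qed
  qed
  have img: "?h ` V \<subseteq> ?X"
  proof
    fix p assume "p \<in> ?h ` V"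
    then obtain es where es: "es \<in> V" "p = ?h es" by blast
    have d: "distinct (map (\<lambda>(a, b). {a, b}) es)" "set (map (\<lambda>(a, b). {a, b}) es) \<subseteq> F"
      using es(1) unfolding V_def valid_seq_def by auto
    have "length es \<le> ?f" using card_mono[OF fin d(2)] distinct_card[OF d(1)] by simp
    then show "p \<in> ?X" using d es(2) by auto
  qed
  show "finite V" using finite_imageD[OF finite_subset[OF img finX] inj] .
  have cD: "card (?D m) \<le> fact ?f" if "m \<le> ?f" for m
  proof -
    have "card (?D m) = \<Prod>{?f - m + 1..?f}" using card_lists_distinct_length_eq[OF fin that] .
    also have "\<dots> \<le> \<Prod>{1..?f}"
      by (rule dvd_imp_le[OF prod_dvd_prod_subset]) (auto intro!: prod_pos)
    finally show ?thesis by (simp add: fact_prod)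
  qed
  have "card V \<le> card ?X" by (rule card_inj_on_le[OF inj img finX])
  also have "\<dots> \<le> (\<Sum>m\<le>?f. card (?D m \<times> ?B m))" by (rule card_UN_le) simp
  also have "\<dots> \<le> (\<Sum>m\<le>?f. fact ?f * 2 ^ ?f)"
  proof (rule sum_mono)
    fix m assume m: "m \<in> {..?f}"
    have "card (?B m) = 2 ^ m" using card_lists_length_eq[of "UNIV :: bool set" m] by simp
    then have "card (?B m) \<le> 2 ^ ?f" using m by simp
    then show "card (?D m \<times> ?B m) \<le> fact ?f * 2 ^ ?f"
      unfolding card_cartesian_product using cD m by (intro mult_mono) auto
  qed
  also have "\<dots> = fact (?f + 1) * 2 ^ ?f" by (simp add: algebra_simps)
  finally show "card V \<le> fact (card F + 1) * 2 ^ card F" .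
qed

text \<open>Distinctness concerns undirected edges, which is why \<open>exts\<close> excludes both
  orientations of the edges already used.\<close>

lemma valid_seq_snoc:
  fixes F :: vrel
  assumes "\<And>u v. F u v \<Longrightarrow> u < n \<and> v < n" "valid_seq F es"
  shows "valid_seq F (es @ [e]) \<longleftrightarrow> e \<in> exts n F es"
proof -
  obtain u v where e: "e = (u, v)" by force
  have "{u, v} \<in> (\<lambda>(a, b). {a, b}) ` set es \<longleftrightarrow> (u, v) \<in> set es \<or> (v, u) \<in> set es"
    by (force simp: doubleton_eq_iff)
  then show ?thesis using assms unfolding valid_seq_def exts_def e by auto
qed

lemma valid_seq_prefix: "valid_seq F (es @ [e]) \<Longrightarrow> valid_seq F es"
  by (auto simp: valid_seq_def)

text \<open>Distinct edges give distinct pairs, and there are n^2 pairs; this justifies the n^2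
  rounds of \<open>walk\<close>.\<close>

lemma valid_seq_bound:
  fixes F :: vrel
  assumes "\<And>u v. F u v \<Longrightarrow> u < n \<and> v < n" "valid_seq F es"
  shows "set es \<subseteq> {..<n} \<times> {..<n} \<and> length es \<le> n * n"
proof
  show sub: "set es \<subseteq> {..<n} \<times> {..<n}" using assms unfolding valid_seq_def by auto
  have "distinct es" using assms(2) unfolding valid_seq_def by (simp add: distinct_map)
  then have "length es = card (set es)" by (simp add: distinct_card)
  also have "\<dots> \<le> n * n" using card_mono[OF _ sub] by simp
  finally show "length es \<le> n * n" .
qed

section \<open>The search\<close>

text \<open>Breadth-first search: the rows are the root and the one-edge extensions of the rows
  before the head. Distinctness and validity of the rows bound their number by that of the valid
  sequences, and hence the number of iterations.\<close>

definition search_inv :: "bool \<Rightarrow> nat \<Rightarrow> vrel \<Rightarrow> vrel \<Rightarrow> vrel \<Rightarrow>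
    (nat \<times> nat) list list \<Rightarrow> state \<Rightarrow> bool" where
  "search_inv cyc n E P F rows s \<longleftrightarrow> graph_ctx n E P F s \<and> table rows s \<and> fst s 9 = length rows \<and>
     fst s 8 \<le> length rows \<and> distinct rows \<and>
     set rows = insert [] {es @ [e] |es e. es \<in> set (take (fst s 8) rows) \<and> e \<in> exts n F es} \<and>
     (\<forall>es\<in>set rows. valid_seq F es) \<and> fst s 7 = of_bool (\<exists>es\<in>set (take (fst s 8) rows). good cyc n E P F es)"

lemma search_inv_agree:
  assumes "search_inv cyc n E P F rows s" "agree 25 u s"
  shows "search_inv cyc n E P F rows u"
proof -
  have "snd u = snd s" "fst u 0 = fst s 0" "fst u 4 = fst s 4" "fst u 7 = fst s 7" "fst u 8 = fst s 8" "fst u 9 = fst s 9"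
    using assms(2) by (auto simp: agree_def)
  then show ?thesis
    using assms(1) graph_ctx_cong[of u s] table_cong[of u s] unfolding search_inv_def by simp
qed

lemma search_inv_body:
  assumes inv: "search_inv cyc n E P F rows s" and q: "fst s 8 < fst s 9" and n: "0 < n"
    and E: "\<And>u v. E u v \<Longrightarrow> u < n \<and> v < n" and F: "\<And>u v. F u v \<Longrightarrow> u < n \<and> v < n"
  shows "\<exists>rows'. search_inv cyc n E P F rows' (sem (body cyc) s) \<and> fst (sem (body cyc) s) 8 = Suc (fst s 8)"
proof -
  let ?q = "fst s 8"
  let ?row = "rows ! ?q"
  have I: "graph_ctx n E P F s" "table rows s" "fst s 9 = length rows" "distinct rows"
    "set rows = insert [] {es @ [e] |es e. es \<in> set (take ?q rows) \<and> e \<in> exts n F es}"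
    "\<And>es. es \<in> set rows \<Longrightarrow> valid_seq F es" "fst s 7 = of_bool (\<exists>es\<in>set (take ?q rows). good cyc n E P F es)"
    using inv unfolding search_inv_def by auto
  have ql: "?q < length rows" using q I(3) by simp
  have bnd: "set es \<subseteq> {..<n} \<times> {..<n} \<and> length es \<le> n * n" if "valid_seq F es" for es
    using valid_seq_bound[OF F that] by blast
  obtain xs where xs: "distinct xs" "set xs = exts n F ?row" "table (rows @ map (\<lambda>e. ?row @ [e]) xs) (sem expand s)"
      "fst (sem expand s) 9 = length rows + length xs"
    using sem_expand[OF I(1) n I(2) ql I(3) bnd[OF I(6)]] by blast
  define new where "new = map (\<lambda>e. ?row @ [e]) xs"
  let ?s1 = "sem expand s"
  have g1: "graph_ctx n E P F ?s1"
    using I(1) graph_ctx_cong[of ?s1 s] by (simp add: sem_frame_reg sem_frame_arr)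
  have r1: "fst ?s1 8 = ?q" "fst ?s1 7 = fst s 7" by (simp_all add: sem_frame_reg)
  have set_new: "set new = {?row @ [e] |e. e \<in> exts n F ?row}" using xs(2) unfolding new_def by auto
  have row: "?row \<in> set rows" using ql by simp
  have valid: "valid_seq F es" if "es \<in> set (rows @ new)" for es
    using that I(6) row set_new valid_seq_snoc[OF F I(6)[OF row]] by auto
  let ?c = "ForC 5 (ForC 6 (walk ;; test cyc))"
  let ?s2 = "sem ?c ?s1"
  have s2: "sem (body cyc) s = ((fst ?s2)(8 := Suc (fst ?s2 8)), snd ?s2)"
    unfolding body_def by (simp del: sem.simps(10))
  have ans: "fst ?s2 7 = (if good cyc n E P F ((rows @ new) ! ?q) then 1 else fst s 7)"
    using sem_checks[OF g1 n _ _ E, of "rows @ new" cyc] xs(3) ql bnd[OF valid] r1 unfolding new_def by simp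
  have r2: "fst ?s2 8 = ?q" "fst ?s2 9 = length (rows @ new)" "fst ?s2 0 = fst s 0" "fst ?s2 4 = fst s 4"
    using xs(4) r1 by (simp_all add: sem_frame_reg new_def del: sem.simps)
  have a2: "snd ?s2 A = snd ?s1 A" if "A \<notin> {3, 4, 5, 6, 7, 8, 9}" for A
    using that by (simp add: sem_frame_arr del: sem.simps)
  have g2: "graph_ctx n E P F ?s2"
    using g1 graph_ctx_cong[of ?s2 ?s1] a2 by (simp add: sem_frame_reg del: sem.simps)
  have t2: "table (rows @ new) ?s2" using xs(3) table_cong[of ?s2 ?s1] a2 unfolding new_def by simp
  have take: "take (Suc ?q) (rows @ new) = take ?q rows @ [?row]" using ql by (simp add: take_Suc_conv_app_nth)
  have nth: "(rows @ new) ! ?q = ?row" using ql by (simp add: nth_append)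
  \<comment> \<open>A nonempty sequence determines its parent, and the parent has not been treated
    before; so its extensions are new rows.\<close>
  have fresh: "?row \<notin> set (take ?q rows)"
  proof
    assume "?row \<in> set (take ?q rows)"
    then obtain j where "j < ?q" "rows ! j = ?row" using ql by (auto simp: in_set_conv_nth)
    then show False using nth_eq_iff_index_eq[OF I(4), of j ?q] ql by auto
  qed
  have "distinct new" unfolding new_def distinct_map using xs(1) by (auto intro: inj_onI)
  moreover have "es \<notin> set new" if "es \<in> set rows" for es
    using that fresh I(5) set_new by auto
  ultimately have "distinct (rows @ new)" using I(4) by auto
  moreover have "set (rows @ new) = insert [] {es @ [e] |es e. es \<in> set (take (Suc ?q) (rows @ new)) \<and> e \<in> exts n F es}"
    unfolding take set_append set_new by (subst I(5)) auto
  moreover have "(if good cyc n E P F ?row then 1 else fst s 7) =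
      of_bool (\<exists>es\<in>set (take (Suc ?q) (rows @ new)). good cyc n E P F es)"
    unfolding take I(7) by auto
  ultimately have "search_inv cyc n E P F (rows @ new) (sem (body cyc) s)"
    unfolding search_inv_def s2 using g2 t2 r2 ans ql valid unfolding nth by simp
  moreover have "fst (sem (body cyc) s) 8 = Suc ?q" unfolding s2 using r2 by simp
  ultimately show ?thesis by blast
qed

text \<open>Once the head has reached the tail, the rows are closed under extension. Prefixes of
  valid sequences are valid, so induction from the empty row reaches every valid sequence.\<close>

lemma search_inv_final:
  assumes inv: "search_inv cyc n E P F rows s" and q: "\<not> fst s 8 < fst s 9"
    and F: "\<And>u v. F u v \<Longrightarrow> u < n \<and> v < n"
  shows "fst s 7 = of_bool (\<exists>es. valid_seq F es \<and> good cyc n E P F es)"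
proof -
  have take: "take (fst s 8) rows = rows" using inv q unfolding search_inv_def by simp
  have I: "set rows = insert [] {es @ [e] |es e. es \<in> set rows \<and> e \<in> exts n F es}" "\<And>es. es \<in> set rows \<Longrightarrow> valid_seq F es"
    "fst s 7 = of_bool (\<exists>es\<in>set rows. good cyc n E P F es)"
    using inv unfolding search_inv_def take by auto
  have "es \<in> set rows" if "valid_seq F es" for es
    using that
  proof (induction es rule: rev_induct)
    case Nil
    then show ?case by (subst I(1)) simp
  next
    case (snoc e es)
    then have "es \<in> set rows" "e \<in> exts n F es"
      using valid_seq_prefix valid_seq_snoc[OF F] by blast+
    then show ?case by (subst I(1)) blast
  qed
  then have "(\<exists>es\<in>set rows. good cyc n E P F es) \<longleftrightarrow> (\<exists>es. valid_seq F es \<and> good cyc n E P F es)"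
    using I(2) by blast
  then show ?thesis using I(3) by simp
qed

definition solver :: "bool \<Rightarrow> prog" where
  "solver cyc = Seq (ccode 25 (init cyc)) (Seq (WhileLess 8 9 (ccode 25 (body cyc))) (Copy 0 7))"

text \<open>The factor (k + 1)! 2^k is needed for the body only, but as it is at least 1 it may
  multiply everything. The constant 3 pays for the test in each iteration, the last test and the
  final copy.\<close>

definition solver_time :: "bool \<Rightarrow> nat poly" where
  "solver_time cyc = ctime (init cyc) + ctime (body cyc) + [:3:]"

lemma rel_encode:
  fixes n :: nat and E F :: "nat set set"
  assumes "u < n" "v < n"
  shows "rel (encode n E \<pi> F) 0 0 u v \<longleftrightarrow> {u, v} \<in> E" "rel (encode n E \<pi> F) 1 0 u v \<longleftrightarrow> (u, v) \<in> \<pi>"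
    "rel (encode n E \<pi> F) 2 0 u v \<longleftrightarrow> {u, v} \<in> F"
proof -
  have "Suc u * n \<le> n * n" using assms(1) by (intro mult_right_mono) auto
  then have "idx n 0 u v < n * n" using assms(2) by (simp add: idx_def)
  moreover have "idx n 0 u v div n = u" "idx n 0 u v mod n = v" using assms by (auto simp: idx_def)
  ultimately show "rel (encode n E \<pi> F) 0 0 u v \<longleftrightarrow> {u, v} \<in> E" "rel (encode n E \<pi> F) 1 0 u v \<longleftrightarrow> (u, v) \<in> \<pi>"
    "rel (encode n E \<pi> F) 2 0 u v \<longleftrightarrow> {u, v} \<in> F"
    using assms unfolding rel_def encode_def bit_matrix_def by simp_all
qed

lemma runs_solver:
  fixes E F :: "nat set set"
  assumes E: "\<And>e. e \<in> E \<Longrightarrow> e \<subseteq> {..<n} \<and> card e = 2" and FE: "F \<subseteq> E" and k: "card F \<le> k"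
  shows "\<exists>s'. runs (solver cyc) (encode n E \<pi> F) (fact (k + 1) * 2 ^ k * poly (solver_time cyc) n) s' \<and>
    fst s' 0 = of_bool (if n = 0 then \<not> cyc else \<exists>es. valid_seq (\<lambda>u v. {u, v} \<in> F) es \<and>
      good cyc n (\<lambda>u v. {u, v} \<in> E) (\<lambda>u v. (u, v) \<in> \<pi>) (\<lambda>u v. {u, v} \<in> F) es)"
proof -
  let ?E = "\<lambda>u v. {u, v} \<in> E" and ?P = "\<lambda>u v. (u, v) \<in> \<pi>" and ?F = "\<lambda>u v. {u, v} \<in> F"
  let ?V = "{es. valid_seq ?F es}"
  let ?s = "encode n E \<pi> F"
  let ?K = "fact (k + 1) * 2 ^ k :: nat"
  have "F \<subseteq> Pow {..<n}" using E FE by blast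
  then have finF: "finite F" by (rule finite_subset) simp
  have V: "finite ?V" "card ?V \<le> ?K"
  proof -
    show "finite ?V" using card_valid_seq(1)[OF finF] E FE by blast
    have "card ?V \<le> fact (card F + 1) * 2 ^ card F" using card_valid_seq(2)[OF finF] E FE by blast
    also have "\<dots> \<le> ?K" using k by (intro mult_mono fact_mono power_increasing) auto
    finally show "card ?V \<le> ?K" .
  qed
  have En: "u < n \<and> v < n" if "?E u v" for u v using E[OF that] by simp
  have Fn: "u < n \<and> v < n" if "?F u v" for u v using En FE that by blast
  have s: "fst ?s 0 = n" "fst ?s i = 0" if "i \<noteq> 0" for i using that unfolding encode_def by auto
  have n: "fst ?s 0 = n" unfolding encode_def by simp
  obtain s1 where s1: "runs (ccode 25 (init cyc)) ?s (poly (ctime (init cyc)) n) s1" "agree 25 s1 (sem (init cyc) ?s)"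
    using runs_ccode[of 25 "init cyc" ?s] n by auto
  let ?T = "poly (ctime (body cyc)) n"
  have "\<exists>s2. runs (WhileLess 8 9 (ccode 25 (body cyc))) s1 (?K * (?T + 1) + 1) s2 \<and>
    fst s2 7 = of_bool (if n = 0 then \<not> cyc else \<exists>es. valid_seq ?F es \<and> good cyc n ?E ?P ?F es)"
  proof (cases "n = 0")
    case True
    have "sem (init cyc) ?s = ((fst ?s)(7 := of_bool (\<not> cyc)), snd ?s)"
      unfolding init_def using n True by simp
    then have "fst s1 7 = of_bool (\<not> cyc)" "fst s1 8 = 0" "fst s1 9 = 0"
      using s1(2) s(2)[of 8] s(2)[of 9] by (auto simp: agree_def)
    \<comment> \<open>Without vertices head and tail of the queue are both still 0, so the loop
      stops at its first test.\<close>
    moreover from this have "runs (WhileLess 8 9 (ccode 25 (body cyc))) s1 1 s1"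
      unfolding runs_def using exec.WhileFalse[of s1 8 9] by auto
    then have "runs (WhileLess 8 9 (ccode 25 (body cyc))) s1 (?K * (?T + 1) + 1) s1"
      by (rule runs_mono) simp
    ultimately show ?thesis using True by (intro exI[of _ s1]) simp
  next
    case False
    have "holds (ExF 16 TrueF) ?s" using n False by auto
    then have i: "sem (init cyc) ?s = ((fst ?s)(9 := 1), snd ?s)"
      unfolding init_def by (simp del: holds.simps)
    have gs: "graph_ctx n ?E ?P ?F ?s"
      unfolding graph_ctx_def using rel_encode n s(2)[of 4] by simp
    have "search_inv cyc n ?E ?P ?F [[]] (sem (init cyc) ?s)"
      unfolding i search_inv_def using gs s(2)[of 8] s(2)[of 7]
      by (auto simp: table_def valid_seq_def)
    then have inv: "\<exists>rows. search_inv cyc n ?E ?P ?F rows s1" using search_inv_agree s1(2) by blast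
    have "\<exists>s2. runs (WhileLess 8 9 (ccode 25 (body cyc))) s1 ((card ?V - fst s1 8) * (?T + 1) + 1) s2 \<and>
        (\<exists>rows. search_inv cyc n ?E ?P ?F rows s2) \<and> \<not> fst s2 8 < fst s2 9"
    \<comment> \<open>Each iteration advances the head by one, and the head stays below the number
      of rows, which are distinct valid sequences.\<close>
    proof (rule runs_While[where P = "\<lambda>s. \<exists>rows. search_inv cyc n ?E ?P ?F rows s" and \<mu> = "\<lambda>s. card ?V - fst s 8", OF _ inv])
      fix u assume "\<exists>rows. search_inv cyc n ?E ?P ?F rows u" and lt: "fst u 8 < fst u 9"
      then obtain rows where u: "search_inv cyc n ?E ?P ?F rows u" by blast
      have nu: "fst u 0 = n" using u unfolding search_inv_def graph_ctx_def by blast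
      obtain u' where u': "runs (ccode 25 (body cyc)) u ?T u'" "agree 25 u' (sem (body cyc) u)"
        using runs_ccode[of 25 "body cyc" u] nu by auto
      obtain rows' where r: "search_inv cyc n ?E ?P ?F rows' (sem (body cyc) u)" "fst (sem (body cyc) u) 8 = Suc (fst u 8)"
        using search_inv_body[OF u lt _ En Fn] False by blast
      have "fst u 8 < card ?V"
      proof -
        have "distinct rows" "set rows \<subseteq> ?V" using u unfolding search_inv_def by blast+
        then have "length rows \<le> card ?V" using card_mono[OF V(1)] distinct_card by metis
        then show ?thesis using lt u unfolding search_inv_def by simp
      qed
      moreover have "fst u' 8 = Suc (fst u 8)" using u'(2) r(2) by (simp add: agree_def)
      ultimately have "card ?V - fst u' 8 < card ?V - fst u 8" by simp
      then show "\<exists>s'. runs (ccode 25 (body cyc)) u ?T s' \<and> (\<exists>rows. search_inv cyc n ?E ?P ?F rows s') \<and>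
          card ?V - fst s' 8 < card ?V - fst u 8"
        using u'(1) search_inv_agree[OF r(1) u'(2)] by blast
    qed
    then obtain s2 rows where s2: "runs (WhileLess 8 9 (ccode 25 (body cyc))) s1 ((card ?V - fst s1 8) * (?T + 1) + 1) s2"
        "search_inv cyc n ?E ?P ?F rows s2" "\<not> fst s2 8 < fst s2 9" by blast
    have "card ?V - fst s1 8 \<le> ?K" using V(2) by (meson diff_le_self le_trans)
    then have "(card ?V - fst s1 8) * (?T + 1) + 1 \<le> ?K * (?T + 1) + 1"
      by (intro add_mono mult_right_mono) auto
    then show ?thesis using runs_mono[OF s2(1)] search_inv_final[OF s2(2,3) Fn] False
      by (intro exI[of _ s2]) simp
  qed
  then obtain s2 where s2: "runs (WhileLess 8 9 (ccode 25 (body cyc))) s1 (?K * (?T + 1) + 1) s2"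
    "fst s2 7 = of_bool (if n = 0 then \<not> cyc else \<exists>es. valid_seq ?F es \<and> good cyc n ?E ?P ?F es)" by blast
  have "1 \<le> ?K" by (simp add: Suc_le_eq del: fact_Suc)
  then have "(poly (ctime (init cyc)) n + 2) * 1 \<le> (poly (ctime (init cyc)) n + 2) * ?K" by (intro mult_left_mono) auto
  then have "poly (ctime (init cyc)) n + ((?K * (?T + 1) + 1) + 1) \<le> ?K * poly (solver_time cyc) n"
    unfolding solver_time_def by (simp add: algebra_simps del: fact_Suc)
  then have "runs (solver cyc) ?s (?K * poly (solver_time cyc) n) ((fst s2)(0 := fst s2 7), snd s2)"
    unfolding solver_def using runs_mono[OF runs_Seq[OF s1(1) runs_Seq[OF s2(1) runs_Copy]]] by blast
  then show ?thesis using s2(2) by (intro exI[of _ "((fst s2)(0 := fst s2 7), snd s2)"]) simp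
qed

section \<open>Correctness\<close>

lemma good_iff:
  fixes E F :: "nat set set"
  assumes E: "\<And>e. e \<in> E \<Longrightarrow> e \<subseteq> {..<n} \<and> card e = 2" and FE: "F \<subseteq> E" and po: "partial_order_on {..<n} \<pi>"
    and bg: "block_graph {..<n} (E - F)" and n: "0 < n"
  shows "(\<exists>es. valid_seq (\<lambda>u v. {u, v} \<in> F) es \<and>
      good cyc n (\<lambda>u v. {u, v} \<in> E) (\<lambda>u v. (u, v) \<in> \<pi>) (\<lambda>u v. {u, v} \<in> F) es) \<longleftrightarrow>
    (if cyc then pohcp {..<n} E \<pi> else pohpp {..<n} E \<pi>)"
proof -
  let ?E = "\<lambda>u v. {u, v} \<in> E" and ?P = "\<lambda>u v. (u, v) \<in> \<pi>" and ?F = "\<lambda>u v. {u, v} \<in> F"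
  let ?H = "\<lambda>u v. ?E u v \<and> \<not> ?F u v"
  have sym: "symp ?H" by (auto simp: symp_def insert_commute)
  have irr: "\<not> ?H u u" for u using E[of "{u}"] by auto
  have Hn: "u < n \<and> v < n" if "?H u v" for u v using E[of "{u, v}"] that by auto
  have adj: "?H u v" if "u < n" "u \<noteq> v" "?H\<^sup>*\<^sup>* u v" "\<And>x. x \<noteq> u \<Longrightarrow> x \<noteq> v \<Longrightarrow> avoid ?H x u v" for u v
    using block_graph_adjacent[of "{..<n}" "E - F" u v] E bg that by auto
  \<comment> \<open>Whichever vertex \<open>x\<close> is removed, \<open>w\<close> or
    \<open>w'\<close> remains and still joins \<open>a\<close> to \<open>b\<close>; in a block graph
    this makes them adjacent.\<close>
  have quad: "?H a b" if ab: "a \<noteq> b" "w \<noteq> w'" "?H a w" "?H a w'" "?H b w" "?H b w'" for a b w w'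
  proof (rule adj)
    show "a < n" using Hn ab(3) by blast
    have wb: "?H w b" "?H w' b" using ab(5,6) sympD[OF sym] by blast+
    show "?H\<^sup>*\<^sup>* a b" by (rule converse_rtranclp_into_rtranclp[where r = ?H, OF ab(3) r_into_rtranclp[where r = ?H, OF wb(1)]])
    fix x assume x: "x \<noteq> a" "x \<noteq> b"
    have "avoid ?H x a b" if "?H a z" "?H z b" "z \<noteq> x" for z
      by (rule avoid_trans[of ?H x a z b]) (use that x in \<open>auto intro!: avoid_step\<close>)
    then show "avoid ?H x a b" using ab(2-4) wb by metis
  qed (rule ab(1))
  have P: "\<And>u. u < n \<Longrightarrow> ?P u u" "\<And>u v. ?P u v \<Longrightarrow> ?P v u \<Longrightarrow> u = v" "\<And>u v w. ?P u v \<Longrightarrow> ?P v w \<Longrightarrow> ?P u w"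
    using po unfolding partial_order_on_def preorder_on_def refl_on_def antisym_def trans_def by blast+
  show ?thesis
  proof
    assume "\<exists>es. valid_seq ?F es \<and> good cyc n ?E ?P ?F es"
    then obtain s t T where st: "s < n" "accepts n s t T ?E ?H ?P" "cyc \<longrightarrow> ?E s t" unfolding good_def by blast
    have "\<exists>vs. distinct vs \<and> set vs = {..<n} \<and> (\<forall>i. Suc i < length vs \<longrightarrow> ?E (vs ! i) (vs ! Suc i)) \<and>
        (\<forall>i<length vs. \<forall>j<length vs. ?P (vs ! i) (vs ! j) \<longrightarrow> i \<le> j) \<and> hd vs = s \<and> last vs = t"
    proof (rule accepts_sound[OF st(2,1) _ sym])
      fix a b w w' assume "a \<noteq> b" "w \<noteq> w'" "?H a w" "?H a w'" "?H b w" "?H b w'"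
      then show "?H a b" by (rule quad)
    qed (use P in blast)+
    then obtain vs where vs: "distinct vs" "set vs = {..<n}" "\<forall>i. Suc i < length vs \<longrightarrow> ?E (vs ! i) (vs ! Suc i)"
      "\<forall>i<length vs. \<forall>j<length vs. ?P (vs ! i) (vs ! j) \<longrightarrow> i \<le> j" "hd vs = s" "last vs = t"
      by blast
    have "0 \<in> set vs" unfolding vs(2) using n by simp
    then have "vs \<noteq> []" by (metis empty_iff list.set(1))
    moreover have "ordered_ham_path {..<n} E vs" unfolding ordered_ham_path_def using vs(1-3) by blast
    moreover have "extending \<pi> vs" unfolding extending_def using vs(4) by blast
    moreover have "cyc \<longrightarrow> {hd vs, last vs} \<in> E" using st(3) unfolding vs(5,6) .
    ultimately show "if cyc then pohcp {..<n} E \<pi> else pohpp {..<n} E \<pi>"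
      unfolding pohcp_def pohpp_def by (cases cyc) (simp, blast)+
  next
    assume "if cyc then pohcp {..<n} E \<pi> else pohpp {..<n} E \<pi>"
    then obtain vs where vs: "ordered_ham_path {..<n} E vs" "extending \<pi> vs" "cyc \<longrightarrow> ?E (hd vs) (last vs)"
      unfolding pohcp_def pohpp_def by (auto split: if_splits)
    let ?es = "jumps ?F vs"
    have d: "distinct vs" "set vs = {..<n}" using vs(1) unfolding ordered_ham_path_def by auto
    have "0 \<in> set vs" unfolding d(2) using n by simp
    then have ne: "vs \<noteq> []" by (metis empty_iff list.set(1))
    have st: "hd vs < n" "last vs < n" using hd_in_set[OF ne] last_in_set[OF ne] d(2) by auto
    have "valid_seq ?F ?es"
      unfolding valid_seq_def using distinct_jumps[OF d(1), of ?F] set_jumps[of ?F vs] by auto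
    moreover have "accepts n (hd vs) (last vs) (forced_step ?H (set ?es) (segs (hd vs) ?es (last vs)))\<^sup>+\<^sup>+ ?E ?H ?P"
    proof (rule accepts_complete[OF d n _ _ _ sym irr])
      show "?E (vs ! i) (vs ! Suc i)" if "Suc i < length vs" for i
        using vs(1) that unfolding ordered_ham_path_def by blast
      show "i \<le> j" if "i < length vs" "j < length vs" "?P (vs ! i) (vs ! j)" for i j
        using vs(2) that unfolding extending_def by blast
      show "?H u v \<longleftrightarrow> ?E u v \<and> \<not> ?F u v" for u v ..
      show "u < n \<and> v < n" if "?H u v" for u v using that by (rule Hn)
      show "?H u v" if "u < n" "v < n" "u \<noteq> v" "?H\<^sup>*\<^sup>* u v" "\<And>x. x \<noteq> u \<Longrightarrow> x \<noteq> v \<Longrightarrow> avoid ?H x u v" for u v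
        using that(1,3-5) by (rule adj)
    qed
    ultimately show "\<exists>es. valid_seq ?F es \<and> good cyc n ?E ?P ?F es"
      unfolding good_def using st vs(3) by blast
  qed
qed

lemma solver_answers:
  fixes E F :: "nat set set"
  assumes "simple_graph {..<n} E" "partial_order_on {..<n} \<pi>" "F \<subseteq> E" "card F \<le> k" "block_graph {..<n} (E - F)"
  shows "answers_within (solver cyc) (encode n E \<pi> F) (if cyc then pohcp {..<n} E \<pi> else pohpp {..<n} E \<pi>)
    (fact (k + 1) * 2 ^ k * poly (solver_time cyc) n)"
proof -
  have E: "\<And>e. e \<in> E \<Longrightarrow> e \<subseteq> {..<n} \<and> card e = 2" using assms(1) unfolding simple_graph_def by blast
  have ans: "(if n = 0 then \<not> cyc else \<exists>es. valid_seq (\<lambda>u v. {u, v} \<in> F) es \<and>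
      good cyc n (\<lambda>u v. {u, v} \<in> E) (\<lambda>u v. (u, v) \<in> \<pi>) (\<lambda>u v. {u, v} \<in> F) es) \<longleftrightarrow>
    (if cyc then pohcp {..<n} E \<pi> else pohpp {..<n} E \<pi>)"
  proof (cases "n = 0")
    case True
    then show ?thesis by (auto simp: pohcp_def pohpp_def ordered_ham_path_def extending_def)
  next
    case False
    then show ?thesis using good_iff[OF E assms(3,2,5)] by simp
  qed
  show ?thesis
    using runs_solver[OF E assms(3,4), of cyc \<pi>]
    unfolding answers_within_def runs_def of_bool_def ans by blast
qed

text \<open>The witnesses \<open>solver\<close> and \<open>solver_time\<close> depend only on which
  of the two problems is meant. The parameter k enters solely through the bound on the number of
  valid sequences.\<close>

theorem theorem4p5:
  shows "(\<exists>(c :: prog) (p :: nat poly). \<forall>(n :: nat) (k :: nat) (E :: nat set set) (\<pi> :: nat rel) (F :: nat set set).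
            simple_graph {..<n} E \<and> partial_order_on {..<n} \<pi> \<and>
            F \<subseteq> E \<and> card F \<le> k \<and> block_graph {..<n} (E - F) \<longrightarrow>
            answers_within c (encode n E \<pi> F) (pohpp {..<n} E \<pi>) (fact (k + 1) * 2 ^ k * poly p n))
       \<and> (\<exists>(c :: prog) (p :: nat poly). \<forall>(n :: nat) (k :: nat) (E :: nat set set) (\<pi> :: nat rel) (F :: nat set set).
            simple_graph {..<n} E \<and> partial_order_on {..<n} \<pi> \<and>
            F \<subseteq> E \<and> card F \<le> k \<and> block_graph {..<n} (E - F) \<longrightarrow>
            answers_within c (encode n E \<pi> F) (pohcp {..<n} E \<pi>) (fact (k + 1) * 2 ^ k * poly p n))"
  by (intro conjI exI allI impI; elim conjE;
      (rule solver_answers[where cyc = False, unfolded if_False] |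
       rule solver_answers[where cyc = True, unfolded if_True]); assumption)

end
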